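(* Let $X$ be an infinite dimensional complex Banach space and let $T \in L(X)$. The following conditions are equivalent: (i) $\mathrm{int}\, \sigma_{LD}(T) \subset \sigma_{lw}(T)$; (ii) $T$ has SVEP at every $\lambda \notin \sigma_{lw}(T)$; (iii) $\sigma_{LD}(T) \subset \sigma_{lw}(T)$; (iv) a-Browder's theorem holds for $T'$ and $\sigma(T)=\sigma_{su}(T)$.
   Context: $L(X)$ is the algebra of bounded linear operators on $X$, $\sigma(T)$ is the spectrum of $T$, $T'$ is the adjoint operator of $T$ acting on the dual space of $X$, and $\mathrm{int}\,F$ is the interior of $F\subset\mathbb{C}$. $T$ has the single-valued extension property (SVEP) at $\lambda_0\in\mathbb{C}$ if for every open disc $D_{\lambda_0}$ centered at $\lambda_0$ the only analytic function $f:D_{\lambda_0}\to X$ satisfying $(T-\lambda I)f(\lambda)=0$ for all $\lambda\in D_{\lambda_0}$ is $f\equiv 0$. For a bounded operator $S$ on a complex Banach space, $N(S)$ and $R(S)$ are the null space and range, $\alpha(S)=\dim N(S)$, $\beta(S)=\mathrm{codim}\,R(S)$. $S$ is upper semi-Fredholm (resp. lower semi-Fredholm) if $R(S)$ is closed and $\alpha(S)<\infty$ (resp. $\beta(S)<\infty$); then $\mathrm{ind}(S)=\alpha(S)-\beta(S)$. $S$ is upper semi-Weyl if it is upper semi-Fredholm with $\mathrm{ind}(S)\le 0$, and lower semi-Weyl if it is lower semi-Fredholm with $\mathrm{ind}(S)\ge 0$. The ascent $p(S)$ is the smallest integer $p\ge 0$ with $N(S^p)=N(S^{p+1})$ ($\infty$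 if none exists). $S$ is upper semi-Browder if it is upper semi-Fredholm with $p(S)<\infty$. $S$ is left Drazin invertible if $p=p(S)<\infty$ and $R(S^{p+1})$ is closed. For such $S$, the spectra are the sets of $\lambda\in\mathbb{C}$ such that: $S-\lambda I$ is not surjective ($\sigma_{su}(S)$); $S-\lambda I$ is not upper semi-Weyl ($\sigma_{uw}(S)$); $S-\lambda I$ is not lower semi-Weyl ($\sigma_{lw}(S)$); $S-\lambda I$ is not upper semi-Browder ($\sigma_{ub}(S)$); $S-\lambda I$ is not left Drazin invertible ($\sigma_{LD}(S)$). a-Browder's theorem holds for $S$ if $\sigma_{uw}(S)=\sigma_{ub}(S)$. *)

theory Defs
  imports "HOL-Analysis.Analysis"
begin

section \<open>Complex Banach spaces\<close>

class scaleC = scaleR +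
  fixes scaleC :: "complex \<Rightarrow> 'a \<Rightarrow> 'a" (infixr \<open>*\<^sub>C\<close> 75)
  assumes scaleR_scaleC: "scaleR r = scaleC (complex_of_real r)"

class complex_normed_vector = real_normed_vector + scaleC +
  assumes scaleC_add_right: "a *\<^sub>C (x + y) = a *\<^sub>C x + a *\<^sub>C y"
    and scaleC_add_left: "(a + b) *\<^sub>C x = a *\<^sub>C x + b *\<^sub>C x"
    and scaleC_scaleC: "a *\<^sub>C b *\<^sub>C x = (a * b) *\<^sub>C x"
    and scaleC_one: "1 *\<^sub>C x = x"
    and norm_scaleC: "norm (a *\<^sub>C x) = cmod a * norm x"

class complex_banach = complex_normed_vector + banach

global_interpretation complex_vector:
  vector_space "scaleC :: complex \<Rightarrow> 'a::complex_normed_vector \<Rightarrow> 'a"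
  by unfold_locales (simp_all add: scaleC_add_right scaleC_add_left scaleC_scaleC scaleC_one)

instantiation complex :: complex_banach
begin

definition scaleC_complex :: "complex \<Rightarrow> complex \<Rightarrow> complex"
  where "scaleC_complex a z = a * z"

instance
  by standard (auto simp: scaleC_complex_def fun_eq_iff algebra_simps norm_mult scaleR_conv_of_real)

end

lemma scaleC_right_bounded_linear:
  "bounded_linear (\<lambda>x::'a::complex_normed_vector. a *\<^sub>C x)"
  by (rule bounded_linear_intro[where K="cmod a"])
    (simp_all add: scaleC_add_right scaleR_scaleC scaleC_scaleC norm_scaleC mult.commute)


section \<open>Bounded complex-linear operators and the dual space\<close>

definition bounded_clinear :: "('a::complex_normed_vector \<Rightarrow> 'b::complex_normed_vector) \<Rightarrow> bool"
  where "bounded_clinear f \<longleftrightarrow> bounded_linear f \<and> (\<forall>a x. f (a *\<^sub>C x) = a *\<^sub>C f x)"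

typedef (overloaded) ('a, 'b) cblinfun (\<open>(_ \<Rightarrow>\<^sub>C\<^sub>L /_)\<close> [22, 21] 21) =
  "{f :: 'a::complex_normed_vector \<Rightarrow> 'b::complex_normed_vector. bounded_clinear f}"
  morphisms cblinfun_apply CBlinfun
  by (rule exI[of _ "\<lambda>_. 0"]) (simp add: bounded_clinear_def)

setup_lifting type_definition_cblinfun

instantiation cblinfun :: (complex_normed_vector, complex_normed_vector) complex_normed_vector
begin

lift_definition norm_cblinfun :: "'a \<Rightarrow>\<^sub>C\<^sub>L 'b \<Rightarrow> real" is onorm .

lift_definition minus_cblinfun :: "'a \<Rightarrow>\<^sub>C\<^sub>L 'b \<Rightarrow> 'a \<Rightarrow>\<^sub>C\<^sub>L 'b \<Rightarrow> 'a \<Rightarrow>\<^sub>C\<^sub>L 'b"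
  is "\<lambda>f g x. f x - g x"
  by (simp add: bounded_clinear_def bounded_linear_sub complex_vector.scale_right_diff_distrib)

lift_definition uminus_cblinfun :: "'a \<Rightarrow>\<^sub>C\<^sub>L 'b \<Rightarrow> 'a \<Rightarrow>\<^sub>C\<^sub>L 'b" is "\<lambda>f x. - f x"
  by (simp add: bounded_clinear_def bounded_linear_minus)

lift_definition zero_cblinfun :: "'a \<Rightarrow>\<^sub>C\<^sub>L 'b" is "\<lambda>x. 0"
  by (simp add: bounded_clinear_def)

lift_definition plus_cblinfun :: "'a \<Rightarrow>\<^sub>C\<^sub>L 'b \<Rightarrow> 'a \<Rightarrow>\<^sub>C\<^sub>L 'b \<Rightarrow> 'a \<Rightarrow>\<^sub>C\<^sub>L 'b"
  is "\<lambda>f g x. f x + g x"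
  by (simp add: bounded_clinear_def bounded_linear_add scaleC_add_right)

lift_definition scaleR_cblinfun :: "real \<Rightarrow> 'a \<Rightarrow>\<^sub>C\<^sub>L 'b \<Rightarrow> 'a \<Rightarrow>\<^sub>C\<^sub>L 'b" is "\<lambda>r f x. r *\<^sub>R f x"
  by (auto simp add: bounded_clinear_def scaleR_scaleC scaleC_scaleC mult.commute
      intro: bounded_linear_compose[OF scaleC_right_bounded_linear])

lift_definition scaleC_cblinfun :: "complex \<Rightarrow> 'a \<Rightarrow>\<^sub>C\<^sub>L 'b \<Rightarrow> 'a \<Rightarrow>\<^sub>C\<^sub>L 'b" is "\<lambda>a f x. a *\<^sub>C f x"
  by (auto simp add: bounded_clinear_def scaleC_scaleC mult.commute
      intro: bounded_linear_compose[OF scaleC_right_bounded_linear])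

definition dist_cblinfun :: "'a \<Rightarrow>\<^sub>C\<^sub>L 'b \<Rightarrow> 'a \<Rightarrow>\<^sub>C\<^sub>L 'b \<Rightarrow> real"
  where "dist_cblinfun a b = norm (a - b)"

definition uniformity_cblinfun :: "(('a \<Rightarrow>\<^sub>C\<^sub>L 'b) \<times> ('a \<Rightarrow>\<^sub>C\<^sub>L 'b)) filter"
  where "uniformity_cblinfun = (INF e\<in>{0 <..}. principal {(x, y). dist x y < e})"

definition open_cblinfun :: "('a \<Rightarrow>\<^sub>C\<^sub>L 'b) set \<Rightarrow> bool"
  where "open_cblinfun S = (\<forall>x\<in>S. \<forall>\<^sub>F (x', y) in uniformity. x' = x \<longrightarrow> y \<in> S)"

definition sgn_cblinfun :: "'a \<Rightarrow>\<^sub>C\<^sub>L 'b \<Rightarrow> 'a \<Rightarrow>\<^sub>C\<^sub>L 'b"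
  where "sgn_cblinfun x = scaleR (inverse (norm x)) x"

instance
proof
  fix a b :: complex and f g h :: "'a \<Rightarrow>\<^sub>C\<^sub>L 'b" and r s :: real
  show "f + g + h = f + (g + h)" "f + g = g + f" "0 + f = f" "- f + f = 0" "f - g = f + - g"
    by (transfer; simp add: fun_eq_iff algebra_simps)+
  show "r *\<^sub>R (f + g) = r *\<^sub>R f + r *\<^sub>R g" "(r + s) *\<^sub>R f = r *\<^sub>R f + s *\<^sub>R f"
    "r *\<^sub>R s *\<^sub>R f = (r * s) *\<^sub>R f" "1 *\<^sub>R f = f"
    by (transfer; simp add: fun_eq_iff algebra_simps)+
  show "((*\<^sub>R) r :: 'a \<Rightarrow>\<^sub>C\<^sub>L 'b \<Rightarrow> _) = (*\<^sub>C) (complex_of_real r)"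
    by (rule ext, transfer) (simp add: scaleR_scaleC)
  show "a *\<^sub>C (f + g) = a *\<^sub>C f + a *\<^sub>C g" "(a + b) *\<^sub>C f = a *\<^sub>C f + b *\<^sub>C f"
    "a *\<^sub>C b *\<^sub>C f = (a * b) *\<^sub>C f" "1 *\<^sub>C f = f"
    by (transfer; simp add: fun_eq_iff scaleC_add_right scaleC_add_left scaleC_scaleC)+
  show "sgn f = inverse (norm f) *\<^sub>R f" by (rule sgn_cblinfun_def)
  show "dist f g = norm (f - g)" by (rule dist_cblinfun_def)
  show "(uniformity :: (('a \<Rightarrow>\<^sub>C\<^sub>L 'b) \<times> _) filter) = (INF e\<in>{0 <..}. principal {(x, y). dist x y < e})"
    by (rule uniformity_cblinfun_def)
  show "open U = (\<forall>x\<in>U. \<forall>\<^sub>F (x', y) in uniformity. x' = x \<longrightarrow> y \<in> U)"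
    for U :: "('a \<Rightarrow>\<^sub>C\<^sub>L 'b) set"
    by (rule open_cblinfun_def)
  show "(norm f = 0) = (f = 0)"
    by transfer (simp add: bounded_clinear_def onorm_eq_0 fun_eq_iff)
  show "norm (f + g) \<le> norm f + norm g"
    by transfer (simp add: bounded_clinear_def onorm_triangle)
  show "norm (r *\<^sub>R f) = \<bar>r\<bar> * norm f"
    by transfer (simp add: bounded_clinear_def onorm_scaleR)
  show "norm (a *\<^sub>C f) = cmod a * norm f"
  proof transfer
    fix a and f :: "'a \<Rightarrow> 'b"
    assume "bounded_clinear f"
    then have f: "bounded_linear f" by (simp add: bounded_clinear_def)
    have "norm (a *\<^sub>C f x) / norm x = norm (cmod a *\<^sub>R f x) / norm x" for x
      by (simp only: norm_scaleC norm_scaleR abs_norm_cancel)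
    then have "onorm (\<lambda>x. a *\<^sub>C f x) = onorm (\<lambda>x. cmod a *\<^sub>R f x)"
      unfolding onorm_def by (rule arg_cong[where f=Sup, OF image_cong[OF refl]])
    also have "\<dots> = cmod a * onorm f"
      by (simp add: onorm_scaleR[OF f])
    finally show "onorm (\<lambda>x. a *\<^sub>C f x) = cmod a * onorm f" .
  qed
qed

end

lift_definition blinfun_of_cblinfun ::
  "'a::complex_normed_vector \<Rightarrow>\<^sub>C\<^sub>L 'b::complex_normed_vector \<Rightarrow> 'a \<Rightarrow>\<^sub>L 'b"
  is "\<lambda>f. f" by (simp add: bounded_clinear_def)

lemma dist_blinfun_of_cblinfun: "dist (blinfun_of_cblinfun f) (blinfun_of_cblinfun g) = dist f g"
  unfolding dist_norm by transfer simp

instance cblinfun :: (complex_normed_vector, complex_banach) complex_banach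
proof
  fix F :: "nat \<Rightarrow> 'a \<Rightarrow>\<^sub>C\<^sub>L 'b"
  assume "Cauchy F"
  then have "Cauchy (\<lambda>n. blinfun_of_cblinfun (F n))"
    by (simp add: Cauchy_def dist_blinfun_of_cblinfun)
  then obtain L where L: "(\<lambda>n. blinfun_of_cblinfun (F n)) \<longlonglongrightarrow> L"
    by (auto simp: Cauchy_convergent_iff convergent_def)
  have lim: "(\<lambda>n. cblinfun_apply (F n) x) \<longlonglongrightarrow> blinfun_apply L x" for x
    using blinfun.tendsto[OF L tendsto_const, of x] by (simp add: blinfun_of_cblinfun.rep_eq)
  have "blinfun_apply L (a *\<^sub>C x) = a *\<^sub>C blinfun_apply L x" for a x
  proof (rule LIMSEQ_unique[OF lim])
    have "(\<lambda>n. a *\<^sub>C cblinfun_apply (F n) x) \<longlonglongrightarrow> a *\<^sub>C blinfun_apply L x"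
      by (rule bounded_linear.tendsto[OF scaleC_right_bounded_linear lim])
    moreover have "cblinfun_apply (F n) (a *\<^sub>C x) = a *\<^sub>C cblinfun_apply (F n) x" for n
      using cblinfun_apply[of "F n"] by (simp add: bounded_clinear_def)
    ultimately show "(\<lambda>n. cblinfun_apply (F n) (a *\<^sub>C x)) \<longlonglongrightarrow> a *\<^sub>C blinfun_apply L x"
      by simp
  qed
  then have "bounded_clinear (blinfun_apply L)"
    by (simp add: bounded_clinear_def blinfun.bounded_linear_right)
  then have "L = blinfun_of_cblinfun (CBlinfun (blinfun_apply L))"
    by (intro blinfun_eqI) (simp add: blinfun_of_cblinfun.rep_eq CBlinfun_inverse)
  then have "F \<longlonglongrightarrow> CBlinfun (blinfun_apply L)"
    using L by (metis (no_types, lifting) dist_blinfun_of_cblinfun lim_sequentially)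
  then show "convergent F"
    by (rule convergentI)
qed

lift_definition id_cblinfun :: "'a::complex_normed_vector \<Rightarrow>\<^sub>C\<^sub>L 'a" is "\<lambda>x. x"
  by (simp add: bounded_clinear_def)

lift_definition cblinfun_compose :: "'b::complex_normed_vector \<Rightarrow>\<^sub>C\<^sub>L 'c::complex_normed_vector
    \<Rightarrow> 'a::complex_normed_vector \<Rightarrow>\<^sub>C\<^sub>L 'b \<Rightarrow> 'a \<Rightarrow>\<^sub>C\<^sub>L 'c" (infixl \<open>o\<^sub>C\<^sub>L\<close> 67)
  is "\<lambda>f g x. f (g x)"
  by (simp add: bounded_clinear_def bounded_linear_compose)

type_synonym 'a cdual = "'a \<Rightarrow>\<^sub>C\<^sub>L complex"

lemma bounded_clinear_compose_right:
  fixes T :: "'a::complex_normed_vector \<Rightarrow>\<^sub>C\<^sub>L 'b::complex_normed_vector"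
  shows "bounded_clinear (\<lambda>f :: 'b \<Rightarrow>\<^sub>C\<^sub>L 'c::complex_normed_vector. f o\<^sub>C\<^sub>L T)"
proof -
  have "norm (f o\<^sub>C\<^sub>L T) \<le> norm f * norm T" for f :: "'b \<Rightarrow>\<^sub>C\<^sub>L 'c"
    by transfer (simp add: bounded_clinear_def onorm_compose[unfolded o_def])
  moreover have "(f + g) o\<^sub>C\<^sub>L T = f o\<^sub>C\<^sub>L T + g o\<^sub>C\<^sub>L T" for f g :: "'b \<Rightarrow>\<^sub>C\<^sub>L 'c"
    by transfer simp
  moreover have "(r *\<^sub>R f) o\<^sub>C\<^sub>L T = r *\<^sub>R (f o\<^sub>C\<^sub>L T)" for r and f :: "'b \<Rightarrow>\<^sub>C\<^sub>L 'c"
    by transfer simp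
  moreover have "(a *\<^sub>C f) o\<^sub>C\<^sub>L T = a *\<^sub>C (f o\<^sub>C\<^sub>L T)" for a and f :: "'b \<Rightarrow>\<^sub>C\<^sub>L 'c"
    by transfer simp
  ultimately show ?thesis
    unfolding bounded_clinear_def by (blast intro: bounded_linear_intro)
qed

text \<open>The Banach space adjoint (no complex conjugation is involved).\<close>

definition dual_adjoint :: "'a::complex_normed_vector \<Rightarrow>\<^sub>C\<^sub>L 'a \<Rightarrow> 'a cdual \<Rightarrow>\<^sub>C\<^sub>L 'a cdual"
  where "dual_adjoint T = CBlinfun (\<lambda>\<phi>. \<phi> o\<^sub>C\<^sub>L T)"

lemma dual_adjoint_apply: "cblinfun_apply (dual_adjoint T) \<phi> = \<phi> o\<^sub>C\<^sub>L T"
  by (simp add: dual_adjoint_def CBlinfun_inverse bounded_clinear_compose_right)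


section \<open>Dimension, codimension and semi-Fredholm theory\<close>

abbreviation kernel :: "'a::complex_normed_vector \<Rightarrow>\<^sub>C\<^sub>L 'b::complex_normed_vector \<Rightarrow> 'a set"
  where "kernel S \<equiv> {x. cblinfun_apply S x = 0}"

abbreviation range_of :: "'a::complex_normed_vector \<Rightarrow>\<^sub>C\<^sub>L 'b::complex_normed_vector \<Rightarrow> 'b set"
  where "range_of S \<equiv> range (cblinfun_apply S)"

text \<open>The library's \<open>dim\<close> is \<open>0\<close> on infinite dimensional subspaces, hence the case distinction.\<close>

definition cdimension :: "'a::complex_normed_vector set \<Rightarrow> enat"
  where "cdimension V =
    (if \<exists>B. finite B \<and> V \<subseteq> complex_vector.span B then enat (complex_vector.dim V) else \<infinity>)"

text \<open>The cosets \<open>b + M\<close> with \<open>b \<in> B\<close> are pairwise distinct and linearly independent in the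
  quotient of the whole space by the subspace \<open>M\<close>.\<close>

definition independent_mod :: "'a::complex_normed_vector set \<Rightarrow> 'a set \<Rightarrow> bool"
  where "independent_mod M B \<longleftrightarrow>
    (\<forall>u. (\<Sum>b\<in>B. u b *\<^sub>C b) \<in> M \<longrightarrow> (\<forall>b\<in>B. u b = 0))"

text \<open>The dimension of the quotient by \<open>M\<close>: the supremum of the sizes of its finite linearly
  independent subsets.\<close>

definition codimension :: "'a::complex_normed_vector set \<Rightarrow> enat"
  where "codimension M = (SUP B \<in> {B. finite B \<and> independent_mod M B}. enat (card B))"

definition nullity :: "'a::complex_normed_vector \<Rightarrow>\<^sub>C\<^sub>L 'a \<Rightarrow> enat"
  where "nullity S = cdimension (kernel S)"

definition deficiency :: "'a::complex_normed_vector \<Rightarrow>\<^sub>C\<^sub>L 'a \<Rightarrow> enat"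
  where "deficiency S = codimension (range_of S)"

definition upper_semi_Fredholm :: "'a::complex_normed_vector \<Rightarrow>\<^sub>C\<^sub>L 'a \<Rightarrow> bool"
  where "upper_semi_Fredholm S \<longleftrightarrow> closed (range_of S) \<and> nullity S < \<infinity>"

definition lower_semi_Fredholm :: "'a::complex_normed_vector \<Rightarrow>\<^sub>C\<^sub>L 'a \<Rightarrow> bool"
  where "lower_semi_Fredholm S \<longleftrightarrow> closed (range_of S) \<and> deficiency S < \<infinity>"

text \<open>Only used for semi-Fredholm operators, where \<open>\<infinity> - \<infinity>\<close> does not occur.\<close>

definition index :: "'a::complex_normed_vector \<Rightarrow>\<^sub>C\<^sub>L 'a \<Rightarrow> ereal"
  where "index S = ereal_of_enat (nullity S) - ereal_of_enat (deficiency S)"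

definition upper_semi_Weyl :: "'a::complex_normed_vector \<Rightarrow>\<^sub>C\<^sub>L 'a \<Rightarrow> bool"
  where "upper_semi_Weyl S \<longleftrightarrow> upper_semi_Fredholm S \<and> index S \<le> 0"

definition lower_semi_Weyl :: "'a::complex_normed_vector \<Rightarrow>\<^sub>C\<^sub>L 'a \<Rightarrow> bool"
  where "lower_semi_Weyl S \<longleftrightarrow> lower_semi_Fredholm S \<and> index S \<ge> 0"

fun cblinfun_power :: "'a::complex_normed_vector \<Rightarrow>\<^sub>C\<^sub>L 'a \<Rightarrow> nat \<Rightarrow> 'a \<Rightarrow>\<^sub>C\<^sub>L 'a"
  where
    "cblinfun_power S 0 = id_cblinfun"
  | "cblinfun_power S (Suc n) = S o\<^sub>C\<^sub>L cblinfun_power S n"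

definition ascent :: "'a::complex_normed_vector \<Rightarrow>\<^sub>C\<^sub>L 'a \<Rightarrow> enat"
  where "ascent S =
    (if \<exists>p. kernel (cblinfun_power S p) = kernel (cblinfun_power S (p + 1))
     then enat (LEAST p. kernel (cblinfun_power S p) = kernel (cblinfun_power S (p + 1)))
     else \<infinity>)"

definition upper_semi_Browder :: "'a::complex_normed_vector \<Rightarrow>\<^sub>C\<^sub>L 'a \<Rightarrow> bool"
  where "upper_semi_Browder S \<longleftrightarrow> upper_semi_Fredholm S \<and> ascent S < \<infinity>"

definition left_Drazin_invertible :: "'a::complex_normed_vector \<Rightarrow>\<^sub>C\<^sub>L 'a \<Rightarrow> bool"
  where "left_Drazin_invertible S \<longleftrightarrow>
    (\<exists>p. ascent S = enat p \<and> closed (range_of (cblinfun_power S (p + 1))))"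


section \<open>Spectra\<close>

definition spectrum :: "'a::complex_normed_vector \<Rightarrow>\<^sub>C\<^sub>L 'a \<Rightarrow> complex set"
  where "spectrum S = {l. \<not> (\<exists>R. R o\<^sub>C\<^sub>L (S - l *\<^sub>C id_cblinfun) = id_cblinfun \<and>
    (S - l *\<^sub>C id_cblinfun) o\<^sub>C\<^sub>L R = id_cblinfun)}"

definition surjectivity_spectrum :: "'a::complex_normed_vector \<Rightarrow>\<^sub>C\<^sub>L 'a \<Rightarrow> complex set"
  where "surjectivity_spectrum S = {l. \<not> surj (cblinfun_apply (S - l *\<^sub>C id_cblinfun))}"

definition upper_semi_Weyl_spectrum :: "'a::complex_normed_vector \<Rightarrow>\<^sub>C\<^sub>L 'a \<Rightarrow> complex set"
  where "upper_semi_Weyl_spectrum S = {l. \<not> upper_semi_Weyl (S - l *\<^sub>C id_cblinfun)}"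

definition lower_semi_Weyl_spectrum :: "'a::complex_normed_vector \<Rightarrow>\<^sub>C\<^sub>L 'a \<Rightarrow> complex set"
  where "lower_semi_Weyl_spectrum S = {l. \<not> lower_semi_Weyl (S - l *\<^sub>C id_cblinfun)}"

definition upper_semi_Browder_spectrum :: "'a::complex_normed_vector \<Rightarrow>\<^sub>C\<^sub>L 'a \<Rightarrow> complex set"
  where "upper_semi_Browder_spectrum S = {l. \<not> upper_semi_Browder (S - l *\<^sub>C id_cblinfun)}"

definition left_Drazin_spectrum :: "'a::complex_normed_vector \<Rightarrow>\<^sub>C\<^sub>L 'a \<Rightarrow> complex set"
  where "left_Drazin_spectrum S = {l. \<not> left_Drazin_invertible (S - l *\<^sub>C id_cblinfun)}"

definition a_Browder_theorem_holds :: "'a::complex_normed_vector \<Rightarrow>\<^sub>C\<^sub>L 'a \<Rightarrow> bool"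
  where "a_Browder_theorem_holds S \<longleftrightarrow> upper_semi_Weyl_spectrum S = upper_semi_Browder_spectrum S"


section \<open>The single-valued extension property\<close>

text \<open>The library's \<open>holomorphic_on\<close> only covers functions with values in a field. For
  vector-valued \<open>f\<close> on an open set, analyticity is complex differentiability at every point: the
  Frechet derivative exists and has the form \<open>h \<mapsto> h *\<^sub>C d\<close>.\<close>

definition vector_analytic_on :: "(complex \<Rightarrow> 'a::complex_normed_vector) \<Rightarrow> complex set \<Rightarrow> bool"
  where "vector_analytic_on f D \<longleftrightarrow> (\<forall>z\<in>D. \<exists>d. (f has_derivative (\<lambda>h. h *\<^sub>C d)) (at z))"

definition SVEP_at :: "'a::complex_normed_vector \<Rightarrow>\<^sub>C\<^sub>L 'a \<Rightarrow> complex \<Rightarrow> bool"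
  where "SVEP_at T l0 \<longleftrightarrow>
    (\<forall>r>0. \<forall>f. vector_analytic_on f (ball l0 r) \<and>
        (\<forall>l\<in>ball l0 r. cblinfun_apply (T - l *\<^sub>C id_cblinfun) (f l) = 0)
      \<longrightarrow> (\<forall>l\<in>ball l0 r. f l = 0))"

end

theory Submission
  imports Defs "HOL-Complex_Analysis.Conformal_Mappings"
begin

text \<open>
  The conditions are numbered (i) to (iv) in the order in which they occur in the theorem, and the implications run
  (iii) \<Longrightarrow> (i) \<Longrightarrow> (ii) \<Longrightarrow> (iii) \<Longrightarrow> (iv) \<Longrightarrow> (ii). Fix \<open>l\<close> outside the lower semi-Weyl spectrum of \<open>T\<close> and write \<open>S = T - l\<close>.
  Then \<open>R(S)\<close> has finite codimension, and so has every \<open>R(S^n)\<close>; an operator range of finite codimension is closed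
  (\<open>closed_range_finite_codimension\<close>). An eigenfunction is an analytic \<open>f\<close> with \<open>(T - z) (f z) = 0\<close>; the single-valued
  extension property says that it vanishes.

  (i) \<Longrightarrow> (ii). Since \<open>f z\<close> is an eigenvector of \<open>T - m\<close> for \<open>z - m\<close>, it lies in \<open>R((T - m)^n)\<close> for all \<open>n\<close> and
  \<open>z \<noteq> m\<close>. If \<open>T - m\<close> is left Drazin invertible, continuity puts \<open>f m\<close> into a closed range that meets
  \<open>N(T - m)\<close> trivially, so \<open>f m = 0\<close>. By (i) such points \<open>m\<close> accumulate at \<open>l\<close>, or \<open>l\<close> is one of them; in the
  latter case \<open>S\<close> is bounded below on some \<open>R(S^p)\<close> and \<open>f\<close> vanishes near \<open>l\<close>. The identity theorem
  concludes (\<open>SVEP_of_left_Drazin_accumulation\<close>).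

  (ii) \<Longrightarrow> (iii). The increasing subspaces \<open>R(S) + N(S^n)\<close> become constant, and with them the decreasing subspaces
  \<open>N(S) \<inter> R(S^n)\<close>. Their final value lies in \<open>V\<close>, the intersection of all \<open>R(S^n)\<close>, and \<open>S\<close> maps the closed
  subspace \<open>V\<close> onto itself. A nonzero \<open>x\<close> in \<open>N(S) \<inter> V\<close> would start a backward orbit under \<open>S\<close> of geometric growth,
  and the power series with this orbit as coefficients would be a nonzero eigenfunction. So \<open>N(S) \<inter> R(S^n) = 0\<close> for
  some \<open>n\<close>, which is finite ascent (\<open>SVEP_imp_finite_ascent\<close>).

  (iii) \<Longrightarrow> (iv). Finite ascent and finite deficiency make the nullity at most the deficiency, and equality gives finite
  descent (\<open>nullity_versus_deficiency\<close>). Hence \<open>S\<close>, which has nonnegative index, has index zero and finite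
  descent; in particular it is injective if it is surjective. The adjoint is upper semi-Weyl exactly if \<open>S\<close> is
  lower semi-Weyl (\<open>upper_semi_Weyl_dual_adjoint_iff\<close>, which rests on the closed range theorem), and descent of \<open>S\<close> is
  ascent of the adjoint.

  (iv) \<Longrightarrow> (ii). The same duality now gives \<open>S\<close> finite descent, and then \<open>T - z\<close> is surjective for all \<open>z \<noteq> l\<close> near
  \<open>l\<close> (\<open>surjective_perturbation\<close>). As the spectrum is the surjectivity spectrum, \<open>T - z\<close> is injective there, and
  eigenfunctions vanish.

  The functional analysis behind this is the Hahn-Banach theorem, the open mapping theorem for closed subspaces, both
  halves of the closed range theorem, and linear algebra modulo a subspace.
\<close>

section \<open>The Hahn-Banach theorem\<close>

definition sublinear :: "('a::real_vector \<Rightarrow> real) \<Rightarrow> bool"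
  where "sublinear q \<longleftrightarrow>
    (\<forall>x y. q (x + y) \<le> q x + q y) \<and> (\<forall>r x. 0 \<le> r \<longrightarrow> q (r *\<^sub>R x) = r * q x)"

lemma sublinear_add: "sublinear q \<Longrightarrow> q (x + y) \<le> q x + q y"
  and sublinear_scale: "sublinear q \<Longrightarrow> 0 \<le> r \<Longrightarrow> q (r *\<^sub>R x) = r * q x"
  by (simp_all add: sublinear_def)

lemma sublinear_zero: "sublinear q \<Longrightarrow> q 0 = 0"
  using sublinear_scale[of q 0 0] by simp

lemma sublinear_neg: "sublinear q \<Longrightarrow> - q (- x) \<le> q x"
  using sublinear_add[of q x "- x"] by (simp add: sublinear_zero)

lemma sublinearI:
  assumes add: "\<And>x y. q (x + y) \<le> q x + q y"
    and scale: "\<And>r x. 0 < r \<Longrightarrow> q (r *\<^sub>R x) \<le> r * q x" and zero: "q 0 = 0"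
  shows "sublinear q"
proof -
  have "q (r *\<^sub>R x) = r * q x" if "0 \<le> r" for r x
  proof (cases "r = 0")
    case False
    with that have r: "0 < r" by simp
    have "q (inverse r *\<^sub>R r *\<^sub>R x) \<le> inverse r * q (r *\<^sub>R x)"
      using r by (intro scale) simp
    then have "r * q x \<le> q (r *\<^sub>R x)"
      using r by (simp add: field_simps)
    with scale[OF r, of x] show ?thesis by simp
  qed (simp add: zero)
  with add show ?thesis by (simp add: sublinear_def)
qed

text \<open>
  The infimum of \<open>q (x + c) - g c\<close> over the cone pushes \<open>q\<close> down until it is at most \<open>- g c\<close> at
  \<open>- c\<close>. This one construction serves twice: with \<open>C\<close> a ray it shows that minimal sublinear functionals
  are linear, and with \<open>C\<close> a subspace it encodes a prescribed linear functional into the majorant.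
\<close>

lemma sublinear_cone_minorant:
  fixes q :: "'a::real_vector \<Rightarrow> real"
  assumes q: "sublinear q"
    and C0: "0 \<in> C" and Cadd: "\<And>c d. c \<in> C \<Longrightarrow> d \<in> C \<Longrightarrow> c + d \<in> C"
    and Cscale: "\<And>r c. 0 \<le> r \<Longrightarrow> c \<in> C \<Longrightarrow> r *\<^sub>R c \<in> C"
    and gadd: "\<And>c d. c \<in> C \<Longrightarrow> d \<in> C \<Longrightarrow> g c + g d \<le> g (c + d)"
    and gscale: "\<And>r c. 0 \<le> r \<Longrightarrow> c \<in> C \<Longrightarrow> g (r *\<^sub>R c) = r * g c"
    and gq: "\<And>c. c \<in> C \<Longrightarrow> g c \<le> q c"
  shows "\<exists>q'. sublinear q' \<and> q' \<le> q \<and> (\<forall>c\<in>C. q' (- c) \<le> - g c)"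
proof (intro exI conjI ballI)
  define q' where "q' x = (INF c\<in>C. q (x + c) - g c)" for x
  have bd: "- q (- x) \<le> q (x + c) - g c" if "c \<in> C" for x c
    using sublinear_add[OF q, of "x + c" "- x"] gq[OF that] by simp
  have bdd: "bdd_below ((\<lambda>c. q (x + c) - g c) ` C)" for x
    using bd by (intro bdd_belowI2)
  have low: "q' x \<le> q (x + c) - g c" if "c \<in> C" for x c
    unfolding q'_def using bdd that by (rule cINF_lower)
  have great: "m \<le> q' x" if "\<And>c. c \<in> C \<Longrightarrow> m \<le> q (x + c) - g c" for m x
    unfolding q'_def using C0 that by (intro cINF_greatest) auto
  have g0: "g 0 = 0" using gscale[of 0 0] C0 by simp
  show "sublinear q'"
  proof (rule sublinearI)
    fix x y
    have 1: "q' (x + y) \<le> (q (x + c) - g c) + (q (y + d) - g d)" if "c \<in> C" "d \<in> C" for c d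
    proof -
      have "q' (x + y) \<le> q ((x + y) + (c + d)) - g (c + d)"
        by (intro low Cadd that)
      also have "(x + y) + (c + d) = (x + c) + (y + d)" by simp
      also have "q \<dots> \<le> q (x + c) + q (y + d)" by (rule sublinear_add[OF q])
      finally show ?thesis using gadd[OF that] by simp
    qed
    have "q' (x + y) - (q (x + c) - g c) \<le> q' y" if "c \<in> C" for c
      using 1[OF that] by (intro great) (simp add: algebra_simps)
    then have "q' (x + y) - q' y \<le> q' x"
      by (intro great) (simp add: algebra_simps)
    then show "q' (x + y) \<le> q' x + q' y" by simp
  next
    fix r :: real and x assume r: "0 < r"
    have "q' (r *\<^sub>R x) / r \<le> q (x + c) - g c" if "c \<in> C" for c
    proof -
      have "q' (r *\<^sub>R x) \<le> q (r *\<^sub>R x + r *\<^sub>R c) - g (r *\<^sub>R c)"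
        using r by (intro low Cscale that) simp
      also have "\<dots> = r * (q (x + c) - g c)"
        using r that sublinear_scale[OF q, of r "x + c"] gscale[of r c]
        by (simp add: scaleR_add_right algebra_simps)
      finally show ?thesis using r by (simp add: field_simps)
    qed
    then have "q' (r *\<^sub>R x) / r \<le> q' x" by (rule great)
    then show "q' (r *\<^sub>R x) \<le> r * q' x" using r by (simp add: field_simps)
  next
    have "q' 0 \<le> 0" using low[OF C0, of 0] by (simp add: g0 sublinear_zero[OF q])
    moreover have "0 \<le> q' 0" using gq by (intro great) simp
    ultimately show "q' 0 = 0" by simp
  qed
  show "q' \<le> q"
    using low[OF C0] by (auto simp: le_fun_def g0)
  show "q' (- c) \<le> - g c" if "c \<in> C" for c
    using low[OF that, of "- c"] by (simp add: sublinear_zero[OF q])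
qed

text \<open>
  Zorn's lemma applies because a chain of sublinear minorants of \<open>p\<close> is bounded below pointwise by
  \<open>- p (- x)\<close>, and its infimum is subadditive as any two members of the chain are comparable.
\<close>

lemma exists_minimal_sublinear:
  fixes p :: "'a::real_vector \<Rightarrow> real"
  assumes p: "sublinear p"
  shows "\<exists>m. sublinear m \<and> m \<le> p \<and> (\<forall>q. sublinear q \<and> q \<le> m \<longrightarrow> q = m)"
proof -
  define A where "A = {q. sublinear q \<and> q \<le> p}"
  have "\<exists>m\<in>A. \<forall>a\<in>A. a \<le> m \<longrightarrow> a = m"
  proof (rule predicate_Zorn)
    show "partial_order_on A (relation_of (\<lambda>a b. b \<le> a) A)"
      by (rule partial_order_on_relation_ofI) auto
  next
    fix C assume C: "C \<in> Chains (relation_of (\<lambda>a b. b \<le> a) A)"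
    then have CA: "C \<subseteq> A" and chain: "\<And>a b. a \<in> C \<Longrightarrow> b \<in> C \<Longrightarrow> a \<le> b \<or> b \<le> a"
      by (auto simp: Chains_def relation_of_def)
    show "\<exists>u\<in>A. \<forall>a\<in>C. u \<le> a"
    proof (cases "C = {}")
      case True
      then show ?thesis using p by (auto simp: A_def)
    next
      case False
      then obtain c0 where c0: "c0 \<in> C" by blast
      define u where "u x = (INF q\<in>C. q x)" for x
      have sub: "sublinear q" and qp: "q x \<le> p x" if "q \<in> C" for q x
        using CA that by (auto simp: A_def le_fun_def)
      have bd: "- p (- x) \<le> q x" if "q \<in> C" for q x
        using sublinear_neg[OF sub[OF that], of x] qp[OF that, of "- x"] by linarith
      have low: "u x \<le> q x" if "q \<in> C" for q x
        unfolding u_def using bd that by (intro cINF_lower bdd_belowI2)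
      have great: "m \<le> u x" if "\<And>q. q \<in> C \<Longrightarrow> m \<le> q x" for m x
        unfolding u_def using False that by (intro cINF_greatest) auto
      have "sublinear u"
      proof (rule sublinearI)
        fix x y
        have 1: "u (x + y) \<le> q x + q' y" if "q \<in> C" "q' \<in> C" for q q'
        proof (cases "q \<le> q'")
          case True
          have "u (x + y) \<le> q x + q y"
            using low[OF that(1), of "x + y"] sublinear_add[OF sub[OF that(1)], of x y] by simp
          with True show ?thesis by (auto simp: le_fun_def intro: order_trans)
        next
          case False
          then have "q' \<le> q" using chain that by blast
          moreover have "u (x + y) \<le> q' x + q' y"
            using low[OF that(2), of "x + y"] sublinear_add[OF sub[OF that(2)], of x y] by simp
          ultimately show ?thesis by (auto simp: le_fun_def intro: order_trans)
        qed
        have "u (x + y) - q x \<le> u y" if "q \<in> C" for q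
          using 1[OF that] by (intro great) (simp add: algebra_simps)
        then have "u (x + y) - u y \<le> u x"
          by (intro great) (simp add: algebra_simps)
        then show "u (x + y) \<le> u x + u y" by simp
      next
        fix r :: real and x assume r: "0 < r"
        have "u (r *\<^sub>R x) / r \<le> q x" if "q \<in> C" for q
          using low[OF that, of "r *\<^sub>R x"] sublinear_scale[OF sub[OF that], of r x] r
          by (simp add: field_simps)
        then have "u (r *\<^sub>R x) / r \<le> u x" by (rule great)
        then show "u (r *\<^sub>R x) \<le> r * u x" using r by (simp add: field_simps)
      next
        have "u 0 \<le> 0" using low[OF c0, of 0] by (simp add: sublinear_zero sub c0)
        moreover have "0 \<le> u 0" by (intro great) (simp add: sublinear_zero sub)
        ultimately show "u 0 = 0" by simp
      qed
      moreover have "u \<le> p"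
        unfolding le_fun_def using low[OF c0] qp[OF c0] by (meson order_trans)
      ultimately show ?thesis using low by (auto simp: A_def le_fun_def)
    qed
  qed
  then show ?thesis unfolding A_def by (auto intro: order_trans)
qed

text \<open>
  Lowering \<open>m\<close> along the ray through \<open>y\<close> yields a sublinear minorant whose value at \<open>- y\<close> is at most
  \<open>- m y\<close>. By minimality nothing was lowered, so \<open>m\<close> is odd, and an odd sublinear functional is linear.
\<close>

lemma minimal_sublinear_linear:
  fixes m :: "'a::real_vector \<Rightarrow> real"
  assumes m: "sublinear m" and min: "\<And>q. sublinear q \<Longrightarrow> q \<le> m \<Longrightarrow> q = m"
  shows "linear m"
proof -
  have neg: "m (- y) = - m y" for y
  proof -
    define C where "C = {t *\<^sub>R y |t. 0 \<le> t}"
    have "\<exists>q. sublinear q \<and> q \<le> m \<and> (\<forall>c\<in>C. q (- c) \<le> - m c)"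
    proof (rule sublinear_cone_minorant[OF m])
      show "0 \<in> C" by (auto simp: C_def intro!: exI[of _ 0])
      show "c + d \<in> C" if "c \<in> C" "d \<in> C" for c d
        using that by (auto simp: C_def scaleR_add_left[symmetric] intro: add_nonneg_nonneg)
      show "r *\<^sub>R c \<in> C" if "0 \<le> r" "c \<in> C" for r c
        using that by (auto simp: C_def intro: mult_nonneg_nonneg)
      show "m c + m d \<le> m (c + d)" if "c \<in> C" "d \<in> C" for c d
      proof -
        obtain s t where st: "c = s *\<^sub>R y" "d = t *\<^sub>R y" "0 \<le> s" "0 \<le> t"
          using \<open>c \<in> C\<close> \<open>d \<in> C\<close> by (auto simp: C_def)
        then have "c + d = (s + t) *\<^sub>R y" by (simp add: scaleR_add_left)
        with st show ?thesis by (simp add: sublinear_scale[OF m] distrib_right)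
      qed
      show "m (r *\<^sub>R c) = r * m c" if "0 \<le> r" for r c
        by (rule sublinear_scale[OF m that])
    qed simp
    then obtain q where "sublinear q" "q \<le> m" and q: "\<forall>c\<in>C. q (- c) \<le> - m c" by blast
    then have "q = m" by (intro min)
    moreover have "y \<in> C" by (auto simp: C_def intro!: exI[of _ 1])
    ultimately show ?thesis
      using q sublinear_neg[OF m, of y] by (metis dual_order.antisym minus_le_iff)
  qed
  have add: "m (x + y) = m x + m y" for x y
    using sublinear_add[OF m, of x y] sublinear_add[OF m, of "x + y" "- y"] by (simp add: neg)
  have "m (r *\<^sub>R x) = r * m x" for r x
  proof (cases "0 \<le> r")
    case False
    then have "m (- (r *\<^sub>R x)) = - r * m x"
      using sublinear_scale[OF m, of "- r" x] by simp
    then show ?thesis by (simp add: neg)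
  qed (rule sublinear_scale[OF m])
  with add show ?thesis by (intro linearI) simp_all
qed

text \<open>
  It suffices to take a minimal sublinear functional below the lowered majorant that encodes \<open>g\<close>: on \<open>F\<close>
  it dominates \<open>g\<close>, and two linear functionals on a subspace that are comparable agree.
\<close>

theorem Hahn_Banach_real:
  fixes p :: "'a::real_vector \<Rightarrow> real"
  assumes p: "sublinear p" and F: "subspace F"
    and gadd: "\<And>x y. x \<in> F \<Longrightarrow> y \<in> F \<Longrightarrow> g (x + y) = g x + g y"
    and gscale: "\<And>r x. x \<in> F \<Longrightarrow> g (r *\<^sub>R x) = r * g x"
    and gp: "\<And>x. x \<in> F \<Longrightarrow> g x \<le> p x"
  shows "\<exists>h. linear h \<and> h \<le> p \<and> (\<forall>x\<in>F. h x = g x)"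
proof -
  obtain q where q: "sublinear q" "q \<le> p" and qF: "\<And>x. x \<in> F \<Longrightarrow> q (- x) \<le> - g x"
    using sublinear_cone_minorant[of p F g] p F gadd gscale gp
    by (auto simp: subspace_0 subspace_add subspace_scale)
  obtain m where m: "sublinear m" "m \<le> q" and "\<forall>q'. sublinear q' \<and> q' \<le> m \<longrightarrow> q' = m"
    using exists_minimal_sublinear[OF q(1)] by blast
  then have lin: "linear m" by (intro minimal_sublinear_linear) auto
  have le: "g x \<le> m x" if "x \<in> F" for x
    using qF[OF that] m(2) linear_neg[OF lin, of x] by (auto simp: le_fun_def dest: spec[of _ "- x"])
  have "m x = g x" if "x \<in> F" for x
  proof -
    have "- x \<in> F" "g (- x) = - g x"
      using gscale[OF that, of "- 1"] subspace_neg[OF F that] by auto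
    then show ?thesis
      using le[OF that] le[of "- x"] linear_neg[OF lin, of x] by auto
  qed
  with lin m(2) q(2) show ?thesis by (meson order_trans)
qed

text \<open>
  Homogeneity is required for complex scalars, which lets the bound pass from the real part of a
  functional to its modulus.
\<close>

definition cseminorm :: "('a::complex_normed_vector \<Rightarrow> real) \<Rightarrow> bool"
  where "cseminorm p \<longleftrightarrow>
    (\<forall>x y. p (x + y) \<le> p x + p y) \<and> (\<forall>c x. p (c *\<^sub>C x) = cmod c * p x)"

lemma cblinfun_add: "cblinfun_apply S (x + y) = cblinfun_apply S x + cblinfun_apply S y"
  and cblinfun_scale: "cblinfun_apply S (c *\<^sub>C x) = c *\<^sub>C cblinfun_apply S x"
  and cblinfun_bounded_linear: "bounded_linear (cblinfun_apply S)"
  using cblinfun_apply[of S] by (auto simp: bounded_clinear_def linear_add bounded_linear.linear)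

lemma cblinfun_zero: "cblinfun_apply S 0 = 0"
  and cblinfun_diff: "cblinfun_apply S (x - y) = cblinfun_apply S x - cblinfun_apply S y"
  using bounded_linear.linear[OF cblinfun_bounded_linear[of S]]
  by (simp_all add: linear_0 linear_diff)

lemma norm_cblinfun_apply: "norm (cblinfun_apply S x) \<le> norm S * norm x"
  using onorm[OF cblinfun_bounded_linear[of S], of x] by (simp add: norm_cblinfun.rep_eq)

lemma norm_cblinfun_bound:
  "0 \<le> b \<Longrightarrow> (\<And>x. norm (cblinfun_apply S x) \<le> b * norm x) \<Longrightarrow> norm S \<le> b"
  by (simp add: norm_cblinfun.rep_eq onorm_bound)

lemma complex_subspace_real: "complex_vector.subspace F \<Longrightarrow> subspace F"
  by (auto simp: subspace_def complex_vector.subspace_def scaleR_scaleC)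

lemma cblinfun_of_bounded:
  assumes "\<And>x y. f (x + y) = f x + f y" "\<And>c x. f (c *\<^sub>C x) = c *\<^sub>C f x" "\<And>x. norm (f x) \<le> K * norm x"
  shows "\<exists>S. cblinfun_apply S = f"
proof -
  have "bounded_linear f"
    using assms by (intro bounded_linear_intro[where K=K]) (auto simp: scaleR_scaleC mult.commute)
  then have "bounded_clinear f" using assms by (simp add: bounded_clinear_def)
  then show ?thesis by (metis CBlinfun_inverse mem_Collect_eq)
qed

text \<open>
  The real part of \<open>f\<close> is extended, and the complex functional is recovered from its real part \<open>h\<close> as
  \<open>h x - \<i> h (\<i> x)\<close>. The bound by a multiple of the norm makes the extension an element of the dual.
\<close>

theorem Hahn_Banach_complex:
  fixes p :: "'a::complex_normed_vector \<Rightarrow> real"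
  assumes p: "cseminorm p" and pK: "\<And>x. p x \<le> K * norm x" and F: "complex_vector.subspace F"
    and fadd: "\<And>x y. x \<in> F \<Longrightarrow> y \<in> F \<Longrightarrow> f (x + y) = f x + f y"
    and fscale: "\<And>c x. x \<in> F \<Longrightarrow> f (c *\<^sub>C x) = c * f x"
    and fp: "\<And>x. x \<in> F \<Longrightarrow> cmod (f x) \<le> p x"
  shows "\<exists>\<phi>::'a cdual. (\<forall>x. cmod (cblinfun_apply \<phi> x) \<le> p x) \<and> (\<forall>x\<in>F. cblinfun_apply \<phi> x = f x)"
proof -
  have sc: "p (c *\<^sub>C x) = cmod c * p x" for c x using p by (simp add: cseminorm_def)
  have "sublinear p"
    using p by (auto simp: sublinear_def cseminorm_def scaleR_scaleC)
  moreover have "subspace F" by (rule complex_subspace_real[OF F])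
  moreover have "Re (f x) \<le> p x" if "x \<in> F" for x
    using fp[OF that] complex_Re_le_cmod[of "f x"] by linarith
  moreover have "Re (f (r *\<^sub>R x)) = r * Re (f x)" if "x \<in> F" for r x
    by (simp add: scaleR_scaleC fscale that)
  ultimately obtain h where h: "linear h" "h \<le> p" and hF: "\<And>x. x \<in> F \<Longrightarrow> h x = Re (f x)"
    using Hahn_Banach_real[of p F "\<lambda>x. Re (f x)"] fadd by auto
  \<comment> \<open>\<open>h\<close> is the real part of a unique complex-linear functional.\<close>
  define \<phi> where "\<phi> x = Complex (h x) (- h (\<i> *\<^sub>C x))" for x
  have hadd: "h (x + y) = h x + h y" and hscale: "h (r *\<^sub>R x) = r * h x" and hneg: "h (- x) = - h x"
    for x y r using h(1) by (simp_all add: linear_add linear_scale linear_neg)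
  have add: "\<phi> (x + y) = \<phi> x + \<phi> y" for x y
    by (simp add: \<phi>_def hadd scaleC_add_right complex_eq_iff)
  have hc: "h (c *\<^sub>C x) = Re c * h x + Im c * h (\<i> *\<^sub>C x)" for c x
  proof -
    have "c *\<^sub>C x = Re c *\<^sub>R x + Im c *\<^sub>R \<i> *\<^sub>C x"
      by (subst (1) complex_eq) (simp add: scaleC_add_left scaleR_scaleC scaleC_scaleC mult.commute)
    then show ?thesis by (simp add: hadd hscale)
  qed
  have scale: "\<phi> (c *\<^sub>C x) = c * \<phi> x" for c x
    using hc[of c x] hc[of "\<i> * c" x] by (simp add: \<phi>_def complex_eq_iff scaleC_scaleC)
  have bound: "cmod (\<phi> x) \<le> p x" for x
  proof (cases "\<phi> x = 0")
    case True
    have "0 \<le> p x"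
      using h(2)[THEN le_funD, of x] h(2)[THEN le_funD, of "- x"] sc[of "- 1" x] hneg[of x]
      by (simp)
    then show ?thesis by (simp add: True)
  next
    case False
    \<comment> \<open>The unimodular factor that makes the value at \<open>x\<close> real and nonnegative.\<close>
    define c where "c = cnj (sgn (\<phi> x))"
    have c: "c * \<phi> x = cmod (\<phi> x)" "cmod c = 1"
      using False by (simp_all add: c_def sgn_eq complex_norm_square[symmetric] divide_simps
          power2_eq_square norm_divide mult.commute[of "cnj _"])
    have "cmod (\<phi> x) = Re (\<phi> (c *\<^sub>C x))" by (simp add: scale c)
    also have "\<dots> \<le> p (c *\<^sub>C x)" using h(2) by (simp add: \<phi>_def le_fun_def)
    also have "\<dots> = p x" by (simp add: sc c)
    finally show ?thesis .
  qed
  obtain \<Phi> :: "'a cdual" where \<Phi>: "cblinfun_apply \<Phi> = \<phi>"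
    using cblinfun_of_bounded[of \<phi> K] add scale order_trans[OF bound pK]
    by (auto simp: scaleC_complex_def)
  have "\<phi> x = f x" if "x \<in> F" for x
  proof -
    have "\<i> *\<^sub>C x \<in> F" using F that by (rule complex_vector.subspace_scale)
    then show ?thesis
      by (simp add: \<phi>_def hF that fscale complex_eq_iff)
  qed
  with \<Phi> bound show ?thesis by auto
qed

lemma Hahn_Banach_at_point:
  fixes p :: "'a::complex_normed_vector \<Rightarrow> real"
  assumes p: "cseminorm p" and pK: "\<And>x. p x \<le> K * norm x"
  shows "\<exists>\<phi>::'a cdual. (\<forall>x. cmod (cblinfun_apply \<phi> x) \<le> p x) \<and> cblinfun_apply \<phi> y = p y"
proof -
  have sc: "p (c *\<^sub>C x) = cmod c * p x" for c x using p by (simp add: cseminorm_def)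
  have p0: "p 0 = 0" using sc[of 0 0] by simp
  have nonneg: "0 \<le> p x" for x
  proof -
    have "p (x + (- 1) *\<^sub>C x) \<le> p x + p ((- 1) *\<^sub>C x)"
      using p unfolding cseminorm_def by blast
    then show ?thesis using sc[of "- 1" x] by (simp add: p0 scaleC_one)
  qed
  show ?thesis
  proof (cases "p y = 0")
    case True
    then show ?thesis using nonneg by (intro exI[of _ 0]) (simp add: zero_cblinfun.rep_eq)
  next
    case False
    then have y: "y \<noteq> 0" by (auto simp: p0)
    define f where "f x = (THE c. x = c *\<^sub>C y) * p y" for x
    have f: "f (c *\<^sub>C y) = c * p y" for c
      using y by (simp add: f_def complex_vector.scale_right_imp_eq complex_vector.scale_cancel_right)
    have "\<exists>\<phi>::'a cdual. (\<forall>x. cmod (cblinfun_apply \<phi> x) \<le> p x) \<and>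
        (\<forall>x\<in>complex_vector.span {y}. cblinfun_apply \<phi> x = f x)"
    proof (rule Hahn_Banach_complex[OF p pK])
      show "complex_vector.subspace (complex_vector.span {y})" by simp
    qed (auto simp: complex_vector.span_singleton f sc norm_mult scaleC_scaleC nonneg algebra_simps
        simp flip: scaleC_add_left)
    then obtain \<phi> :: "'a cdual" where "\<forall>x. cmod (cblinfun_apply \<phi> x) \<le> p x"
      "\<forall>x\<in>complex_vector.span {y}. cblinfun_apply \<phi> x = f x" by blast
    then show ?thesis
      using f[of 1] by (intro exI[of _ \<phi>]) (simp add: scaleC_one complex_vector.span_base)
  qed
qed

section \<open>Separation of points from closed subspaces\<close>

lemma cseminormI:
  assumes add: "\<And>x y. p (x + y) \<le> p x + p y" and scale: "\<And>c x. p (c *\<^sub>C x) \<le> cmod c * p x"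
  shows "cseminorm p"
proof -
  have "p (c *\<^sub>C x) = cmod c * p x" for c x
  proof (cases "c = 0")
    case True
    have "p 0 \<le> 0" using scale[of 0 0] by simp
    moreover have "0 \<le> p 0" using add[of 0 0] by simp
    ultimately show ?thesis by (simp add: True)
  next
    case False
    have "p (inverse c *\<^sub>C c *\<^sub>C x) \<le> cmod (inverse c) * p (c *\<^sub>C x)" by (rule scale)
    then have "cmod c * p x \<le> p (c *\<^sub>C x)"
      using False by (simp add: scaleC_scaleC scaleC_one norm_inverse norm_divide field_simps)
    with scale[of c x] show ?thesis by simp
  qed
  with add show ?thesis by (simp add: cseminorm_def)
qed

lemma cseminorm_infdist:
  assumes M: "complex_vector.subspace M"
  shows "cseminorm (\<lambda>x. infdist x M)"
proof -
  have ne: "M \<noteq> {}" using complex_vector.subspace_0[OF M] by auto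
  have inf: "infdist x M = (INF m\<in>M. dist x m)" for x using ne by (simp add: infdist_def)
  show ?thesis
  proof (rule cseminormI)
    fix x y
    have 1: "infdist (x + y) M \<le> dist x m + dist y n" if "m \<in> M" "n \<in> M" for m n
    proof -
      have "infdist (x + y) M \<le> dist (x + y) (m + n)"
        by (intro infdist_le complex_vector.subspace_add[OF M] that)
      also have "\<dots> \<le> dist x m + dist y n" by (rule dist_triangle_add)
      finally show ?thesis .
    qed
    have "infdist (x + y) M - dist x m \<le> infdist y M" if "m \<in> M" for m
      unfolding inf[of y] using ne 1[OF that] by (intro cINF_greatest) (auto simp: algebra_simps)
    then have "infdist (x + y) M - infdist y M \<le> infdist x M"
      unfolding inf[of x] using ne by (intro cINF_greatest) (auto simp: algebra_simps)
    then show "infdist (x + y) M \<le> infdist x M + infdist y M" by simp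
  next
    fix c x
    show "infdist (c *\<^sub>C x) M \<le> cmod c * infdist x M"
    proof (cases "c = 0")
      case True
      then show ?thesis using complex_vector.subspace_0[OF M] by simp
    next
      case False
      have "infdist (c *\<^sub>C x) M / cmod c \<le> dist x m" if "m \<in> M" for m
      proof -
        have "infdist (c *\<^sub>C x) M \<le> dist (c *\<^sub>C x) (c *\<^sub>C m)"
          by (intro infdist_le complex_vector.subspace_scale[OF M] that)
        also have "\<dots> = cmod c * dist x m"
          by (simp add: dist_norm norm_scaleC flip: complex_vector.scale_right_diff_distrib)
        finally show ?thesis using False by (simp add: field_simps)
      qed
      then have "infdist (c *\<^sub>C x) M / cmod c \<le> infdist x M"
        unfolding inf[of x] using ne by (intro cINF_greatest)
      then show ?thesis using False by (simp add: field_simps)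
    qed
  qed
qed

text \<open>
  The distance to \<open>M\<close> is a seminorm that vanishes exactly on \<open>M\<close>, so a functional dominated by it and
  normed at \<open>b\<close> does the separation.
\<close>

lemma separate_point_closed_subspace:
  fixes M :: "'a::complex_normed_vector set"
  assumes M: "complex_vector.subspace M" "closed M" and b: "b \<notin> M"
  shows "\<exists>\<phi>::'a cdual. (\<forall>m\<in>M. cblinfun_apply \<phi> m = 0) \<and> cblinfun_apply \<phi> b = 1"
proof -
  have 0: "0 \<in> M" by (rule complex_vector.subspace_0[OF M(1)])
  then have pos: "infdist b M \<noteq> 0" using M(2) b in_closed_iff_infdist_zero[of M b] by auto
  have "infdist x M \<le> 1 * norm x" for x using infdist_le[OF 0, of x] by simp
  then obtain \<phi> :: "'a cdual" where le: "\<And>x. cmod (cblinfun_apply \<phi> x) \<le> infdist x M"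
    and eq: "cblinfun_apply \<phi> b = infdist b M"
    using Hahn_Banach_at_point[OF cseminorm_infdist[OF M(1)]] by blast
  have "cblinfun_apply \<phi> m = 0" if "m \<in> M" for m using le[of m] that by simp
  then show ?thesis
    using pos by (intro exI[of _ "inverse (complex_of_real (infdist b M)) *\<^sub>C \<phi>"])
      (simp add: scaleC_cblinfun.rep_eq scaleC_complex_def eq)
qed

lemma subspace_add_span:
  assumes "complex_vector.subspace M"
  shows "complex_vector.subspace {m + b |m b. m \<in> M \<and> b \<in> complex_vector.span B}"
  using complex_vector.subspace_sums[OF assms complex_vector.subspace_span, of B]
  by (simp add: conj_commute)

text \<open>
  One vector \<open>a\<close> is added at a time. If \<open>a\<close> lies outside the closed subspace reached so far, a
  separating functional \<open>\<phi>\<close> with \<open>\<phi> a = 1\<close> reads off the coefficient of \<open>a\<close>, which exhibits the larger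
  subspace as a preimage of the smaller one under a continuous map.
\<close>

lemma closed_add_span:
  fixes M :: "'a::complex_normed_vector set"
  assumes M: "complex_vector.subspace M" "closed M" and "finite B"
  shows "closed {m + b |m b. m \<in> M \<and> b \<in> complex_vector.span B}"
  using \<open>finite B\<close>
proof induction
  case empty
  then show ?case using M by simp
next
  case (insert a B)
  let ?N = "{m + b |m b. m \<in> M \<and> b \<in> complex_vector.span B}"
  let ?N' = "{m + b |m b. m \<in> M \<and> b \<in> complex_vector.span (insert a B)}"
  have N: "complex_vector.subspace ?N" by (rule subspace_add_span[OF M(1)])
  have N': "x \<in> ?N' \<longleftrightarrow> (\<exists>c. x - c *\<^sub>C a \<in> ?N)" for x
  proof
    assume "x \<in> ?N'"
    then obtain m b c where "x = m + b" "m \<in> M" "b - c *\<^sub>C a \<in> complex_vector.span B"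
      by (auto simp: complex_vector.span_insert)
    then show "\<exists>c. x - c *\<^sub>C a \<in> ?N"
      by (intro exI[of _ c] CollectI exI[of _ m] exI[of _ "b - c *\<^sub>C a"]) simp
  next
    assume "\<exists>c. x - c *\<^sub>C a \<in> ?N"
    then obtain m b c where "x - c *\<^sub>C a = m + b" "m \<in> M" "b \<in> complex_vector.span B" by auto
    then show "x \<in> ?N'"
      by (intro CollectI exI[of _ m] exI[of _ "b + c *\<^sub>C a"])
        (auto simp: complex_vector.span_insert algebra_simps intro: exI[of _ c])
  qed
  show ?case
  proof (cases "a \<in> ?N")
    case True
    have "x \<in> ?N' \<longleftrightarrow> x \<in> ?N" for x
    proof
      assume "x \<in> ?N'"
      then obtain c where "x - c *\<^sub>C a \<in> ?N" using N' by blast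
      then have "(x - c *\<^sub>C a) + c *\<^sub>C a \<in> ?N"
        by (rule complex_vector.subspace_add[OF N _ complex_vector.subspace_scale[OF N True]])
      then show "x \<in> ?N" by simp
    next
      assume "x \<in> ?N"
      then show "x \<in> ?N'" unfolding N' by (intro exI[of _ 0]) simp
    qed
    then have "?N' = ?N" by blast
    with insert.IH show ?thesis by simp
  next
    case False
    obtain \<phi> :: "'a cdual" where \<phi>: "\<forall>m\<in>?N. cblinfun_apply \<phi> m = 0" "cblinfun_apply \<phi> a = 1"
      using separate_point_closed_subspace[OF N insert.IH False] by blast
    \<comment> \<open>The coefficient of \<open>a\<close> is a continuous function of the point.\<close>
    have "x \<in> ?N' \<longleftrightarrow> x - cblinfun_apply \<phi> x *\<^sub>C a \<in> ?N" for x
    proof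
      assume "x \<in> ?N'"
      then obtain c where c: "x - c *\<^sub>C a \<in> ?N" using N' by blast
      then have "cblinfun_apply \<phi> x = c"
        using bspec[OF \<phi>(1) c] \<phi>(2) by (simp add: cblinfun_diff cblinfun_scale scaleC_complex_def)
      with c show "x - cblinfun_apply \<phi> x *\<^sub>C a \<in> ?N" by simp
    qed (use N' in blast)
    then have N'_eq: "?N' = (\<lambda>x. x - cblinfun_apply \<phi> x *\<^sub>C a) -` ?N" by blast
    have "bounded_linear (\<lambda>x. cblinfun_apply \<phi> x *\<^sub>C a)"
    proof (rule bounded_linear_intro[where K="norm \<phi> * norm a"])
      show "norm (cblinfun_apply \<phi> x *\<^sub>C a) \<le> norm x * (norm \<phi> * norm a)" for x
        using mult_right_mono[OF norm_cblinfun_apply[of \<phi> x] norm_ge_zero[of a]]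
        by (simp add: norm_scaleC mult_ac)
    qed (simp_all add: cblinfun_add cblinfun_scale scaleC_add_left scaleR_scaleC scaleC_scaleC
        scaleR_conv_of_real scaleC_complex_def)
    then show ?thesis
      unfolding N'_eq by (intro closed_vimage insert.IH continuous_intros linear_continuous_on)
  qed
qed

section \<open>The open mapping theorem\<close>

text \<open>
  The usual successive approximation: the error is halved in each step, the corrections form an
  absolutely convergent series, and its sum is an exact solution. It is stated for a subspace \<open>V\<close> and a set
  \<open>W\<close> invariant under corrections, because it is used for the open mapping theorem, for the perturbation
  of surjective operators and for the closed range theorem.
\<close>

lemma approximate_solvability_imp_solvability:
  fixes f :: "'a::banach \<Rightarrow> 'b::real_normed_vector"
  assumes f: "bounded_linear f" and V: "subspace V" "closed V"
    and W: "\<And>w v. w \<in> W \<Longrightarrow> v \<in> V \<Longrightarrow> w - f v \<in> W"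
    and approx: "\<And>w. w \<in> W \<Longrightarrow> \<exists>v\<in>V. norm v \<le> C * norm w \<and> norm (w - f v) \<le> norm w / 2"
    and w: "w \<in> W"
  shows "\<exists>v\<in>V. f v = w \<and> norm v \<le> 2 * C * norm w"
proof -
  interpret f: bounded_linear f by fact
  obtain v where v: "\<And>w. w \<in> W \<Longrightarrow> v w \<in> V" "\<And>w. w \<in> W \<Longrightarrow> norm (v w) \<le> C * norm w"
    "\<And>w. w \<in> W \<Longrightarrow> norm (w - f (v w)) \<le> norm w / 2"
    using approx by metis
  define r where "r n = ((\<lambda>w. w - f (v w)) ^^ n) w" for n
  have r0: "r 0 = w" and rS: "r (Suc n) = r n - f (v (r n))" for n by (simp_all add: r_def)
  have rW: "r n \<in> W" for n by (induction n) (simp_all add: r0 rS w W v)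
  have rn: "norm (r n) \<le> norm w * (1/2) ^ n" for n
  proof (induction n)
    case (Suc n)
    have "norm (r (Suc n)) \<le> norm (r n) / 2" using v(3)[OF rW, of n] by (simp add: rS)
    also have "\<dots> \<le> norm w * (1/2) ^ n / 2" using Suc by simp
    finally show ?case by simp
  qed (simp add: r0)
  have vn: "norm (v (r n)) \<le> (\<bar>C\<bar> * norm w) * (1/2) ^ n" for n
  proof -
    have "norm (v (r n)) \<le> \<bar>C\<bar> * norm (r n)"
      using v(2)[OF rW, of n] abs_ge_self[of C] mult_right_mono[of C "\<bar>C\<bar>" "norm (r n)"] by simp
    also have "\<dots> \<le> \<bar>C\<bar> * (norm w * (1/2) ^ n)" by (intro mult_left_mono rn) simp
    finally show ?thesis by (simp add: mult_ac)
  qed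
  have geo: "summable (\<lambda>n. (\<bar>C\<bar> * norm w) * (1/2) ^ n)"
    by (intro summable_mult summable_geometric) simp
  have sumn: "summable (\<lambda>n. norm (v (r n)))"
    by (rule summable_comparison_test'[OF geo, of 0]) (simp add: vn)
  then have sum: "summable (\<lambda>n. v (r n))" by (rule summable_norm_cancel)
  let ?s = "\<Sum>n. v (r n)"
  have "?s \<in> V"
  proof (rule closed_sequentially[OF V(2)])
    show "(\<lambda>n. \<Sum>i<n. v (r i)) \<longlonglongrightarrow> ?s" by (rule summable_LIMSEQ[OF sum])
    show "(\<Sum>i<n. v (r i)) \<in> V" for n
      by (intro subspace_sum[OF V(1)]) (simp add: v rW)
  qed
  moreover have "f ?s = w"
  proof -
    have "r \<longlonglongrightarrow> 0"
    proof (rule tendsto_norm_zero_cancel, rule tendsto_sandwich[OF _ _ tendsto_const])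
      show "(\<lambda>n. norm w * (1/2) ^ n) \<longlonglongrightarrow> 0"
        by (intro tendsto_mult_right_zero LIMSEQ_realpow_zero) auto
    qed (auto simp: rn)
    then have "(\<lambda>n. r n - r (Suc n)) sums (r 0 - 0)" by (rule telescope_sums')
    then have "(\<lambda>n. f (v (r n))) sums w" by (simp add: r0 rS)
    moreover have "(\<lambda>n. f (v (r n))) sums f ?s"
      by (rule f.sums[OF summable_sums[OF sum]])
    ultimately show ?thesis by (metis sums_unique2)
  qed
  moreover have "norm ?s \<le> 2 * C * norm w"
  proof (cases "w = 0")
    case False
    have "0 \<le> C * norm w" using v(2)[OF w] norm_ge_zero order_trans by blast
    with False have C: "0 \<le> C" by (simp add: zero_le_mult_iff)
    have "norm ?s \<le> (\<Sum>n. norm (v (r n)))" by (rule summable_norm[OF sumn])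
    also have "\<dots> \<le> (\<Sum>n. (\<bar>C\<bar> * norm w) * (1/2) ^ n)" by (rule suminf_le[OF vn sumn geo])
    also have "\<dots> = (\<bar>C\<bar> * norm w) * 2"
      by (subst suminf_mult) (auto simp: suminf_geometric)
    finally show ?thesis using C by (simp add: mult_ac)
  next
    case True
    have "r n = 0" for n using rn[of n] True by simp
    then have "v (r n) = 0" for n using v(2)[OF rW, of n] by simp
    then show ?thesis by (simp add: True)
  qed
  ultimately show ?thesis by blast
qed

text \<open>
  \<open>W\<close> is the union of the closures of the images of the balls of radius \<open>n\<close> in \<open>V\<close>, so by Baire's theorem
  one of them contains a relative ball. Differences of its elements give approximate solutions with a
  norm bound, which can be made exact.
\<close>

theorem open_mapping:
  fixes f :: "'a::banach \<Rightarrow> 'b::banach"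
  assumes f: "bounded_linear f" and V: "subspace V" "closed V"
    and W: "subspace W" "closed W" and fVW: "f ` V = W"
  shows "\<exists>C\<ge>0. \<forall>w\<in>W. \<exists>v\<in>V. f v = w \<and> norm v \<le> C * norm w"
proof -
  interpret f: bounded_linear f by fact
  let ?X = "top_of_set W"
  define T where "T n = W \<inter> closure (f ` (V \<inter> cball 0 (real n)))" for n :: nat
  have "\<exists>n. ?X interior_of T n \<noteq> {}"
  proof (rule ccontr)
    assume "\<not> ?thesis"
    then have "?X interior_of \<Union>(range T) = {}"
      using W(2) by (intro Baire_category_alt disjI1)
        (auto simp: T_def completely_metrizable_space_closedin completely_metrizable_space_euclidean
          intro: closedin_closed_Int)
    moreover have "\<Union>(range T) = W"
    proof
      show "W \<subseteq> \<Union>(range T)"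
      proof
        fix w assume "w \<in> W"
        then obtain v where v: "v \<in> V" "f v = w" using fVW by blast
        obtain n where "norm v \<le> real n" using real_arch_simple by blast
        then have "w \<in> f ` (V \<inter> cball 0 (real n))" using v by auto
        then have "w \<in> T n"
          using \<open>w \<in> W\<close> unfolding T_def by (blast intro: subsetD[OF closure_subset])
        then show "w \<in> \<Union>(range T)" by blast
      qed
    qed (auto simp: T_def)
    moreover have "?X interior_of W = W"
      by (metis interior_of_topspace topspace_euclidean_subtopology)
    ultimately show False using subspace_0[OF W(1)] by auto
  qed
  then obtain n w0 where w0: "w0 \<in> ?X interior_of T n" by blast
  have "openin ?X (?X interior_of T n)" by simp
  then obtain e where e: "0 < e" "\<And>w. w \<in> W \<Longrightarrow> dist w w0 < e \<Longrightarrow> w \<in> ?X interior_of T n"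
    using w0 unfolding openin_euclidean_subtopology_iff by metis
  have T: "w \<in> T n" if "w \<in> W" "dist w w0 < e" for w
    by (rule subsetD[OF interior_of_subset e(2)[OF that]])
  have w0W: "w0 \<in> W" using subsetD[OF interior_of_subset w0] by (simp add: T_def)
  have near: "\<exists>v\<in>V. norm v \<le> real n \<and> norm (w - f v) < d" if "w \<in> T n" "0 < d" for w d
  proof -
    have "w \<in> closure (f ` (V \<inter> cball 0 (real n)))" using that(1) by (simp add: T_def)
    then have "\<exists>y\<in>f ` (V \<inter> cball 0 (real n)). dist y w < d"
      using that(2) by (metis closure_approachable)
    then obtain v where v: "v \<in> V" "norm v \<le> real n" and y: "dist (f v) w < d" by auto
    with y show ?thesis by (auto simp: dist_norm norm_minus_commute)
  qed
  \<comment> \<open>A vector of norm \<open>e / 2\<close> is approximated by the image of a difference of norm at most \<open>2 n\<close>.\<close>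
  define C where "C = 4 * real n / e"
  have C: "0 \<le> C" using e(1) by (simp add: C_def)
  have "\<exists>v\<in>V. norm v \<le> C * norm w \<and> norm (w - f v) \<le> norm w / 2" if w: "w \<in> W" for w
  proof (cases "w = 0")
    case True
    then show ?thesis using subspace_0[OF V(1)] by (intro bexI[of _ 0]) (auto simp: f.zero)
  next
    case False
    define t where "t = e / (2 * norm w)"
    have t: "0 < t" using False e(1) by (simp add: t_def)
    have "w0 + t *\<^sub>R w \<in> W" by (intro subspace_add subspace_scale W w0W w)
    moreover have "dist (w0 + t *\<^sub>R w) w0 < e" using False e(1) by (simp add: dist_norm t_def)
    ultimately have "w0 + t *\<^sub>R w \<in> T n" by (rule T)
    then obtain v1 where v1: "v1 \<in> V" "norm v1 \<le> real n" "norm (w0 + t *\<^sub>R w - f v1) < e / 8"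
      using near[of _ "e / 8"] e(1) by auto
    have "w0 \<in> T n" using T[OF w0W] e(1) by simp
    then obtain v2 where v2: "v2 \<in> V" "norm v2 \<le> real n" "norm (w0 - f v2) < e / 8"
      using near[of _ "e / 8"] e(1) by auto
    let ?v = "(1 / t) *\<^sub>R (v1 - v2)"
    have "norm (v1 - v2) \<le> 2 * real n" using norm_triangle_ineq4[of v1 v2] v1 v2 by linarith
    then have "norm ?v \<le> (1 / t) * (2 * real n)"
      using t mult_left_mono[of "norm (v1 - v2)" "2 * real n" "1 / t"] by simp
    also have "\<dots> = C * norm w" by (simp add: t_def C_def)
    finally have 1: "norm ?v \<le> C * norm w" .
    have "w - f ?v = (1 / t) *\<^sub>R ((w0 + t *\<^sub>R w - f v1) - (w0 - f v2))"
      using t by (simp add: f.scaleR f.diff algebra_simps)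
    moreover have "norm ((w0 + t *\<^sub>R w - f v1) - (w0 - f v2)) \<le> e / 4"
      using norm_triangle_ineq4[of "w0 + t *\<^sub>R w - f v1" "w0 - f v2"] v1(3) v2(3) by linarith
    ultimately have "norm (w - f ?v) \<le> (1 / t) * (e / 4)"
      using t mult_left_mono[of "norm ((w0 + t *\<^sub>R w - f v1) - (w0 - f v2))" "e / 4" "1 / t"] by simp
    also have "\<dots> = norm w / 2" using e(1) by (simp add: t_def)
    finally have 2: "norm (w - f ?v) \<le> norm w / 2" .
    show ?thesis
      using 1 2 by (intro bexI[of _ ?v]) (auto intro: subspace_scale subspace_diff V v1 v2)
  qed
  moreover have "w - f v \<in> W" if "w \<in> W" "v \<in> V" for w v
    using that fVW by (intro subspace_diff[OF W(1)]) auto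
  ultimately have "\<exists>v\<in>V. f v = w \<and> norm v \<le> 2 * C * norm w" if "w \<in> W" for w
    using that by (intro approximate_solvability_imp_solvability[OF f V, of W])
  then show ?thesis using C by (intro exI[of _ "2 * C"]) simp
qed

section \<open>Dimension and codimension\<close>

lemma independent_modD:
  "independent_mod M B \<Longrightarrow> (\<Sum>b\<in>B. u b *\<^sub>C b) \<in> M \<Longrightarrow> b \<in> B \<Longrightarrow> u b = 0"
  by (auto simp: independent_mod_def)

text \<open>
  Independence in two layers: a relation modulo \<open>M\<close> is first read modulo the larger subspace \<open>N\<close>, where
  \<open>A\<close> disappears.
\<close>

lemma independent_mod_Un:
  assumes N: "complex_vector.subspace N" and "finite A" "finite B"
    and AN: "A \<subseteq> N" and MN: "M \<subseteq> N"
    and A: "independent_mod M A" and B: "independent_mod N B"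
  shows "independent_mod M (A \<union> B)" "A \<inter> B = {}"
proof -
  have sumN: "(\<Sum>a\<in>A. u a *\<^sub>C a) \<in> N" for u
    using AN by (intro complex_vector.subspace_sum[OF N] complex_vector.subspace_scale[OF N]) auto
  show disj: "A \<inter> B = {}"
  proof (rule ccontr)
    assume "A \<inter> B \<noteq> {}"
    then obtain x where x: "x \<in> A" "x \<in> B" by blast
    have "(\<Sum>b\<in>B. (if b = x then 1 else 0) *\<^sub>C b) = (\<Sum>b\<in>B. if b = x then x else 0)"
      by (intro sum.cong) (auto simp: scaleC_one)
    also have "\<dots> = x" using x \<open>finite B\<close> by simp
    finally have "(\<Sum>b\<in>B. (if b = x then 1 else 0) *\<^sub>C b) \<in> N" using x AN by auto
    from independent_modD[OF B this x(2)] show False by simp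
  qed
  show "independent_mod M (A \<union> B)"
    unfolding independent_mod_def
  proof (intro allI impI)
    fix u assume "(\<Sum>b\<in>A \<union> B. u b *\<^sub>C b) \<in> M"
    then have M: "(\<Sum>a\<in>A. u a *\<^sub>C a) + (\<Sum>b\<in>B. u b *\<^sub>C b) \<in> M"
      using disj \<open>finite A\<close> \<open>finite B\<close> by (simp add: sum.union_disjoint)
    then have "((\<Sum>a\<in>A. u a *\<^sub>C a) + (\<Sum>b\<in>B. u b *\<^sub>C b)) - (\<Sum>a\<in>A. u a *\<^sub>C a) \<in> N"
      using MN by (intro complex_vector.subspace_diff[OF N] sumN) auto
    then have "(\<Sum>b\<in>B. u b *\<^sub>C b) \<in> N" by simp
    then have uB: "\<forall>b\<in>B. u b = 0" using independent_modD[OF B] by blast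
    then have "(\<Sum>a\<in>A. u a *\<^sub>C a) \<in> M" using M by simp
    then have "\<forall>a\<in>A. u a = 0" using independent_modD[OF A] by blast
    with uB show "\<forall>b\<in>A \<union> B. u b = 0" by blast
  qed
qed

text \<open>
  The counterpart of \<open>independent_mod\<close>: the cosets of \<open>B\<close> generate the quotient by \<open>M\<close>. Both
  together say that \<open>B\<close> is a basis of an algebraic complement of \<open>M\<close>.
\<close>

definition spans_mod :: "'a::complex_normed_vector set \<Rightarrow> 'a set \<Rightarrow> bool"
  where "spans_mod M B \<longleftrightarrow> (\<forall>x. \<exists>b\<in>complex_vector.span B. x - b \<in> M)"

lemma subspace_span_add_mod:
  assumes "complex_vector.subspace M"
  shows "complex_vector.subspace {x. \<exists>b\<in>complex_vector.span B. x - b \<in> M}"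
proof -
  have "{x. \<exists>b\<in>complex_vector.span B. x - b \<in> M} =
      {m + b |m b. m \<in> M \<and> b \<in> complex_vector.span B}"
  proof (intro set_eqI iffI)
    fix x assume "x \<in> {x. \<exists>b\<in>complex_vector.span B. x - b \<in> M}"
    then obtain b where "b \<in> complex_vector.span B" "x - b \<in> M" by blast
    then show "x \<in> {m + b |m b. m \<in> M \<and> b \<in> complex_vector.span B}"
      by (intro CollectI exI[of _ "x - b"] exI[of _ b]) simp
  qed force
  then show ?thesis using subspace_add_span[OF assms] by simp
qed

lemma independent_mod_insert:
  assumes M: "complex_vector.subspace M" and "finite B" and B: "independent_mod M B"
    and x: "\<not> (\<exists>b\<in>complex_vector.span B. x - b \<in> M)"
  shows "independent_mod M (insert x B)" "x \<notin> B"
proof -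
  let ?N = "{x. \<exists>b\<in>complex_vector.span B. x - b \<in> M}"
  have N: "complex_vector.subspace ?N" by (rule subspace_span_add_mod[OF M])
  have BN: "B \<subseteq> ?N"
    using complex_vector.subspace_0[OF M] complex_vector.span_base by force
  have MN: "M \<subseteq> ?N" using complex_vector.span_zero by force
  have "independent_mod ?N {x}"
    unfolding independent_mod_def
  proof (intro allI impI ballI)
    fix u b assume "(\<Sum>b\<in>{x}. u b *\<^sub>C b) \<in> ?N" "b \<in> {x}"
    then have ub: "u b *\<^sub>C x \<in> ?N" "b = x" by simp_all
    have "inverse (u b) *\<^sub>C u b *\<^sub>C x \<in> ?N" by (rule complex_vector.subspace_scale[OF N ub(1)])
    then show "u b = 0" using x by (cases "u b = 0") (auto simp: scaleC_scaleC scaleC_one)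
  qed
  from independent_mod_Un[OF N \<open>finite B\<close> _ BN MN B this]
  show "independent_mod M (insert x B)" "x \<notin> B" by auto
qed

text \<open>
  The injectivity is a consequence of independence as a family: if two indices had the same vector, the
  coefficients \<open>1\<close> and \<open>-1\<close> would give a nontrivial relation.
\<close>

lemma independent_mod_family:
  assumes M: "complex_vector.subspace M" and C: "finite C"
    and zero: "\<And>u. (\<Sum>c\<in>C. u c *\<^sub>C s c) \<in> M \<Longrightarrow> \<forall>c\<in>C. u c = 0"
  shows "inj_on s C" "independent_mod M (s ` C)"
proof -
  show inj: "inj_on s C"
  proof (rule inj_onI, rule ccontr)
    fix c d assume cd: "c \<in> C" "d \<in> C" "s c = s d" "c \<noteq> d"
    define u where "u x = (if x = c then 1 else if x = d then -1 else 0 :: complex)" for x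
    have "(\<Sum>x\<in>C. u x *\<^sub>C s x) = (\<Sum>x\<in>{c, d}. u x *\<^sub>C s x)"
      using cd C by (intro sum.mono_neutral_right) (auto simp: u_def)
    also have "\<dots> = 0" using cd by (simp add: u_def scaleC_one)
    finally show False
      using zero[of u] cd complex_vector.subspace_0[OF M] by (auto simp: u_def)
  qed
  show "independent_mod M (s ` C)"
    unfolding independent_mod_def
  proof (intro allI impI)
    fix u assume "(\<Sum>b\<in>s ` C. u b *\<^sub>C b) \<in> M"
    then have "(\<Sum>c\<in>C. u (s c) *\<^sub>C s c) \<in> M" by (simp add: sum.reindex[OF inj])
    from zero[OF this] show "\<forall>b\<in>s ` C. u b = 0" by auto
  qed
qed

lemma independent_mod_zero:
  assumes "finite B"
  shows "independent_mod {0} B \<longleftrightarrow> complex_vector.independent B"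
  using complex_vector.dependent_finite[OF assms] by (auto simp: independent_mod_def)

text \<open>
  The Steinitz bound in the quotient by \<open>M\<close>: representatives of the members of \<open>C\<close> in the span of \<open>B\<close> are
  linearly independent in the ordinary sense.
\<close>

lemma independent_mod_card_le:
  assumes M: "complex_vector.subspace M" and "finite B" and C: "finite C" "independent_mod M C"
    and span: "\<And>c. c \<in> C \<Longrightarrow> \<exists>b\<in>complex_vector.span B. c - b \<in> M"
  shows "card C \<le> card B"
proof -
  obtain s where s: "\<And>c. c \<in> C \<Longrightarrow> s c \<in> complex_vector.span B" "\<And>c. c \<in> C \<Longrightarrow> c - s c \<in> M"
    using span by metis
  have zero: "\<forall>c\<in>C. u c = 0" if "(\<Sum>c\<in>C. u c *\<^sub>C s c) = 0" for u
  proof -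
    have "(\<Sum>c\<in>C. u c *\<^sub>C c) = (\<Sum>c\<in>C. u c *\<^sub>C (c - s c))"
      using that by (simp add: complex_vector.scale_right_diff_distrib sum_subtractf)
    also have "\<dots> \<in> M"
      by (intro complex_vector.subspace_sum[OF M] complex_vector.subspace_scale[OF M] s)
    finally show ?thesis using independent_modD[OF C(2)] by blast
  qed
  have sub0: "complex_vector.subspace {0::'a}" by simp
  have inj: "inj_on s C" and "independent_mod {0} (s ` C)"
    using independent_mod_family[OF sub0 C(1), of s] zero by auto
  then have "complex_vector.independent (s ` C)"
    using C(1) by (simp add: independent_mod_zero)
  then have "card (s ` C) \<le> card B"
    using s(1) complex_vector.independent_span_bound[OF \<open>finite B\<close>] by blast
  then show ?thesis by (simp add: card_image[OF inj])
qed

lemma card_le_codimension: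
  "finite B \<Longrightarrow> independent_mod M B \<Longrightarrow> enat (card B) \<le> codimension M"
  unfolding codimension_def by (intro SUP_upper) simp

lemma codimension_le_card:
  assumes "complex_vector.subspace M" "finite B" "spans_mod M B"
  shows "codimension M \<le> enat (card B)"
  unfolding codimension_def using assms
  by (intro SUP_least) (auto intro: independent_mod_card_le simp: spans_mod_def)

lemma independent_mod_empty: "independent_mod M {}"
  by (simp add: independent_mod_def)

lemma maximal_independent_mod:
  assumes M: "complex_vector.subspace M"
    and le: "\<And>B. finite B \<Longrightarrow> independent_mod M B \<Longrightarrow> B \<subseteq> V \<Longrightarrow> card B \<le> n"
  obtains B where "finite B" "independent_mod M B" "B \<subseteq> V"
    "\<And>x. x \<in> V \<Longrightarrow> \<exists>b\<in>complex_vector.span B. x - b \<in> M"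
proof -
  define P where "P k \<longleftrightarrow> (\<exists>B. finite B \<and> independent_mod M B \<and> B \<subseteq> V \<and> card B = k)" for k
  have bd: "k \<le> n" if "P k" for k using le that by (auto simp: P_def)
  have "P 0" by (auto simp: P_def intro!: exI[of _ "{}"] independent_mod_empty)
  then have "P (Greatest P)" using bd by (rule GreatestI_nat)
  then obtain B where B: "finite B" "independent_mod M B" "B \<subseteq> V" "card B = Greatest P"
    by (auto simp: P_def)
  have "\<exists>b\<in>complex_vector.span B. x - b \<in> M" if "x \<in> V" for x
  proof (rule ccontr)
    assume x: "\<not> ?thesis"
    have "P (Suc (card B))"
      using independent_mod_insert[OF M B(1,2) x] B(1,3) that
      unfolding P_def by (intro exI[of _ "insert x B"]) simp
    then have "Suc (card B) \<le> Greatest P" using bd by (rule Greatest_le_nat)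
    with B(4) show False by simp
  qed
  with B that show ?thesis by blast
qed

lemma complementary_basis:
  assumes M: "complex_vector.subspace M" and fin: "codimension M < \<infinity>"
  obtains B where "finite B" "independent_mod M B" "spans_mod M B" "codimension M = enat (card B)"
proof -
  obtain n where n: "codimension M = enat n" using fin by (cases "codimension M") auto
  obtain B where B: "finite B" "independent_mod M B"
    and sp: "\<And>x. x \<in> UNIV \<Longrightarrow> \<exists>b\<in>complex_vector.span B. x - b \<in> M"
    using maximal_independent_mod[OF M, of UNIV n] card_le_codimension[of _ M] n by auto
  have "spans_mod M B" using sp by (simp add: spans_mod_def)
  moreover from this have "codimension M = enat (card B)"
    using card_le_codimension[OF B(1,2)] codimension_le_card[OF M B(1)] by (simp add: antisym)
  ultimately show ?thesis using that B by blast
qed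

lemma codimension_finite: "complex_vector.subspace M \<Longrightarrow> finite B \<Longrightarrow> spans_mod M B \<Longrightarrow> codimension M < \<infinity>"
  using codimension_le_card[of M B] by (metis enat_ord_simps(4) infinity_ileE not_less le_less_trans)

lemma codimension_antimono:
  assumes "M \<subseteq> N"
  shows "codimension N \<le> codimension M"
proof -
  have "independent_mod M B" if "independent_mod N B" for B
    using that assms by (auto simp: independent_mod_def)
  then show ?thesis unfolding codimension_def by (intro SUP_subset_mono) auto
qed

lemma codimension_eq_imp_eq:
  assumes N: "complex_vector.subspace N" and MN: "M \<subseteq> N"
    and M: "complex_vector.subspace M" and fin: "codimension M < \<infinity>" and le: "codimension M \<le> codimension N"
  shows "M = N"
proof (rule ccontr)
  assume "M \<noteq> N"
  then obtain x where x: "x \<in> N" "x \<notin> M" using MN by blast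
  have "codimension N < \<infinity>" using codimension_antimono[OF MN] fin by (rule le_less_trans)
  then obtain B where B: "finite B" "independent_mod N B" "codimension N = enat (card B)"
    using complementary_basis[OF N] by metis
  have "independent_mod M (insert x {})"
    using x by (intro independent_mod_insert[OF M]) (auto simp: independent_mod_empty)
  then have "independent_mod M ({x} \<union> B)" "{x} \<inter> B = {}"
    using independent_mod_Un[OF N _ B(1) _ MN, of "{x}"] x B by auto
  then have "enat (Suc (card B)) \<le> codimension M"
    using card_le_codimension[of "{x} \<union> B" M] B(1) by simp
  then have "enat (Suc (card B)) \<le> enat (card B)" using le B(3) by (metis order_trans)
  then show False by simp
qed

text \<open>
  The codimensions form a decreasing sequence in a well-ordered set, and a subspace of finite codimension is
  determined among its enlargements by that codimension.
\<close>

lemma increasing_subspaces_stabilise: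
  assumes sub: "\<And>n. complex_vector.subspace (M n)" and mono: "\<And>n. M n \<subseteq> M (Suc n)"
    and fin: "codimension (M 0) < \<infinity>"
  shows "\<exists>d. \<forall>n\<ge>d. M n = M d"
proof -
  have inc: "M m \<subseteq> M n" if "m \<le> n" for m n using mono that by (rule lift_Suc_mono_le)
  have fin: "codimension (M n) < \<infinity>" for n
    using codimension_antimono[OF inc[of 0 n]] fin by (rule le_less_trans) simp
  obtain d where d: "\<And>n. codimension (M d) \<le> codimension (M n)"
    by (metis (mono_tags, lifting) LeastI_ex Least_le rangeE rangeI
        wellorder_Least_lemma[of "\<lambda>c. c \<in> range (\<lambda>n. codimension (M n))"])
  have "M d = M n" if "d \<le> n" for n
    by (rule codimension_eq_imp_eq[OF sub inc[OF that] sub fin d])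
  then show ?thesis by (intro exI[of _ d]) simp
qed

lemma cdimension_finite_basis:
  assumes V: "complex_vector.subspace V" and fin: "cdimension V < \<infinity>"
  obtains B where "finite B" "independent_mod {0} B" "complex_vector.span B = V"
    "cdimension V = enat (card B)"
proof -
  obtain F where F: "finite F" "V \<subseteq> complex_vector.span F"
    using fin by (auto simp: cdimension_def split: if_splits)
  obtain B where B: "B \<subseteq> V" "complex_vector.independent B" "V \<subseteq> complex_vector.span B"
    "card B = complex_vector.dim V"
    using complex_vector.basis_exists by blast
  have "finite B"
    using complex_vector.independent_span_bound[OF F(1) B(2)] B(1) F(2) by blast
  moreover have "complex_vector.span B = V"
    using B V complex_vector.span_minimal by blast
  moreover have "cdimension V = enat (card B)"
    using F B(4) by (auto simp: cdimension_def)
  ultimately show ?thesis using that B(2) by (simp add: independent_mod_zero)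
qed

lemma card_le_cdimension:
  assumes B: "finite B" "independent_mod {0} B" "B \<subseteq> V" and V: "complex_vector.subspace V"
  shows "enat (card B) \<le> cdimension V"
proof (cases "cdimension V < \<infinity>")
  case True
  then obtain D where D: "finite D" "complex_vector.span D = V" "cdimension V = enat (card D)"
    using cdimension_finite_basis[OF V] by metis
  have "card B \<le> card D"
    using complex_vector.independent_span_bound[OF D(1), of B] B D(2) by (simp add: independent_mod_zero)
  with D show ?thesis by simp
qed simp

text \<open>
  Bounding the sizes of the independent sets suffices: this also yields that the dimension is finite, which
  is part of the meaning of a finite value of \<open>cdimension\<close>.
\<close>

lemma cdimension_le:
  assumes V: "complex_vector.subspace V"
    and le: "\<And>B. finite B \<Longrightarrow> independent_mod {0} B \<Longrightarrow> B \<subseteq> V \<Longrightarrow> card B \<le> n"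
  shows "cdimension V \<le> enat n"
proof -
  have sub0: "complex_vector.subspace {0::'a}" by simp
  obtain B where B: "finite B"
    and sp: "\<And>x. x \<in> V \<Longrightarrow> \<exists>b\<in>complex_vector.span B. x - b \<in> {0}"
    using maximal_independent_mod[OF sub0, of V n] le by metis
  have "V \<subseteq> complex_vector.span B" using sp by force
  then have "cdimension V < \<infinity>" using B by (auto simp: cdimension_def)
  then obtain D where "finite D" "independent_mod {0} D" "complex_vector.span D = V"
    "cdimension V = enat (card D)"
    using cdimension_finite_basis[OF V] by metis
  then show ?thesis using le[of D] complex_vector.span_superset[of D] by simp
qed

section \<open>Kernels and ranges of powers\<close>

lemma spans_mod_rangeE:
  assumes "spans_mod (range f) B"
  obtains b y where "b \<in> complex_vector.span B" "x - b = f y"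
  using assms unfolding spans_mod_def by (meson rangeE)

lemma subspace_kernel: "complex_vector.subspace (kernel S)"
  by (auto simp: complex_vector.subspace_def cblinfun_zero cblinfun_add cblinfun_scale)

lemma subspace_image:
  "complex_vector.subspace V \<Longrightarrow> complex_vector.subspace (cblinfun_apply S ` V)"
proof (rule complex_vector.subspaceI)
  assume V: "complex_vector.subspace V"
  show "0 \<in> cblinfun_apply S ` V"
    using complex_vector.subspace_0[OF V] by (metis cblinfun_zero image_eqI)
  show "x + y \<in> cblinfun_apply S ` V" if "x \<in> cblinfun_apply S ` V" "y \<in> cblinfun_apply S ` V" for x y
    using that complex_vector.subspace_add[OF V] by (auto simp flip: cblinfun_add)
  show "c *\<^sub>C x \<in> cblinfun_apply S ` V" if "x \<in> cblinfun_apply S ` V" for c x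
    using that complex_vector.subspace_scale[OF V] by (auto simp flip: cblinfun_scale)
qed

lemma subspace_range: "complex_vector.subspace (range_of S)"
  by (rule subspace_image) simp

lemma image_span:
  assumes "x \<in> complex_vector.span B"
  shows "cblinfun_apply S x \<in> complex_vector.span (cblinfun_apply S ` B)"
  using assms
proof (rule complex_vector.span_induct_alt)
  show "cblinfun_apply S (c *\<^sub>C b + y) \<in> complex_vector.span (cblinfun_apply S ` B)"
    if "b \<in> B" "cblinfun_apply S y \<in> complex_vector.span (cblinfun_apply S ` B)" for c b y
    using that by (simp add: cblinfun_add cblinfun_scale complex_vector.span_add
        complex_vector.span_scale complex_vector.span_base)
qed (simp add: cblinfun_zero complex_vector.span_zero)

lemma cblinfun_power_Suc: "cblinfun_apply (cblinfun_power S (Suc n)) x = cblinfun_apply S (cblinfun_apply (cblinfun_power S n) x)"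
  by (simp add: cblinfun_compose.rep_eq)

lemma cblinfun_power_0: "cblinfun_apply (cblinfun_power S 0) x = x"
  by (simp add: id_cblinfun.rep_eq)

lemma cblinfun_power_add:
  "cblinfun_apply (cblinfun_power S (m + n)) x =
    cblinfun_apply (cblinfun_power S m) (cblinfun_apply (cblinfun_power S n) x)"
  by (induction m) (simp_all add: cblinfun_power_0 cblinfun_power_Suc del: cblinfun_power.simps)

lemma cblinfun_power_Suc_right:
  "cblinfun_apply (cblinfun_power S (Suc n)) x = cblinfun_apply (cblinfun_power S n) (cblinfun_apply S x)"
  using cblinfun_power_add[of S n 1 x]
  by (simp add: cblinfun_power_0 cblinfun_power_Suc del: cblinfun_power.simps)

declare cblinfun_power.simps [simp del]

lemma range_power_antimono:
  assumes "m \<le> n"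
  shows "range_of (cblinfun_power S n) \<subseteq> range_of (cblinfun_power S m)"
  using assms cblinfun_power_add[of S m "n - m"] by auto

lemma range_power_Suc:
  "range_of (cblinfun_power S (Suc n)) = cblinfun_apply S ` range_of (cblinfun_power S n)"
  by (auto simp: cblinfun_power_Suc)

lemma kernel_power_mono_Suc: "kernel (cblinfun_power S n) \<subseteq> kernel (cblinfun_power S (Suc n))"
  by (auto simp: cblinfun_power_Suc cblinfun_zero)

text \<open>
  The \<open>n\<close>-th power maps the kernel of the next power onto the intersection on the right, with the kernel of
  the \<open>n\<close>-th power as its own kernel. So the ascent is finite exactly if some range of a power
  meets the kernel trivially.
\<close>

lemma kernel_power_stable_iff:
  "kernel (cblinfun_power S n) = kernel (cblinfun_power S (Suc n)) \<longleftrightarrow>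
    kernel S \<inter> range_of (cblinfun_power S n) \<subseteq> {0}"
  using kernel_power_mono_Suc[of S n] by (auto simp: cblinfun_power_Suc)

lemma kernel_power_stable_Suc:
  assumes "kernel (cblinfun_power S n) = kernel (cblinfun_power S (Suc n))"
  shows "kernel (cblinfun_power S (Suc n)) = kernel (cblinfun_power S (Suc (Suc n)))"
  using assms range_power_antimono[of n "Suc n" S] unfolding kernel_power_stable_iff by auto

lemma ascent_finite_iff:
  "ascent S < \<infinity> \<longleftrightarrow> (\<exists>p. kernel (cblinfun_power S p) = kernel (cblinfun_power S (Suc p)))"
  by (simp add: ascent_def)

lemma left_Drazin_invertibleE:
  assumes "left_Drazin_invertible S"
  obtains p where "kernel (cblinfun_power S p) = kernel (cblinfun_power S (Suc p))"
    "closed (range_of (cblinfun_power S (Suc p)))"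
proof -
  obtain p where p: "ascent S = enat p" "closed (range_of (cblinfun_power S (p + 1)))"
    using assms by (auto simp: left_Drazin_invertible_def)
  define P where "P p \<longleftrightarrow> kernel (cblinfun_power S p) = kernel (cblinfun_power S (p + 1))" for p
  have asc: "ascent S = (if \<exists>p. P p then enat (LEAST p. P p) else \<infinity>)"
    by (simp add: ascent_def P_def)
  have ex: "\<exists>p. P p" using p(1) asc by (metis enat.distinct(1))
  then have "p = (LEAST p. P p)" using p(1) asc by simp
  then have "P p" using LeastI_ex[OF ex] by simp
  with p(2) that show ?thesis by (simp add: P_def)
qed

lemma left_Drazin_invertibleI:
  assumes "ascent S < \<infinity>" "\<And>n. closed (range_of (cblinfun_power S n))"
  shows "left_Drazin_invertible S"
  using assms by (auto simp: left_Drazin_invertible_def less_infinityE)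

text \<open>
  With a finite-dimensional complement \<open>span B\<close>, the map \<open>(x, b) \<mapsto> S x + b\<close> is onto, hence open. So a
  point that is a limit of points of the range has a complementary component of arbitrarily small norm.
\<close>

lemma closed_range_finite_codimension:
  fixes S :: "'a::complex_banach \<Rightarrow>\<^sub>C\<^sub>L 'a"
  assumes fin: "codimension (range_of S) < \<infinity>"
  shows "closed (range_of S)"
proof -
  obtain B where B: "finite B" "independent_mod (range_of S) B" "spans_mod (range_of S) B"
    using complementary_basis[OF subspace_range fin] by metis
  define V where "V = (UNIV :: 'a set) \<times> complex_vector.span B"
  define f where "f = (\<lambda>z. cblinfun_apply S (fst z) + snd z)"
  have f: "bounded_linear f"
    unfolding f_def
    by (intro bounded_linear_add bounded_linear_snd
        bounded_linear_compose[OF cblinfun_bounded_linear bounded_linear_fst])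
  have "subspace V"
    unfolding V_def by (intro subspace_Times complex_subspace_real) simp_all
  moreover have "closed (complex_vector.span B)"
    using closed_add_span[of "{0}" B] B(1) by simp
  then have "closed V" unfolding V_def by (intro closed_Times) simp_all
  moreover have "f ` V = UNIV"
  proof -
    have "x \<in> f ` V" for x
    proof -
      obtain b y where "b \<in> complex_vector.span B" "x - b = cblinfun_apply S y"
        using B(3) by (rule spans_mod_rangeE)
      then show ?thesis
        by (intro image_eqI[of _ _ "(y, b)"]) (auto simp: V_def f_def algebra_simps)
    qed
    then show ?thesis by blast
  qed
  ultimately obtain C where C: "0 \<le> C" "\<And>w. \<exists>z\<in>V. f z = w \<and> norm z \<le> C * norm w"
    using open_mapping[OF f, of V UNIV] by auto
  have indep: "b = 0" if b: "b \<in> complex_vector.span B" "b \<in> range_of S" for b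
  proof -
    obtain u where "b = (\<Sum>a\<in>B. u a *\<^sub>C a)"
      using b(1) unfolding complex_vector.span_finite[OF B(1)] by blast
    moreover from this have "\<forall>a\<in>B. u a = 0" using independent_modD[OF B(2)] b(2) by auto
    ultimately show ?thesis by simp
  qed
  have "w \<in> range_of S" if w: "w \<in> closure (range_of S)" for w
  proof -
    obtain x b where xb: "b \<in> complex_vector.span B" "w = cblinfun_apply S x + b"
      using C(2)[of w] by (auto simp: V_def f_def)
    \<comment> \<open>The complementary component of \<open>w - v\<close> is \<open>b\<close> for every \<open>v\<close> in the range.\<close>
    have small: "norm b \<le> C * dist v w" if v: "v \<in> range_of S" for v
    proof -
      obtain y where y: "v = cblinfun_apply S y" using v by blast
      obtain z where z: "z \<in> V" "f z = w - v" "norm z \<le> C * norm (w - v)" using C(2) by blast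
      obtain x' b' where "z = (x', b')" by (cases z)
      with z have x'b': "b' \<in> complex_vector.span B" "w - v = cblinfun_apply S x' + b'"
        "norm (x', b') \<le> C * norm (w - v)" by (auto simp: V_def f_def)
      have "b - b' = cblinfun_apply S (x' + y - x)"
        using xb(2) x'b'(2) y by (simp add: cblinfun_add cblinfun_diff algebra_simps)
      then have "b - b' \<in> range_of S" by (rule range_eqI)
      then have "b - b' = 0"
        using indep complex_vector.span_diff[OF xb(1) x'b'(1)] by blast
      then have "norm b \<le> norm (x', b')" using norm_snd_le[of b' x'] by simp
      with x'b'(3) show ?thesis by (simp add: dist_norm norm_minus_commute)
    qed
    have "norm b \<le> 0"
    proof (rule field_le_epsilon)
      fix e :: real assume e: "0 < e"
      then have "0 < e / (C + 1)" using C(1) by simp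
      then obtain v where v: "v \<in> range_of S" "dist v w < e / (C + 1)"
        using w closure_approachable by blast
      have "norm b \<le> C * dist v w" by (rule small[OF v(1)])
      also have "\<dots> \<le> (C + 1) * (e / (C + 1))"
        using v(2) C(1) by (intro mult_mono) simp_all
      finally show "norm b \<le> 0 + e" using C(1) by simp
    qed
    with xb show ?thesis by simp
  qed
  then show ?thesis using closure_subset_eq by blast
qed

text \<open>
  If \<open>B\<close> spans modulo the range of \<open>S\<close> and \<open>C\<close> modulo the range of the \<open>n\<close>-th power, then
  \<open>B \<union> S C\<close> spans modulo the range of the next power.
\<close>

lemma codimension_range_power:
  assumes fin: "codimension (range_of S) < \<infinity>"
  shows "codimension (range_of (cblinfun_power S n)) < \<infinity>"
proof (induction n)
  case 0
  have "spans_mod (range_of (cblinfun_power S 0)) {}"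
    by (auto simp: spans_mod_def cblinfun_power_0)
  then show ?case by (rule codimension_finite[OF subspace_range finite.emptyI])
next
  case (Suc n)
  obtain B where B: "finite B" "spans_mod (range_of S) B"
    using complementary_basis[OF subspace_range fin] by metis
  obtain C where C: "finite C" "spans_mod (range_of (cblinfun_power S n)) C"
    using complementary_basis[OF subspace_range Suc] by metis
  have "spans_mod (range_of (cblinfun_power S (Suc n))) (B \<union> cblinfun_apply S ` C)"
    unfolding spans_mod_def
  proof
    fix x
    obtain b y where b: "b \<in> complex_vector.span B" "x - b = cblinfun_apply S y"
      using B(2) by (rule spans_mod_rangeE)
    obtain c z where c: "c \<in> complex_vector.span C" "y - c = cblinfun_apply (cblinfun_power S n) z"
      using C(2) by (rule spans_mod_rangeE)
    have "x - (b + cblinfun_apply S c) = cblinfun_apply S (y - c)"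
      using b(2) by (simp add: cblinfun_diff algebra_simps)
    also have "\<dots> = cblinfun_apply (cblinfun_power S (Suc n)) z"
      by (simp add: c(2) cblinfun_power_Suc)
    finally have "x - (b + cblinfun_apply S c) \<in> range_of (cblinfun_power S (Suc n))" by simp
    moreover have "b + cblinfun_apply S c \<in> complex_vector.span (B \<union> cblinfun_apply S ` C)"
      using b(1) image_span[OF c(1), of S] complex_vector.span_mono[of B "B \<union> cblinfun_apply S ` C"]
        complex_vector.span_mono[of "cblinfun_apply S ` C" "B \<union> cblinfun_apply S ` C"]
      by (intro complex_vector.span_add) auto
    ultimately show "\<exists>b\<in>complex_vector.span (B \<union> cblinfun_apply S ` C).
        x - b \<in> range_of (cblinfun_power S (Suc n))" by blast
  qed
  then show ?case using B(1) C(1) by (intro codimension_finite[OF subspace_range]) auto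
qed

lemma closed_range_power:
  fixes S :: "'a::complex_banach \<Rightarrow>\<^sub>C\<^sub>L 'a"
  assumes "deficiency S < \<infinity>"
  shows "closed (range_of (cblinfun_power S n))"
  using assms codimension_range_power closed_range_finite_codimension
  by (auto simp: deficiency_def)

section \<open>Finite ascent and the index\<close>

text \<open>
  On the finite-dimensional quotient by \<open>W\<close>, the map induced by \<open>S\<close> has a kernel and a cokernel of equal
  dimension. Its kernel is \<open>E / W\<close>, into which the kernel of \<open>S\<close> embeds because it meets \<open>W\<close> trivially; its
  cokernel has the dimension of the cokernel of \<open>S\<close> because the range of \<open>S\<close> contains \<open>W\<close>. If
  the embedding is onto, every \<open>x\<close> with \<open>S x \<in> W\<close> differs from an element of \<open>W\<close> by an element of the kernel, and so
  \<open>S\<close> maps \<open>W\<close> onto \<open>W\<close>. The argument is carried out with bases instead of quotient spaces.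
\<close>

lemma nullity_versus_deficiency:
  fixes S :: "'a::complex_normed_vector \<Rightarrow>\<^sub>C\<^sub>L 'a"
  assumes W: "complex_vector.subspace W" and WW: "cblinfun_apply S ` W \<subseteq> W"
    and WR: "W \<subseteq> range_of S" and fin: "codimension W < \<infinity>" and ker: "kernel S \<inter> W \<subseteq> {0}"
  shows "nullity S \<le> deficiency S" "deficiency S \<le> nullity S \<Longrightarrow> W \<subseteq> cblinfun_apply S ` W"
proof -
  define E where "E = {x. cblinfun_apply S x \<in> W}"
  have E: "complex_vector.subspace E"
    using W by (auto simp: E_def complex_vector.subspace_def cblinfun_zero cblinfun_add cblinfun_scale)
  have WE: "W \<subseteq> E" using WW by (auto simp: E_def)
  have kerE: "kernel S \<subseteq> E" using complex_vector.subspace_0[OF W] by (auto simp: E_def)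
  obtain D where D: "finite D" "independent_mod E D" "spans_mod E D"
    using complementary_basis[OF E] codimension_antimono[OF WE] fin by (metis le_less_trans)
  obtain B where B: "finite B" "spans_mod (range_of S) B" and defB: "deficiency S = enat (card B)"
    using complementary_basis[OF subspace_range, of S] codimension_antimono[OF WR] fin
    unfolding deficiency_def by (metis le_less_trans)
  have "spans_mod W (B \<union> cblinfun_apply S ` D)"
    unfolding spans_mod_def
  proof
    fix x
    obtain b y where b: "b \<in> complex_vector.span B" "x - b = cblinfun_apply S y"
      using B(2) by (rule spans_mod_rangeE)
    obtain d where d: "d \<in> complex_vector.span D" "y - d \<in> E"
      using D(3) by (auto simp: spans_mod_def)
    have "x - (b + cblinfun_apply S d) = cblinfun_apply S (y - d)"
      using b(2) by (simp add: cblinfun_diff algebra_simps)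
    then have "x - (b + cblinfun_apply S d) \<in> W" using d(2) by (simp add: E_def)
    moreover have "b + cblinfun_apply S d \<in> complex_vector.span (B \<union> cblinfun_apply S ` D)"
      using b(1) image_span[OF d(1), of S] complex_vector.span_mono[of B "B \<union> cblinfun_apply S ` D"]
        complex_vector.span_mono[of "cblinfun_apply S ` D" "B \<union> cblinfun_apply S ` D"]
      by (intro complex_vector.span_add) auto
    ultimately show "\<exists>b\<in>complex_vector.span (B \<union> cblinfun_apply S ` D). x - b \<in> W" by blast
  qed
  then have "codimension W \<le> enat (card (B \<union> cblinfun_apply S ` D))"
    using B(1) D(1) by (intro codimension_le_card[OF W]) auto
  also have "\<dots> \<le> enat (card B + card D)"
    using card_Un_le[of B "cblinfun_apply S ` D"] card_image_le[OF D(1), of "cblinfun_apply S"] by simp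
  finally have codW: "codimension W \<le> enat (card B + card D)" .
  have CD: "independent_mod W (C \<union> D)" "card (C \<union> D) = card C + card D"
    if C: "finite C" "independent_mod {0} C" "C \<subseteq> kernel S" for C
  proof -
    have "independent_mod W C"
      unfolding independent_mod_def
    proof (intro allI impI)
      fix u assume "(\<Sum>b\<in>C. u b *\<^sub>C b) \<in> W"
      moreover have "(\<Sum>b\<in>C. u b *\<^sub>C b) \<in> kernel S"
        using C(3) by (intro complex_vector.subspace_sum[OF subspace_kernel]
            complex_vector.subspace_scale[OF subspace_kernel]) auto
      ultimately have "(\<Sum>b\<in>C. u b *\<^sub>C b) \<in> {0}" using ker by blast
      then show "\<forall>b\<in>C. u b = 0" using independent_modD[OF C(2)] by blast
    qed
    moreover have "C \<subseteq> E" using C(3) kerE by blast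
    ultimately have "independent_mod W (C \<union> D)" "C \<inter> D = {}"
      using independent_mod_Un[OF E C(1) D(1) _ WE _ D(2)] by auto
    then show "independent_mod W (C \<union> D)" "card (C \<union> D) = card C + card D"
      using C(1) D(1) by (simp_all add: card_Un_disjoint)
  qed
  have "card C \<le> card B" if C: "finite C" "independent_mod {0} C" "C \<subseteq> kernel S" for C
  proof -
    have "enat (card C + card D) \<le> codimension W"
      using card_le_codimension[of "C \<union> D" W] CD[OF C] C(1) D(1) by simp
    with codW have "enat (card C + card D) \<le> enat (card B + card D)" by (rule order_trans[rotated])
    then show ?thesis by simp
  qed
  then show le: "nullity S \<le> deficiency S"
    unfolding nullity_def defB by (intro cdimension_le subspace_kernel)
  assume ge: "deficiency S \<le> nullity S"
  have "nullity S < \<infinity>" using le by (rule le_less_trans) (simp add: defB)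
  then obtain C where C: "finite C" "independent_mod {0} C" "complex_vector.span C = kernel S"
    "nullity S = enat (card C)"
    using cdimension_finite_basis[OF subspace_kernel, of S] unfolding nullity_def by metis
  have Cker: "C \<subseteq> kernel S" using C(3) complex_vector.span_superset by blast
  have BC: "card B \<le> card C" using ge C(4) defB by simp
  show "W \<subseteq> cblinfun_apply S ` W"
  proof
    fix w assume w: "w \<in> W"
    then obtain x where x: "w = cblinfun_apply S x" using WR by blast
    have "\<exists>s\<in>complex_vector.span (C \<union> D). x - s \<in> W"
    proof (rule ccontr)
      assume "\<not> ?thesis"
      then have "independent_mod W (insert x (C \<union> D))" "x \<notin> C \<union> D"
        using independent_mod_insert[OF W _ CD(1)[OF C(1,2) Cker]] C(1) D(1) by auto
      then have "enat (Suc (card C + card D)) \<le> codimension W"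
        using card_le_codimension[of "insert x (C \<union> D)" W] CD(2)[OF C(1,2) Cker] C(1) D(1) by simp
      with codW have "enat (Suc (card C + card D)) \<le> enat (card B + card D)" by (rule order_trans[rotated])
      with BC show False by simp
    qed
    then obtain c d where c: "c \<in> complex_vector.span C" and d: "d \<in> complex_vector.span D"
      and cd: "x - (c + d) \<in> W" by (auto simp: complex_vector.span_Un)
    have xE: "x \<in> E" using w x by (simp add: E_def)
    have cE: "c \<in> E" using c C(3) kerE by blast
    have "x - (c + d) \<in> E" using cd WE by blast
    then have "(x - c) - (x - (c + d)) \<in> E"
      by (rule complex_vector.subspace_diff[OF E complex_vector.subspace_diff[OF E xE cE]])
    then have "d \<in> E" by simp
    moreover obtain u where u: "d = (\<Sum>a\<in>D. u a *\<^sub>C a)"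
      using d unfolding complex_vector.span_finite[OF D(1)] by blast
    ultimately have "\<forall>a\<in>D. u a = 0" using independent_modD[OF D(2)] by auto
    then have "d = 0" using u by simp
    moreover have "cblinfun_apply S c = 0" using c C(3) by auto
    ultimately have "w = cblinfun_apply S (x - (c + d))" by (simp add: x cblinfun_diff)
    with cd show "w \<in> cblinfun_apply S ` W" by blast
  qed
qed

text \<open>
  The invariant subspace is the range of a power of \<open>S\<close> beyond the ascent. The second part says that an
  operator of index zero with finite ascent also has finite descent.
\<close>

lemma finite_ascent_finite_deficiency:
  fixes S :: "'a::complex_normed_vector \<Rightarrow>\<^sub>C\<^sub>L 'a"
  assumes asc: "ascent S < \<infinity>" and fin: "deficiency S < \<infinity>"
  shows "nullity S \<le> deficiency S"
    "deficiency S \<le> nullity S \<Longrightarrow>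
      \<exists>q. range_of (cblinfun_power S q) = range_of (cblinfun_power S (Suc q))"
proof -
  obtain p where "kernel (cblinfun_power S p) = kernel (cblinfun_power S (Suc p))"
    using asc ascent_finite_iff[of S] by auto
  \<comment> \<open>The exponent is raised by one to make it positive, so that the range lies in that of \<open>S\<close>.\<close>
  then have p: "kernel S \<inter> range_of (cblinfun_power S (Suc p)) \<subseteq> {0}"
    using kernel_power_stable_iff[of S "Suc p"] kernel_power_stable_Suc[of S p] by simp
  let ?W = "range_of (cblinfun_power S (Suc p))"
  have image: "cblinfun_apply S ` ?W = range_of (cblinfun_power S (Suc (Suc p)))"
    by (simp add: range_power_Suc)
  have inv: "cblinfun_apply S ` ?W \<subseteq> ?W"
    unfolding image by (intro range_power_antimono) simp
  have WR: "?W \<subseteq> range_of S" by (auto simp: cblinfun_power_Suc)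
  have codW: "codimension ?W < \<infinity>"
    using fin by (intro codimension_range_power) (simp add: deficiency_def)
  note * = nullity_versus_deficiency[OF subspace_range inv WR codW p]
  show "nullity S \<le> deficiency S" by (rule *(1))
  assume "deficiency S \<le> nullity S"
  then have "?W = cblinfun_apply S ` ?W" using *(2) inv by blast
  then show "\<exists>q. range_of (cblinfun_power S q) = range_of (cblinfun_power S (Suc q))"
    unfolding image by blast
qed

section \<open>Vector-valued analytic functions\<close>

lemma scaleC_left_bounded_linear: "bounded_linear (\<lambda>c. c *\<^sub>C (x::'a::complex_normed_vector))"
  by (rule bounded_linear_intro[where K="norm x"])
    (simp_all add: scaleC_add_left norm_scaleC scaleR_scaleC scaleC_scaleC scaleC_complex_def)

lemma vector_analytic_functional:
  fixes \<phi> :: "'a::complex_normed_vector cdual"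
  assumes "vector_analytic_on f D"
  shows "(\<lambda>z. cblinfun_apply \<phi> (f z)) holomorphic_on D"
  unfolding holomorphic_on_def
proof
  fix z assume "z \<in> D"
  then obtain d where "(f has_derivative (\<lambda>h. h *\<^sub>C d)) (at z)"
    using assms by (auto simp: vector_analytic_on_def)
  then have "((\<lambda>z. cblinfun_apply \<phi> (f z)) has_derivative (\<lambda>h. cblinfun_apply \<phi> (h *\<^sub>C d))) (at z)"
    by (rule bounded_linear.has_derivative[OF cblinfun_bounded_linear])
  moreover have "(\<lambda>h. cblinfun_apply \<phi> (h *\<^sub>C d)) = (*) (cblinfun_apply \<phi> d)"
    by (rule ext) (simp add: cblinfun_scale scaleC_complex_def mult.commute)
  ultimately have "((\<lambda>z. cblinfun_apply \<phi> (f z)) has_field_derivative cblinfun_apply \<phi> d) (at z)"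
    by (simp add: has_field_derivative_def)
  then show "(\<lambda>z. cblinfun_apply \<phi> (f z)) field_differentiable (at z within D)"
    by (meson field_differentiable_def has_field_derivative_at_within)
qed

lemma vector_analytic_isCont: "vector_analytic_on f D \<Longrightarrow> z \<in> D \<Longrightarrow> isCont f z"
  unfolding vector_analytic_on_def by (meson has_derivative_continuous)

text \<open>
  The functionals in the dual space separate points, so the scalar identity theorem carries over.
\<close>

lemma vector_identity_theorem:
  fixes f :: "complex \<Rightarrow> 'a::complex_normed_vector"
  assumes f: "vector_analytic_on f (ball l r)"
    and U: "U \<subseteq> ball l r" "\<xi> islimpt U" "\<xi> \<in> ball l r" and zero: "\<And>z. z \<in> U \<Longrightarrow> f z = 0"
    and w: "w \<in> ball l r"
  shows "f w = 0"
proof (rule ccontr)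
  assume "f w \<noteq> 0"
  then obtain \<phi> :: "'a cdual" where \<phi>: "cblinfun_apply \<phi> (f w) = 1"
    using separate_point_closed_subspace[of "{0}" "f w"] by auto
  have "cblinfun_apply \<phi> (f w) = 0"
    by (rule analytic_continuation[OF vector_analytic_functional[OF f] _ _ U(1,3,2) _ w])
      (simp_all add: zero cblinfun_zero)
  with \<phi> show False by simp
qed

text \<open>
  Termwise differentiation, justified by the Weierstrass test applied to the differentiated series.
\<close>

lemma power_series_analytic:
  fixes x :: "nat \<Rightarrow> 'a::complex_banach"
  assumes C: "0 \<le> C" and x: "\<And>n. norm (x n) \<le> A * C ^ n" and r: "0 < r" "r * C < 1"
  shows "\<exists>f. vector_analytic_on f (ball l r) \<and> (\<forall>z\<in>ball l r. (\<lambda>n. (z - l) ^ n *\<^sub>C x n) sums f z)"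
proof -
  define g where "g n z = (of_nat n * (z - l) ^ (n - 1)) *\<^sub>C x n" for n z
  have A: "0 \<le> A" using x[of 0] by (simp) (meson norm_ge_zero order_trans)
  have g_bound: "norm (g n z) \<le> A * (real n * r ^ (n - 1) * C ^ n)" if "z \<in> ball l r" for n z
  proof -
    have "norm (g n z) = real n * cmod (z - l) ^ (n - 1) * norm (x n)"
      by (simp add: g_def norm_scaleC norm_mult norm_power)
    also have "\<dots> \<le> (real n * r ^ (n - 1)) * (A * C ^ n)"
      using that r by (intro mult_mono mult_left_mono power_mono x)
        (auto simp: dist_norm norm_minus_commute)
    finally show ?thesis by (simp add: mult_ac)
  qed
  have "summable (\<lambda>n. real (Suc n) * (r * C) ^ n)"
    using geometric_deriv_sums[of "r * C"] r C by (auto simp: sums_iff)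
  then have "summable (\<lambda>n. (A * C) * (real (Suc n) * (r * C) ^ n))" by (rule summable_mult)
  then have "summable (\<lambda>n. A * (real (Suc n) * r ^ (Suc n - 1) * C ^ Suc n))"
    by (simp add: power_mult_distrib mult_ac)
  then have sumM: "summable (\<lambda>n. A * (real n * r ^ (n - 1) * C ^ n))"
    by (subst (asm) summable_Suc_iff)
  have unif: "uniform_limit (ball l r) (\<lambda>n z. \<Sum>i<n. g i z) (\<lambda>z. \<Sum>i. g i z) sequentially"
    by (rule Weierstrass_m_test[OF g_bound sumM])
  have "\<exists>f. \<forall>z\<in>ball l r. (\<lambda>n. (z - l) ^ n *\<^sub>C x n) sums f z \<and>
      (f has_derivative (\<lambda>h. h *\<^sub>C (\<Sum>i. g i z))) (at z within ball l r)"
  proof (rule has_derivative_series[where f'="\<lambda>n z h. h *\<^sub>C g n z"])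
    fix n z assume "z \<in> ball l r"
    have "((\<lambda>z. (z - l) ^ n) has_field_derivative of_nat n * (z - l) ^ (n - 1)) (at z within ball l r)"
      by (auto intro!: derivative_eq_intros)
    then have "((\<lambda>z. (z - l) ^ n) has_derivative (\<lambda>h. (of_nat n * (z - l) ^ (n - 1)) * h)) (at z within ball l r)"
      by (simp add: has_field_derivative_def)
    from bounded_linear.has_derivative[OF scaleC_left_bounded_linear this, of "x n"]
    show "((\<lambda>z. (z - l) ^ n *\<^sub>C x n) has_derivative (\<lambda>h. h *\<^sub>C g n z)) (at z within ball l r)"
      by (simp add: g_def scaleC_scaleC mult.commute)
  next
    fix e :: real assume "0 < e"
    from uniform_limitD[OF unif this]
    show "\<forall>\<^sub>F n in sequentially. \<forall>z\<in>ball l r. \<forall>h. norm ((\<Sum>i<n. h *\<^sub>C g i z) - h *\<^sub>C (\<Sum>i. g i z)) \<le> e * norm h"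
    proof eventually_elim
      case (elim n)
      show ?case
      proof (intro ballI allI)
        fix z h assume z: "z \<in> ball l r"
        have "norm ((\<Sum>i<n. h *\<^sub>C g i z) - h *\<^sub>C (\<Sum>i. g i z)) = cmod h * dist (\<Sum>i<n. g i z) (\<Sum>i. g i z)"
          by (simp add: dist_norm norm_scaleC complex_vector.scale_sum_right[symmetric]
              complex_vector.scale_right_diff_distrib[symmetric])
        also have "\<dots> \<le> cmod h * e" using elim z by (intro mult_left_mono) (auto intro: less_imp_le)
        finally show "norm ((\<Sum>i<n. h *\<^sub>C g i z) - h *\<^sub>C (\<Sum>i. g i z)) \<le> e * norm h"
          by (simp add: mult.commute)
      qed
    qed
  next
    show "l \<in> ball l r" using r by simp
    have "(\<lambda>n. (l - l) ^ n *\<^sub>C x n) = (\<lambda>n. if n = 0 then x 0 else 0)"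
      by (rule ext) (simp add: scaleC_one)
    then show "(\<lambda>n. (l - l) ^ n *\<^sub>C x n) sums x 0" using sums_single[of 0 "\<lambda>_. x 0"] by simp
  qed simp
  then obtain f where f: "\<forall>z\<in>ball l r. (\<lambda>n. (z - l) ^ n *\<^sub>C x n) sums f z \<and>
      (f has_derivative (\<lambda>h. h *\<^sub>C (\<Sum>i. g i z))) (at z within ball l r)" by blast
  then have "vector_analytic_on f (ball l r)"
    by (auto simp: vector_analytic_on_def at_within_open[OF _ open_ball])
  with f show ?thesis by blast
qed

section \<open>Eigenfunctions and the single-valued extension property\<close>

lemma shifted_apply:
  "cblinfun_apply (T - z *\<^sub>C id_cblinfun) x = cblinfun_apply T x - z *\<^sub>C x"
  by (simp add: minus_cblinfun.rep_eq scaleC_cblinfun.rep_eq id_cblinfun.rep_eq)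

lemma kernel_shifted:
  assumes "cblinfun_apply (T - z *\<^sub>C id_cblinfun) x = 0"
  shows "cblinfun_apply (T - m *\<^sub>C id_cblinfun) x = (z - m) *\<^sub>C x"
  using assms by (simp add: shifted_apply complex_vector.scale_left_diff_distrib)

text \<open>
  This is how eigenfunctions enter the ranges of powers: for \<open>(T - z) (f z) = 0\<close> the vector \<open>f z\<close> is an
  eigenvector of \<open>T - m\<close> for the eigenvalue \<open>z - m\<close>.
\<close>

lemma eigenvector_in_range_power:
  assumes x: "cblinfun_apply S x = c *\<^sub>C x" and c: "c \<noteq> 0"
  shows "x \<in> range_of (cblinfun_power S n)"
proof -
  have "cblinfun_apply (cblinfun_power S n) x = c ^ n *\<^sub>C x"
    by (induction n) (simp_all add: cblinfun_power_0 cblinfun_power_Suc cblinfun_scale x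
        scaleC_scaleC scaleC_one mult.commute)
  then have "cblinfun_apply (cblinfun_power S n) (inverse (c ^ n) *\<^sub>C x) = x"
    using c by (simp add: cblinfun_scale scaleC_scaleC scaleC_one)
  then show ?thesis by (metis rangeI)
qed

text \<open>
  Off \<open>m\<close> the values of \<open>f\<close> lie in the range of every power of \<open>T - m\<close>. By continuity \<open>f m\<close> lies in those
  ranges that are closed, and the one that is closed by assumption meets the kernel of \<open>T - m\<close> trivially.
\<close>

lemma eigenfunction_vanishes_at_left_Drazin_point:
  assumes f: "vector_analytic_on f (ball l r)" and m: "m \<in> ball l r"
    and ker: "\<And>z. z \<in> ball l r \<Longrightarrow> cblinfun_apply (T - z *\<^sub>C id_cblinfun) (f z) = 0"
    and LD: "left_Drazin_invertible (T - m *\<^sub>C id_cblinfun)"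
  shows "f m = 0"
proof -
  let ?S = "T - m *\<^sub>C id_cblinfun"
  obtain p where p: "kernel (cblinfun_power ?S p) = kernel (cblinfun_power ?S (Suc p))"
    and cl: "closed (range_of (cblinfun_power ?S (Suc p)))"
    using LD by (rule left_Drazin_invertibleE)
  have "f m \<in> range_of (cblinfun_power ?S (Suc p))"
  proof (rule Lim_in_closed_set[OF cl])
    show "(f \<longlongrightarrow> f m) (at m)" using vector_analytic_isCont[OF f m] by (simp add: isCont_def)
    have "\<forall>\<^sub>F z in at m. z \<in> ball l r" using m by (intro eventually_at_in_open') auto
    moreover have "\<forall>\<^sub>F z in at m. z \<noteq> m" by (rule eventually_neq_at_within)
    ultimately show "\<forall>\<^sub>F z in at m. f z \<in> range_of (cblinfun_power ?S (Suc p))"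
    proof eventually_elim
      case (elim z)
      show ?case
        using elim by (intro eigenvector_in_range_power[where c="z - m"] kernel_shifted ker) auto
    qed
  qed simp
  then have "f m \<in> range_of (cblinfun_power ?S p)" using range_power_antimono[of p "Suc p" ?S] by auto
  moreover have "f m \<in> kernel ?S" using ker[OF m] by simp
  ultimately show ?thesis using p unfolding kernel_power_stable_iff by blast
qed

text \<open>
  \<open>S = T - l\<close> is injective on the range \<open>W\<close> of its \<open>p\<close>-th power and maps it onto another closed subspace, so it
  is bounded below there. An eigenvector of \<open>S\<close> in \<open>W\<close> therefore cannot have an eigenvalue of small modulus, and an
  eigenfunction vanishes near \<open>l\<close>.
\<close>

lemma SVEP_of_left_Drazin_invertible:
  fixes T :: "'a::complex_banach \<Rightarrow>\<^sub>C\<^sub>L 'a"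
  assumes LD: "left_Drazin_invertible (T - l *\<^sub>C id_cblinfun)"
    and fin: "deficiency (T - l *\<^sub>C id_cblinfun) < \<infinity>"
  shows "SVEP_at T l"
  unfolding SVEP_at_def
proof (intro allI impI ballI)
  fix r :: real and f w
  assume r: "0 < r" and w: "w \<in> ball l r"
    and "vector_analytic_on f (ball l r) \<and>
      (\<forall>z\<in>ball l r. cblinfun_apply (T - z *\<^sub>C id_cblinfun) (f z) = 0)"
  then have f: "vector_analytic_on f (ball l r)"
    and ker: "\<And>z. z \<in> ball l r \<Longrightarrow> cblinfun_apply (T - z *\<^sub>C id_cblinfun) (f z) = 0" by auto
  let ?S = "T - l *\<^sub>C id_cblinfun"
  obtain p where p: "kernel (cblinfun_power ?S p) = kernel (cblinfun_power ?S (Suc p))"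
    using LD by (rule left_Drazin_invertibleE)
  let ?W = "range_of (cblinfun_power ?S p)"
  have inj: "v = 0" if "v \<in> ?W" "cblinfun_apply ?S v = 0" for v
    using p that unfolding kernel_power_stable_iff by blast
  obtain C where C: "0 \<le> C"
    "\<And>w. w \<in> range_of (cblinfun_power ?S (Suc p)) \<Longrightarrow> \<exists>v\<in>?W. cblinfun_apply ?S v = w \<and> norm v \<le> C * norm w"
    using open_mapping[OF cblinfun_bounded_linear complex_subspace_real[OF subspace_range]
        closed_range_power[OF fin] complex_subspace_real[OF subspace_range]
        closed_range_power[OF fin] range_power_Suc[symmetric], of p] by blast
  have below: "norm v \<le> C * norm (cblinfun_apply ?S v)" if v: "v \<in> ?W" for v
  proof -
    have "cblinfun_apply ?S v \<in> range_of (cblinfun_power ?S (Suc p))"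
      using v unfolding range_power_Suc by blast
    then obtain v' where v': "v' \<in> ?W" "cblinfun_apply ?S v' = cblinfun_apply ?S v"
      "norm v' \<le> C * norm (cblinfun_apply ?S v)" using C(2) by blast
    have "v' - v \<in> ?W" by (rule complex_vector.subspace_diff[OF subspace_range v'(1) v])
    then have "v' - v = 0" by (rule inj) (simp add: cblinfun_diff v'(2))
    with v' show ?thesis by simp
  qed
  \<comment> \<open>Here \<open>C * cmod (z - l) < 1\<close>, so that \<open>z - l\<close> is too small for an eigenvalue of \<open>S\<close> on \<open>W\<close>.\<close>
  define U where "U = {z \<in> ball l r. z \<noteq> l \<and> dist l z < 1 / (C + 1)}"
  have "f z = 0" if z: "z \<in> U" for z
  proof -
    have zl: "z - l \<noteq> 0" and zr: "z \<in> ball l r" using z by (auto simp: U_def)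
    have ev: "cblinfun_apply ?S (f z) = (z - l) *\<^sub>C f z" by (rule kernel_shifted[OF ker[OF zr]])
    have "norm (f z) \<le> C * (cmod (z - l) * norm (f z))"
      using below[OF eigenvector_in_range_power[OF ev zl]] by (simp add: ev norm_scaleC)
    then have le: "norm (f z) \<le> (C * cmod (z - l)) * norm (f z)" by (simp add: mult.assoc)
    have "cmod (z - l) * (C + 1) < 1"
      using z C(1) by (simp add: U_def dist_norm norm_minus_commute field_simps)
    then have "C * cmod (z - l) + cmod (z - l) < 1" by (simp add: algebra_simps)
    then have "C * cmod (z - l) < 1" using norm_ge_zero[of "z - l"] by linarith
    then have "\<not> 0 < norm (f z)"
      using mult_strict_right_mono[of "C * cmod (z - l)" 1 "norm (f z)"] le by linarith
    then show ?thesis by simp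
  qed
  moreover have "l islimpt U"
  proof -
    have "U = (ball l r \<inter> ball l (1 / (C + 1))) - {l}" by (auto simp: U_def)
    moreover have "l islimpt (ball l r \<inter> ball l (1 / (C + 1)))"
      using r C(1) by (intro interior_limit_point) (simp add: interior_open)
    ultimately show ?thesis using islimpt_punctured by metis
  qed
  ultimately show "f w = 0"
    using r by (intro vector_identity_theorem[OF f _ _ _ _ w, of U l]) (auto simp: U_def)
qed

text \<open>
  An eigenfunction vanishes at every point outside the left Drazin spectrum. If \<open>l\<close> itself belongs to the
  spectrum, such points accumulate at \<open>l\<close>, and the identity theorem applies.
\<close>

lemma SVEP_of_left_Drazin_accumulation:
  fixes T :: "'a::complex_banach \<Rightarrow>\<^sub>C\<^sub>L 'a"
  assumes l: "l \<notin> interior (left_Drazin_spectrum T)" and fin: "deficiency (T - l *\<^sub>C id_cblinfun) < \<infinity>"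
  shows "SVEP_at T l"
proof (cases "l \<in> left_Drazin_spectrum T")
  case False
  then show ?thesis by (intro SVEP_of_left_Drazin_invertible fin) (simp add: left_Drazin_spectrum_def)
next
  case True
  show ?thesis
    unfolding SVEP_at_def
  proof (intro allI impI ballI)
    fix r :: real and f w
    assume r: "0 < r" and w: "w \<in> ball l r"
      and fk: "vector_analytic_on f (ball l r) \<and>
        (\<forall>z\<in>ball l r. cblinfun_apply (T - z *\<^sub>C id_cblinfun) (f z) = 0)"
    let ?U = "ball l r - left_Drazin_spectrum T"
    have "l islimpt ?U"
      unfolding islimpt_approachable
    proof (intro allI impI)
      fix e :: real assume e: "0 < e"
      have "\<not> ball l (min e r) \<subseteq> left_Drazin_spectrum T"
        using l e r by (meson centre_in_ball interiorI min_less_iff_conj open_ball)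
      then obtain z where "z \<in> ball l (min e r)" "z \<notin> left_Drazin_spectrum T" by blast
      then show "\<exists>z\<in>?U. z \<noteq> l \<and> dist z l < e"
        using True by (intro bexI[of _ z]) (auto simp: dist_commute)
    qed
    moreover have "f z = 0" if "z \<in> ?U" for z
      using that fk by (intro eigenfunction_vanishes_at_left_Drazin_point[of f l r z T])
        (auto simp: left_Drazin_spectrum_def)
    ultimately show "f w = 0"
      using fk r by (intro vector_identity_theorem[OF _ _ _ _ _ w, of f ?U l]) auto
  qed
qed

text \<open>
  The function \<open>f z = (\<Sum>n. (z - l) ^ n *\<^sub>C x n)\<close> satisfies \<open>(T - z) (f z) = 0\<close>, because \<open>S\<close> shifts its
  coefficients by one place, and \<open>f l = x 0\<close>.
\<close>

lemma SVEP_excludes_backward_orbit: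
  fixes T :: "'a::complex_banach \<Rightarrow>\<^sub>C\<^sub>L 'a"
  assumes svep: "SVEP_at T l" and S: "S = T - l *\<^sub>C id_cblinfun"
    and x: "cblinfun_apply S (x 0) = 0" "\<And>n. cblinfun_apply S (x (Suc n)) = x n"
    and C: "0 \<le> C" "\<And>n. norm (x n) \<le> A * C ^ n"
  shows "x 0 = 0"
proof -
  \<comment> \<open>The added \<open>1\<close> keeps the radius positive and the ratio \<open>r * C\<close> below one, also for \<open>C = 0\<close>.\<close>
  define r where "r = 1 / (C + 1)"
  have r: "0 < r" "r * C < 1" using C(1) by (simp_all add: r_def field_simps)
  obtain f where f: "vector_analytic_on f (ball l r)"
    and sums: "\<And>z. z \<in> ball l r \<Longrightarrow> (\<lambda>n. (z - l) ^ n *\<^sub>C x n) sums f z"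
    using power_series_analytic[OF C r] by metis
  have "cblinfun_apply (T - z *\<^sub>C id_cblinfun) (f z) = 0" if z: "z \<in> ball l r" for z
  proof -
    have "(\<lambda>n. cblinfun_apply S ((z - l) ^ n *\<^sub>C x n)) sums cblinfun_apply S (f z)"
      by (rule bounded_linear.sums[OF cblinfun_bounded_linear sums[OF z]])
    then have "(\<lambda>n. cblinfun_apply S ((z - l) ^ Suc n *\<^sub>C x (Suc n))) sums cblinfun_apply S (f z)"
      by (subst sums_Suc_iff) (simp add: cblinfun_scale x)
    moreover have "(\<lambda>n. (z - l) *\<^sub>C (z - l) ^ n *\<^sub>C x n) sums ((z - l) *\<^sub>C f z)"
      by (rule bounded_linear.sums[OF scaleC_right_bounded_linear sums[OF z]])
    ultimately have "cblinfun_apply S (f z) = (z - l) *\<^sub>C f z"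
      by (simp add: cblinfun_scale x scaleC_scaleC sums_unique2)
    then show ?thesis by (simp add: S shifted_apply complex_vector.scale_left_diff_distrib)
  qed
  then have "f l = 0" using svep f r(1) unfolding SVEP_at_def by force
  moreover have "(\<lambda>n. (l - l) ^ n *\<^sub>C x n) = (\<lambda>n. if n = 0 then x 0 else 0)"
    by (rule ext) (simp add: scaleC_one)
  then have "f l = x 0" using sums[of l] sums_single[of 0 "\<lambda>_. x 0"] r(1) by (simp add: sums_unique2)
  ultimately show ?thesis by simp
qed

text \<open>
  The subspaces \<open>R(S) + N(S^n)\<close> increase and have finite codimension, so they are constant from some \<open>d\<close> on.
  This forces \<open>N(S) \<inter> R(S^n)\<close> to be constant from \<open>d\<close> on, hence to lie in the intersection \<open>V\<close> of
  all the ranges. It also makes \<open>S\<close> map \<open>V\<close> onto \<open>V\<close>, and \<open>V\<close> is closed, so every element of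
  \<open>N(S) \<inter> V\<close> starts a backward orbit of geometric growth and must be zero. Working with
  \<open>R(S) + N(S^n)\<close> covers operators with an infinite-dimensional kernel.
\<close>

lemma SVEP_imp_finite_ascent:
  fixes T :: "'a::complex_banach \<Rightarrow>\<^sub>C\<^sub>L 'a"
  assumes svep: "SVEP_at T l" and fin: "deficiency (T - l *\<^sub>C id_cblinfun) < \<infinity>"
  shows "ascent (T - l *\<^sub>C id_cblinfun) < \<infinity>"
proof -
  define S where "S = T - l *\<^sub>C id_cblinfun"
  define M where "M n = {a + b |a b. a \<in> range_of S \<and> b \<in> kernel (cblinfun_power S n)}" for n
  have "\<exists>d. \<forall>n\<ge>d. M n = M d"
  proof (rule increasing_subspaces_stabilise)
    show "complex_vector.subspace (M n)" for n
      unfolding M_def by (rule complex_vector.subspace_sums[OF subspace_range subspace_kernel])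
    show "M n \<subseteq> M (Suc n)" for n
      unfolding M_def using kernel_power_mono_Suc[of S n] by blast
    have "y + 0 \<in> M 0" if "y \<in> range_of S" for y
      using that complex_vector.subspace_0[OF subspace_kernel[of "cblinfun_power S 0"]]
      unfolding M_def by blast
    then have "range_of S \<subseteq> M 0" by auto
    from codimension_antimono[OF this] fin
    show "codimension (M 0) < \<infinity>" unfolding deficiency_def S_def by (rule le_less_trans)
  qed
  then obtain d where d: "\<And>n. d \<le> n \<Longrightarrow> M n = M d" by blast
  let ?R = "\<lambda>n. range_of (cblinfun_power S n)"
  have descend: "kernel S \<inter> ?R n \<subseteq> ?R (Suc n)" if n: "d \<le> n" for n
  proof
    fix y assume y: "y \<in> kernel S \<inter> ?R n"
    then obtain x where x: "y = cblinfun_apply (cblinfun_power S n) x" by blast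
    have "x \<in> kernel (cblinfun_power S (Suc n))" using y x by (simp add: cblinfun_power_Suc)
    then have "0 + x \<in> M (Suc n)"
      unfolding M_def using complex_vector.subspace_0[OF subspace_range[of S]] by blast
    then have "x \<in> M n" using d[of n] d[of "Suc n"] n by simp
    then obtain a b where "x = cblinfun_apply S a + b" "cblinfun_apply (cblinfun_power S n) b = 0"
      by (auto simp: M_def)
    then have "y = cblinfun_apply (cblinfun_power S (Suc n)) a"
      using x by (simp add: cblinfun_add cblinfun_power_Suc_right)
    then show "y \<in> ?R (Suc n)" by blast
  qed
  \<comment> \<open>The elements of the eventual value of \<open>N(S) \<inter> R(S^n)\<close> lie in all the ranges.\<close>
  have deep: "kernel S \<inter> ?R d \<subseteq> ?R n" for n
  proof (cases "d \<le> n")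
    case True
    then show ?thesis
    proof (induction rule: dec_induct)
      case (step m)
      then show ?case using descend[of m] by blast
    qed blast
  qed (use range_power_antimono[of n d S] in auto)
  define V where "V = (\<Inter>n. ?R n)"
  have V: "complex_vector.subspace V"
    unfolding V_def by (intro complex_vector.subspace_Inter) (auto simp: subspace_range)
  have "closed V"
    unfolding V_def using fin by (intro closed_INT ballI closed_range_power) (simp add: S_def)
  have SV: "cblinfun_apply S ` V = V"
  proof
    show "cblinfun_apply S ` V \<subseteq> V"
    proof
      fix y assume "y \<in> cblinfun_apply S ` V"
      then obtain v where v: "v \<in> V" "y = cblinfun_apply S v" by blast
      have "y \<in> ?R n" for n
      proof -
        have "v \<in> ?R n" using v(1) unfolding V_def by blast
        then have "y \<in> ?R (Suc n)" unfolding range_power_Suc v(2) by (rule imageI)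
        then show ?thesis using range_power_antimono[of n "Suc n" S] by auto
      qed
      then show "y \<in> V" unfolding V_def by blast
    qed
    show "V \<subseteq> cblinfun_apply S ` V"
    proof
      fix y assume y: "y \<in> V"
      have pre: "\<exists>u\<in>?R n. cblinfun_apply S u = y" for n
      proof -
        have "y \<in> ?R (Suc n)" using y by (simp add: V_def)
        then show ?thesis unfolding range_power_Suc by blast
      qed
      obtain u where u: "u \<in> ?R d" "cblinfun_apply S u = y" using pre by blast
      \<comment> \<open>Two preimages in the range of the \<open>d\<close>-th power differ by an element of all the ranges.\<close>
      have "u \<in> ?R n" for n
      proof (cases "d \<le> n")
        case True
        obtain v where v: "v \<in> ?R n" "cblinfun_apply S v = y" using pre by blast
        have "v \<in> ?R d" using v(1) range_power_antimono[OF True] by blast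
        then have "u - v \<in> kernel S \<inter> ?R d"
          using u v complex_vector.subspace_diff[OF subspace_range, of u _ v] by (simp add: cblinfun_diff)
        then have "u - v \<in> ?R n" using deep by blast
        then have "(u - v) + v \<in> ?R n" using v(1) by (rule complex_vector.subspace_add[OF subspace_range])
        then show ?thesis by simp
      qed (use u range_power_antimono[of n d S] in auto)
      then show "y \<in> cblinfun_apply S ` V" using u by (auto simp: V_def)
    qed
  qed
  obtain C where C: "0 \<le> C" "\<And>w. w \<in> V \<Longrightarrow> \<exists>v\<in>V. cblinfun_apply S v = w \<and> norm v \<le> C * norm w"
    using open_mapping[OF cblinfun_bounded_linear complex_subspace_real[OF V] \<open>closed V\<close>
        complex_subspace_real[OF V] \<open>closed V\<close> SV] by blast
  then obtain g where g: "\<And>w. w \<in> V \<Longrightarrow> g w \<in> V" "\<And>w. w \<in> V \<Longrightarrow> cblinfun_apply S (g w) = w"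
    "\<And>w. w \<in> V \<Longrightarrow> norm (g w) \<le> C * norm w" by metis
  have "kernel S \<inter> ?R d \<subseteq> {0}"
  proof
    fix x assume x: "x \<in> kernel S \<inter> ?R d"
    define xs where "xs n = (g ^^ n) x" for n
    have xs0: "xs 0 = x" and xsS: "xs (Suc n) = g (xs n)" for n by (simp_all add: xs_def)
    have "x \<in> V" unfolding V_def using x deep by blast
    then have xsV: "xs n \<in> V" for n by (induction n) (simp_all add: xs0 xsS g(1))
    have bound: "norm (xs n) \<le> norm x * C ^ n" for n
    proof (induction n)
      case (Suc n)
      have "norm (xs (Suc n)) \<le> C * norm (xs n)" using g(3)[OF xsV] by (simp add: xsS)
      also have "\<dots> \<le> C * (norm x * C ^ n)" using Suc C(1) by (intro mult_left_mono)
      finally show ?case by (simp add: mult_ac)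
    qed (simp add: xs0)
    have "xs 0 = 0"
      by (rule SVEP_excludes_backward_orbit[OF svep S_def _ _ C(1) bound])
        (use x xsV g(2) in \<open>simp_all add: xs0 xsS\<close>)
    then show "x \<in> {0}" by (simp add: xs0)
  qed
  then have "ascent S < \<infinity>" using ascent_finite_iff kernel_power_stable_iff by blast
  then show ?thesis by (simp add: S_def)
qed

section \<open>Kernel and range of the adjoint\<close>

lemma cdual_eqI: "(\<And>x. cblinfun_apply \<phi> x = cblinfun_apply \<psi> x) \<Longrightarrow> \<phi> = \<psi>"
  by (metis cblinfun_apply_inject ext)

lemma dual_adjoint_eval:
  "cblinfun_apply (cblinfun_apply (dual_adjoint S) \<phi>) x = cblinfun_apply \<phi> (cblinfun_apply S x)"
  by (simp add: dual_adjoint_apply cblinfun_compose.rep_eq)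

lemma dual_adjoint_shifted:
  "dual_adjoint T - l *\<^sub>C id_cblinfun = dual_adjoint (T - l *\<^sub>C id_cblinfun)"
proof -
  have "cblinfun_apply (dual_adjoint T - l *\<^sub>C id_cblinfun) = cblinfun_apply (dual_adjoint (T - l *\<^sub>C id_cblinfun))"
    by (intro ext cdual_eqI)
      (simp add: shifted_apply dual_adjoint_eval minus_cblinfun.rep_eq scaleC_cblinfun.rep_eq
        id_cblinfun.rep_eq cblinfun_diff cblinfun_scale)
  then show ?thesis by (simp add: cblinfun_apply_inject)
qed

lemma dual_adjoint_power_eval:
  "cblinfun_apply (cblinfun_apply (cblinfun_power (dual_adjoint S) n) \<phi>) x =
    cblinfun_apply \<phi> (cblinfun_apply (cblinfun_power S n) x)"
  by (induction n arbitrary: x)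
    (simp_all add: cblinfun_power_0 cblinfun_power_Suc dual_adjoint_eval flip: cblinfun_power_Suc_right)

text \<open>
  The annihilator of the range: this turns descent of \<open>S\<close> into ascent of its adjoint.
\<close>

lemma kernel_dual_adjoint_power:
  "kernel (cblinfun_power (dual_adjoint S) n) =
    {\<phi>. \<forall>y\<in>range_of (cblinfun_power S n). cblinfun_apply \<phi> y = 0}"
proof -
  have "cblinfun_apply (cblinfun_power (dual_adjoint S) n) \<phi> = 0 \<longleftrightarrow>
      (\<forall>y\<in>range_of (cblinfun_power S n). cblinfun_apply \<phi> y = 0)" for \<phi> :: "'a cdual"
    by (auto simp: zero_cblinfun.rep_eq dual_adjoint_power_eval[symmetric]
        intro!: cdual_eqI)
  then show ?thesis by blast
qed

lemma kernel_dual_adjoint: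
  "kernel (dual_adjoint S) = {\<phi>. \<forall>x. cblinfun_apply \<phi> (cblinfun_apply S x) = 0}"
  using kernel_dual_adjoint_power[of S 1]
  by (simp add: cblinfun_power_Suc cblinfun_power_0)

lemma combination_eval:
  fixes \<phi> :: "'i \<Rightarrow> 'a::complex_normed_vector cdual"
  assumes "finite B"
  shows "cblinfun_apply (\<Sum>b\<in>B. u b *\<^sub>C \<phi> b) x = (\<Sum>b\<in>B. u b * cblinfun_apply (\<phi> b) x)"
  using assms by (induction B)
    (simp_all add: zero_cblinfun.rep_eq plus_cblinfun.rep_eq scaleC_cblinfun.rep_eq scaleC_complex_def)

text \<open>
  \<open>\<phi> b\<close> separates \<open>b\<close> from \<open>M + span (B - {b})\<close>, which is closed as a finite-dimensional extension of \<open>M\<close>.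
\<close>

lemma biorthogonal_functionals:
  fixes M :: "'a::complex_normed_vector set"
  assumes M: "complex_vector.subspace M" "closed M" and B: "finite B" "independent_mod M B"
  shows "\<exists>\<phi>::'a \<Rightarrow> 'a cdual. (\<forall>b\<in>B. \<forall>m\<in>M. cblinfun_apply (\<phi> b) m = 0) \<and>
    (\<forall>b\<in>B. \<forall>b'\<in>B. cblinfun_apply (\<phi> b) b' = (if b' = b then 1 else 0))"
proof -
  have "\<exists>\<phi>::'a cdual. (\<forall>m\<in>M. cblinfun_apply \<phi> m = 0) \<and>
      (\<forall>b'\<in>B. cblinfun_apply \<phi> b' = (if b' = b then 1 else 0))" if b: "b \<in> B" for b
  proof -
    let ?N = "{m + a |m a. m \<in> M \<and> a \<in> complex_vector.span (B - {b})}"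
    have N: "complex_vector.subspace ?N" by (rule subspace_add_span[OF M(1)])
    have "closed ?N" by (rule closed_add_span[OF M]) (simp add: B)
    moreover have "b \<notin> ?N"
    proof
      assume "b \<in> ?N"
      then obtain m a where ma: "b = m + a" "m \<in> M" "a \<in> complex_vector.span (B - {b})" by blast
      have "finite (B - {b})" using B(1) by simp
      then obtain u where u: "a = (\<Sum>c\<in>B - {b}. u c *\<^sub>C c)"
        using ma(3) unfolding complex_vector.span_finite[OF \<open>finite (B - {b})\<close>] by blast
      define v where "v c = (if c = b then 1 else - u c)" for c
      have "(\<Sum>c\<in>B. v c *\<^sub>C c) = b + (\<Sum>c\<in>B - {b}. v c *\<^sub>C c)"
        using sum.remove[OF B(1) b, of "\<lambda>c. v c *\<^sub>C c"] by (simp add: v_def scaleC_one)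
      also have "(\<Sum>c\<in>B - {b}. v c *\<^sub>C c) = - a"
        by (simp add: u v_def sum_negf)
      finally have "(\<Sum>c\<in>B. v c *\<^sub>C c) \<in> M" using ma by simp
      from independent_modD[OF B(2) this b] show False by (simp add: v_def)
    qed
    ultimately obtain \<phi> :: "'a cdual" where \<phi>: "\<forall>n\<in>?N. cblinfun_apply \<phi> n = 0" "cblinfun_apply \<phi> b = 1"
      using separate_point_closed_subspace[OF N] by blast
    have "m + 0 \<in> ?N" if "m \<in> M" for m using that complex_vector.span_zero by blast
    moreover have "0 + b' \<in> ?N" if "b' \<in> B" "b' \<noteq> b" for b'
      using that complex_vector.span_base[of b' "B - {b}"] complex_vector.subspace_0[OF M(1)] by blast
    ultimately show ?thesis using \<phi> by (intro exI[of _ \<phi>]) auto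
  qed
  then have "\<forall>b. \<exists>\<phi>::'a cdual. b \<in> B \<longrightarrow> (\<forall>m\<in>M. cblinfun_apply \<phi> m = 0) \<and>
      (\<forall>b'\<in>B. cblinfun_apply \<phi> b' = (if b' = b then 1 else 0))" by blast
  then obtain \<phi> :: "'a \<Rightarrow> 'a cdual" where "\<forall>b. b \<in> B \<longrightarrow> (\<forall>m\<in>M. cblinfun_apply (\<phi> b) m = 0) \<and>
      (\<forall>b'\<in>B. cblinfun_apply (\<phi> b) b' = (if b' = b then 1 else 0))" by metis
  then show ?thesis by blast
qed

lemma independent_mod_biorthogonal:
  fixes \<phi> :: "'a::complex_normed_vector \<Rightarrow> 'a cdual"
  assumes N: "complex_vector.subspace N" and B: "finite B"
    and bi: "\<And>b b'. b \<in> B \<Longrightarrow> b' \<in> B \<Longrightarrow> cblinfun_apply (\<phi> b) b' = (if b' = b then 1 else 0)"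
    and vanish: "\<And>\<psi> b. \<psi> \<in> N \<Longrightarrow> b \<in> B \<Longrightarrow> cblinfun_apply \<psi> b = 0"
  shows "independent_mod N (\<phi> ` B)" "card (\<phi> ` B) = card B"
proof -
  have zero: "\<forall>b\<in>B. u b = 0" if "(\<Sum>b\<in>B. u b *\<^sub>C \<phi> b) \<in> N" for u
  proof
    fix b' assume b': "b' \<in> B"
    have "0 = (\<Sum>b\<in>B. u b * cblinfun_apply (\<phi> b) b')"
      using vanish[OF that b'] by (simp add: combination_eval[OF B])
    also have "\<dots> = (\<Sum>b\<in>B. if b = b' then u b' else 0)"
      by (intro sum.cong) (auto simp: bi b')
    finally show "u b' = 0" using B b' by simp
  qed
  show "independent_mod N (\<phi> ` B)" "card (\<phi> ` B) = card B"
    using independent_mod_family[OF N B zero] by (auto simp: card_image)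
qed

text \<open>
  A bound for the dimension of a space of functionals by the number of points that determine them; it
  estimates both the kernel and the cokernel of an adjoint.
\<close>

lemma card_functionals_le:
  fixes \<Phi> :: "'a::complex_normed_vector cdual set"
  assumes \<Phi>: "finite \<Phi>" "independent_mod N \<Phi>" and B: "finite B" "independent_mod M B" "0 \<in> M"
    and vanish: "\<And>\<psi>. \<psi> \<in> complex_vector.span \<Phi> \<Longrightarrow> (\<And>b. b \<in> B \<Longrightarrow> cblinfun_apply \<psi> b = 0) \<Longrightarrow> \<psi> \<in> N"
  shows "card \<Phi> \<le> card B"
proof -
  \<comment> \<open>The values on \<open>B\<close> determine a functional, and they are coordinates in the span of \<open>B\<close>.\<close>
  define s where "s \<phi> = (\<Sum>b\<in>B. cblinfun_apply \<phi> b *\<^sub>C b)" for \<phi> :: "'a cdual"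
  have sub0: "complex_vector.subspace {0::'a}" by simp
  have zero: "\<forall>\<phi>\<in>\<Phi>. u \<phi> = 0" if "(\<Sum>\<phi>\<in>\<Phi>. u \<phi> *\<^sub>C s \<phi>) \<in> {0}" for u
  proof -
    let ?\<psi> = "\<Sum>\<phi>\<in>\<Phi>. u \<phi> *\<^sub>C \<phi>"
    have "(\<Sum>b\<in>B. cblinfun_apply ?\<psi> b *\<^sub>C b) = (\<Sum>\<phi>\<in>\<Phi>. u \<phi> *\<^sub>C s \<phi>)"
      by (simp add: s_def combination_eval[OF \<Phi>(1), of u "\<lambda>\<phi>. \<phi>"] complex_vector.scale_sum_left
          complex_vector.scale_sum_right scaleC_scaleC) (rule sum.swap)
    then have "(\<Sum>b\<in>B. cblinfun_apply ?\<psi> b *\<^sub>C b) \<in> M" using that B(3) by simp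
    then have "cblinfun_apply ?\<psi> b = 0" if "b \<in> B" for b using independent_modD[OF B(2)] that by blast
    moreover have "?\<psi> \<in> complex_vector.span \<Phi>"
      by (intro complex_vector.span_sum complex_vector.span_scale complex_vector.span_base)
    ultimately have "?\<psi> \<in> N" using vanish by blast
    then show ?thesis using independent_modD[OF \<Phi>(2)] by blast
  qed
  have fam: "inj_on s \<Phi>" "independent_mod {0} (s ` \<Phi>)"
    by (rule independent_mod_family[OF sub0 \<Phi>(1) zero]; assumption)+
  have "card (s ` \<Phi>) \<le> card B"
  proof (rule independent_mod_card_le[OF sub0 B(1) _ fam(2)])
    show "\<exists>b\<in>complex_vector.span B. c - b \<in> {0}" if "c \<in> s ` \<Phi>" for c
    proof -
      have "s \<phi> \<in> complex_vector.span B" for \<phi>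
        unfolding s_def
        by (intro complex_vector.span_sum complex_vector.span_scale complex_vector.span_base)
      then show ?thesis using that by (intro bexI[of _ c]) auto
    qed
  qed (simp add: \<Phi>)
  then show ?thesis by (simp add: card_image[OF fam(1)])
qed

lemma nullity_dual_adjoint_le:
  assumes fin: "deficiency S < \<infinity>"
  shows "nullity (dual_adjoint S) \<le> deficiency S"
proof -
  obtain B where B: "finite B" "independent_mod (range_of S) B" "spans_mod (range_of S) B"
    "deficiency S = enat (card B)"
    using complementary_basis[OF subspace_range] fin unfolding deficiency_def by metis
  have "card \<Phi> \<le> card B" if \<Phi>: "finite \<Phi>" "independent_mod {0} \<Phi>" "\<Phi> \<subseteq> kernel (dual_adjoint S)" for \<Phi>
  proof (rule card_functionals_le[OF \<Phi>(1,2) B(1,2)])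
    show "0 \<in> range_of S" by (rule complex_vector.subspace_0[OF subspace_range])
    fix \<psi> assume \<psi>: "\<psi> \<in> complex_vector.span \<Phi>" and zero: "\<And>b. b \<in> B \<Longrightarrow> cblinfun_apply \<psi> b = 0"
    have "\<psi> \<in> kernel (dual_adjoint S)"
      using \<psi> \<Phi>(3) complex_vector.span_minimal[OF _ subspace_kernel] by blast
    then have range0: "cblinfun_apply \<psi> (cblinfun_apply S x) = 0" for x
      unfolding kernel_dual_adjoint by blast
    have span0: "cblinfun_apply \<psi> b = 0" if "b \<in> complex_vector.span B" for b
      using complex_vector.span_minimal[OF _ subspace_kernel, of B \<psi>] zero that by blast
    have "cblinfun_apply \<psi> x = cblinfun_apply 0 x" for x
    proof -
      obtain b y where "b \<in> complex_vector.span B" "x - b = cblinfun_apply S y"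
        using B(3) by (rule spans_mod_rangeE)
      then have "cblinfun_apply \<psi> (x - b) = 0" "cblinfun_apply \<psi> b = 0"
        using range0 span0 by simp_all
      then show ?thesis by (simp add: cblinfun_diff zero_cblinfun.rep_eq)
    qed
    then show "\<psi> \<in> {0}" using cdual_eqI by blast
  qed
  then show ?thesis unfolding nullity_def B(4) by (intro cdimension_le subspace_kernel)
qed

lemma deficiency_le_nullity_dual_adjoint:
  fixes S :: "'a::complex_normed_vector \<Rightarrow>\<^sub>C\<^sub>L 'a"
  assumes "closed (range_of S)"
  shows "deficiency S \<le> nullity (dual_adjoint S)"
  unfolding deficiency_def codimension_def
proof (rule SUP_least)
  fix B assume "B \<in> {B. finite B \<and> independent_mod (range_of S) B}"
  then have B: "finite B" "independent_mod (range_of S) B" by auto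
  obtain \<phi> :: "'a \<Rightarrow> 'a cdual" where "(\<forall>b\<in>B. \<forall>m\<in>range_of S. cblinfun_apply (\<phi> b) m = 0) \<and>
      (\<forall>b\<in>B. \<forall>b'\<in>B. cblinfun_apply (\<phi> b) b' = (if b' = b then 1 else 0))"
    using biorthogonal_functionals[OF subspace_range assms B] by blast
  then have \<phi>: "\<And>b m. b \<in> B \<Longrightarrow> m \<in> range_of S \<Longrightarrow> cblinfun_apply (\<phi> b) m = 0"
    "\<And>b b'. b \<in> B \<Longrightarrow> b' \<in> B \<Longrightarrow> cblinfun_apply (\<phi> b) b' = (if b' = b then 1 else 0)"
    by blast+
  have sub0: "complex_vector.subspace {0}" by simp
  have *: "independent_mod {0} (\<phi> ` B)" "card (\<phi> ` B) = card B"
    by (rule independent_mod_biorthogonal[OF sub0 B(1) \<phi>(2)]; simp add: zero_cblinfun.rep_eq)+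
  have "\<phi> ` B \<subseteq> kernel (dual_adjoint S)" unfolding kernel_dual_adjoint using \<phi>(1) by auto
  from card_le_cdimension[OF _ *(1) this subspace_kernel] B(1) *(2)
  show "enat (card B) \<le> nullity (dual_adjoint S)" by (simp add: nullity_def)
qed

lemma nullity_le_deficiency_dual_adjoint:
  fixes S :: "'a::complex_normed_vector \<Rightarrow>\<^sub>C\<^sub>L 'a"
  shows "nullity S \<le> deficiency (dual_adjoint S)"
proof (cases "deficiency (dual_adjoint S)")
  case (enat n)
  have "card B \<le> n" if B: "finite B" "independent_mod {0} B" "B \<subseteq> kernel S" for B
  proof -
    have sub0: "complex_vector.subspace {0::'a}" by simp
    obtain \<phi> :: "'a \<Rightarrow> 'a cdual" where
      \<phi>: "\<And>b b'. b \<in> B \<Longrightarrow> b' \<in> B \<Longrightarrow> cblinfun_apply (\<phi> b) b' = (if b' = b then 1 else 0)"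
      using biorthogonal_functionals[OF sub0 closed_singleton B(1,2)] by blast
    have vanish: "cblinfun_apply \<psi> b = 0" if "\<psi> \<in> range_of (dual_adjoint S)" "b \<in> B" for \<psi> b
      using that B(3) by (auto simp: dual_adjoint_eval cblinfun_zero)
    have "independent_mod (range_of (dual_adjoint S)) (\<phi> ` B)" "card (\<phi> ` B) = card B"
      by (rule independent_mod_biorthogonal[OF subspace_range B(1) \<phi> vanish]; assumption)+
    then have "enat (card B) \<le> codimension (range_of (dual_adjoint S))"
      using card_le_codimension[of "\<phi> ` B"] B(1) by (metis finite_imageI)
    with enat show ?thesis by (simp add: deficiency_def)
  qed
  then show ?thesis unfolding enat nullity_def by (intro cdimension_le subspace_kernel)
qed simp

text \<open>
  A functional \<open>\<phi>\<close> that vanishes on the kernel factors through \<open>S\<close>. The factor is bounded on the range of \<open>S\<close> by the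
  open mapping theorem, and its Hahn-Banach extension is a preimage of \<open>\<phi>\<close>.
\<close>

lemma range_dual_adjoint:
  fixes S :: "'a::complex_banach \<Rightarrow>\<^sub>C\<^sub>L 'a"
  assumes cl: "closed (range_of S)"
  shows "range_of (dual_adjoint S) = {\<phi>. \<forall>x\<in>kernel S. cblinfun_apply \<phi> x = 0}"
proof
  show "range_of (dual_adjoint S) \<subseteq> {\<phi>. \<forall>x\<in>kernel S. cblinfun_apply \<phi> x = 0}"
    by (auto simp: dual_adjoint_eval cblinfun_zero)
  show "{\<phi>. \<forall>x\<in>kernel S. cblinfun_apply \<phi> x = 0} \<subseteq> range_of (dual_adjoint S)"
  proof
    fix \<phi> :: "'a cdual" assume "\<phi> \<in> {\<phi>. \<forall>x\<in>kernel S. cblinfun_apply \<phi> x = 0}"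
    then have \<phi>: "\<And>x. cblinfun_apply S x = 0 \<Longrightarrow> cblinfun_apply \<phi> x = 0" by blast
    obtain C where C: "0 \<le> C" "\<And>w. w \<in> range_of S \<Longrightarrow> \<exists>v. cblinfun_apply S v = w \<and> norm v \<le> C * norm w"
      using open_mapping[OF cblinfun_bounded_linear subspace_UNIV closed_UNIV
          complex_subspace_real[OF subspace_range] cl refl] by blast
    define f where "f y = cblinfun_apply \<phi> (SOME x. cblinfun_apply S x = y)" for y
    have f: "f (cblinfun_apply S x) = cblinfun_apply \<phi> x" for x
    proof -
      have "cblinfun_apply S (SOME z. cblinfun_apply S z = cblinfun_apply S x) = cblinfun_apply S x"
        by (rule someI[of _ x]) simp
      from \<phi>[of "(SOME z. cblinfun_apply S z = cblinfun_apply S x) - x"] this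
      show ?thesis by (simp add: f_def cblinfun_diff)
    qed
    have p: "cseminorm (\<lambda>x::'a. (norm \<phi> * C) * norm x)"
    proof (rule cseminormI)
      show "(norm \<phi> * C) * norm (x + y) \<le> (norm \<phi> * C) * norm x + (norm \<phi> * C) * norm y" for x y :: 'a
        unfolding distrib_left[symmetric] using C(1) by (intro mult_left_mono norm_triangle_ineq) simp
    qed (simp add: norm_scaleC mult_ac)
    have "\<exists>\<psi>::'a cdual. (\<forall>x. cmod (cblinfun_apply \<psi> x) \<le> (norm \<phi> * C) * norm x) \<and>
        (\<forall>x\<in>range_of S. cblinfun_apply \<psi> x = f x)"
    proof (rule Hahn_Banach_complex[OF p order_refl subspace_range])
      show "f (x + y) = f x + f y" if xy: "x \<in> range_of S" "y \<in> range_of S" for x y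
      proof -
        obtain a b where "x = cblinfun_apply S a" "y = cblinfun_apply S b" using xy by blast
        then show ?thesis using f[of "a + b"] by (simp add: f cblinfun_add)
      qed
      show "f (c *\<^sub>C x) = c * f x" if x: "x \<in> range_of S" for c x
      proof -
        obtain a where "x = cblinfun_apply S a" using x by blast
        then show ?thesis using f[of "c *\<^sub>C a"] by (simp add: f cblinfun_scale scaleC_complex_def)
      qed
      show "cmod (f x) \<le> (norm \<phi> * C) * norm x" if "x \<in> range_of S" for x
      proof -
        obtain v where v: "cblinfun_apply S v = x" "norm v \<le> C * norm x" using C(2)[OF \<open>x \<in> range_of S\<close>] by blast
        have "cmod (f x) \<le> norm \<phi> * norm v" using norm_cblinfun_apply[of \<phi> v] v(1) f[of v] by simp
        also have "\<dots> \<le> norm \<phi> * (C * norm x)" using v(2) by (intro mult_left_mono) simp_all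
        finally show ?thesis by (simp add: mult.assoc)
      qed
    qed
    then obtain \<psi> :: "'a cdual" where "\<And>x. x \<in> range_of S \<Longrightarrow> cblinfun_apply \<psi> x = f x" by blast
    then have "\<phi> = cblinfun_apply (dual_adjoint S) \<psi>"
      by (intro cdual_eqI) (simp add: dual_adjoint_eval f)
    then show "\<phi> \<in> range_of (dual_adjoint S)" by blast
  qed
qed

lemma closed_range_dual_adjoint:
  fixes S :: "'a::complex_banach \<Rightarrow>\<^sub>C\<^sub>L 'a"
  assumes cl: "closed (range_of S)"
  shows "closed (range_of (dual_adjoint S))"
proof -
  have "closed {\<phi> :: 'a cdual. cblinfun_apply \<phi> x = 0}" for x
  proof -
    have "bounded_linear (\<lambda>\<phi> :: 'a cdual. cblinfun_apply \<phi> x)"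
      by (rule bounded_linear_intro[where K="norm x"])
        (simp_all add: plus_cblinfun.rep_eq scaleR_cblinfun.rep_eq norm_cblinfun_apply)
    then have "closed ((\<lambda>\<phi> :: 'a cdual. cblinfun_apply \<phi> x) -` {0})"
      by (intro closed_vimage linear_continuous_on) auto
    then show ?thesis by (simp add: vimage_def)
  qed
  then have "closed (\<Inter>x\<in>kernel S. {\<phi> :: 'a cdual. cblinfun_apply \<phi> x = 0})" by (intro closed_INT) blast
  also have "(\<Inter>x\<in>kernel S. {\<phi> :: 'a cdual. cblinfun_apply \<phi> x = 0}) = range_of (dual_adjoint S)"
    unfolding range_dual_adjoint[OF cl] by blast
  finally show ?thesis .
qed

lemma deficiency_dual_adjoint_le:
  fixes S :: "'a::complex_banach \<Rightarrow>\<^sub>C\<^sub>L 'a"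
  assumes cl: "closed (range_of S)"
  shows "deficiency (dual_adjoint S) \<le> nullity S"
proof (cases "nullity S < \<infinity>")
  case True
  then obtain B where B: "finite B" "independent_mod {0} B" "complex_vector.span B = kernel S"
    "nullity S = enat (card B)"
    using cdimension_finite_basis[OF subspace_kernel, of S] unfolding nullity_def by metis
  have "card \<Phi> \<le> card B" if \<Phi>: "finite \<Phi>" "independent_mod (range_of (dual_adjoint S)) \<Phi>" for \<Phi>
  proof (rule card_functionals_le[OF \<Phi> B(1,2)])
    fix \<psi> :: "'a cdual" assume "\<And>b. b \<in> B \<Longrightarrow> cblinfun_apply \<psi> b = 0"
    then have "complex_vector.span B \<subseteq> kernel \<psi>"
      by (intro complex_vector.span_minimal subspace_kernel) blast
    then show "\<psi> \<in> range_of (dual_adjoint S)" unfolding range_dual_adjoint[OF cl] using B(3) by blast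
  qed simp
  then show ?thesis
    unfolding deficiency_def codimension_def B(4) by (intro SUP_least) auto
qed simp

section \<open>The closed range theorem\<close>

lemma complex_subspace_closure:
  fixes M :: "'a::complex_normed_vector set"
  assumes M: "complex_vector.subspace M"
  shows "complex_vector.subspace (closure M)"
proof (rule complex_vector.subspaceI)
  show "0 \<in> closure M" by (rule subsetD[OF closure_subset complex_vector.subspace_0[OF M]])
next
  fix x y assume "x \<in> closure M" "y \<in> closure M"
  then obtain f g where fg: "\<And>n. f n \<in> M" "f \<longlonglongrightarrow> x" "\<And>n. g n \<in> M" "g \<longlonglongrightarrow> y"
    unfolding closure_sequential by blast
  show "x + y \<in> closure M"
    unfolding closure_sequential
    by (intro exI[of _ "\<lambda>n. f n + g n"] conjI allI tendsto_add fg complex_vector.subspace_add[OF M])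
next
  fix c x assume "x \<in> closure M"
  then obtain f where f: "\<And>n. f n \<in> M" "f \<longlonglongrightarrow> x"
    unfolding closure_sequential by blast
  show "c *\<^sub>C x \<in> closure M"
    unfolding closure_sequential
    by (intro exI[of _ "\<lambda>n. c *\<^sub>C f n"] conjI allI f complex_vector.subspace_scale[OF M]
        bounded_linear.tendsto[OF scaleC_right_bounded_linear])
qed

text \<open>
  The difficult half of the closed range theorem. The seminorm \<open>p K y\<close>, the infimum of
  \<open>norm x + K * norm (y - S x)\<close>, measures how well \<open>S x = y\<close> can be solved approximately. A functional \<open>\<psi>\<close> dominated
  by it and normed at \<open>y\<close> satisfies \<open>norm (\<psi> \<circ> S) \<le> 1\<close>. The closed range of the adjoint provides \<open>\<phi>\<close> with
  \<open>\<phi> \<circ> S = \<psi> \<circ> S\<close> and a norm bound \<open>C\<close> independent of \<open>K\<close>, and \<open>\<phi> y = \<psi> y\<close> for \<open>y\<close> in the closure of the range.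
  Hence \<open>p K y \<le> C * norm y\<close> for all \<open>K\<close>, and a large \<open>K\<close> makes the residual small.
\<close>

lemma closed_range_of_closed_range_dual_adjoint:
  fixes S :: "'a::complex_banach \<Rightarrow>\<^sub>C\<^sub>L 'a"
  assumes cl: "closed (range_of (dual_adjoint S))"
  shows "closed (range_of S)"
proof -
  obtain C where C: "0 \<le> C" "\<And>\<theta>. \<theta> \<in> range_of (dual_adjoint S) \<Longrightarrow>
      \<exists>\<phi>. cblinfun_apply (dual_adjoint S) \<phi> = \<theta> \<and> norm \<phi> \<le> C * norm \<theta>"
    using open_mapping[OF cblinfun_bounded_linear subspace_UNIV closed_UNIV
        complex_subspace_real[OF subspace_range] cl refl] by blast
  let ?W = "closure (range_of S)"
  define p where "p K y = (INF x. norm x + K * norm (y - cblinfun_apply S x))" for K y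
  have low: "p K y \<le> norm x + K * norm (y - cblinfun_apply S x)" if "0 \<le> K" for K x y
    unfolding p_def using that by (intro cINF_lower bdd_belowI2[where m=0]) auto
  have great: "m \<le> p K y" if "\<And>x. m \<le> norm x + K * norm (y - cblinfun_apply S x)" for m K y
    unfolding p_def using that by (intro cINF_greatest) auto
  have semi: "cseminorm (p K)" if K: "0 \<le> K" for K
  proof (rule cseminormI)
    fix y z
    have 1: "p K (y + z) \<le> (norm x + K * norm (y - cblinfun_apply S x)) +
        (norm x' + K * norm (z - cblinfun_apply S x'))" for x x'
    proof -
      have "p K (y + z) \<le> norm (x + x') + K * norm ((y + z) - cblinfun_apply S (x + x'))"
        by (rule low[OF K])
      also have "(y + z) - cblinfun_apply S (x + x') = (y - cblinfun_apply S x) + (z - cblinfun_apply S x')"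
        by (simp add: cblinfun_add)
      also have "norm (x + x') + K * norm \<dots> \<le>
          (norm x + norm x') + K * (norm (y - cblinfun_apply S x) + norm (z - cblinfun_apply S x'))"
        using K by (intro add_mono mult_left_mono norm_triangle_ineq)
      finally show ?thesis by (simp add: distrib_left)
    qed
    have "p K (y + z) - (norm x + K * norm (y - cblinfun_apply S x)) \<le> p K z" for x
      by (rule great) (use 1[of x] in \<open>simp add: algebra_simps\<close>)
    then have "p K (y + z) - p K z \<le> p K y"
      by (intro great) (simp add: algebra_simps)
    then show "p K (y + z) \<le> p K y + p K z" by simp
  next
    fix c y
    show "p K (c *\<^sub>C y) \<le> cmod c * p K y"
    proof (cases "c = 0")
      case True
      then show ?thesis using low[OF K, of 0 0] by (simp add: cblinfun_zero)
    next
      case False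
      have "p K (c *\<^sub>C y) / cmod c \<le> norm x + K * norm (y - cblinfun_apply S x)" for x
      proof -
        have "p K (c *\<^sub>C y) \<le> norm (c *\<^sub>C x) + K * norm (c *\<^sub>C y - cblinfun_apply S (c *\<^sub>C x))"
          by (rule low[OF K])
        also have "\<dots> = cmod c * (norm x + K * norm (y - cblinfun_apply S x))"
          by (simp add: cblinfun_scale norm_scaleC distrib_left mult_ac
              flip: complex_vector.scale_right_diff_distrib)
        finally show ?thesis using False by (simp add: field_simps)
      qed
      then have "p K (c *\<^sub>C y) / cmod c \<le> p K y" by (rule great)
      then show ?thesis using False by (simp add: field_simps)
    qed
  qed
  have key: "p K y \<le> C * norm y" if K: "0 \<le> K" and y: "y \<in> ?W" for K y
  proof -
    have pK: "p K x \<le> K * norm x" for x using low[OF K, of x 0] by (simp add: cblinfun_zero)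
    obtain \<psi> :: "'a cdual" where \<psi>: "\<And>x. cmod (cblinfun_apply \<psi> x) \<le> p K x" "cblinfun_apply \<psi> y = p K y"
      using Hahn_Banach_at_point[OF semi[OF K] pK] by blast
    have "norm (cblinfun_apply (dual_adjoint S) \<psi>) \<le> 1"
    proof (rule norm_cblinfun_bound)
      show "norm (cblinfun_apply (cblinfun_apply (dual_adjoint S) \<psi>) x) \<le> 1 * norm x" for x
        using \<psi>(1)[of "cblinfun_apply S x"] low[OF K, of "cblinfun_apply S x" x]
        by (simp add: dual_adjoint_eval)
    qed simp
    moreover obtain \<phi> where \<phi>: "cblinfun_apply (dual_adjoint S) \<phi> = cblinfun_apply (dual_adjoint S) \<psi>"
      "norm \<phi> \<le> C * norm (cblinfun_apply (dual_adjoint S) \<psi>)" using C(2) by blast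
    ultimately have "norm \<phi> \<le> C * 1" using C(1) by (meson mult_left_mono order_trans)
    \<comment> \<open>\<open>\<phi>\<close> and \<open>\<psi>\<close> agree on the range of \<open>S\<close>, hence on its closure.\<close>
    have "cblinfun_apply (\<phi> - \<psi>) (cblinfun_apply S x) = 0" for x
      using \<phi>(1) by (metis cblinfun_diff diff_self dual_adjoint_eval minus_cblinfun.rep_eq)
    then have "range_of S \<subseteq> kernel (\<phi> - \<psi>)" by auto
    moreover have "closed (cblinfun_apply (\<phi> - \<psi>) -` {0})"
      by (intro closed_vimage linear_continuous_on cblinfun_bounded_linear) auto
    then have "closed (kernel (\<phi> - \<psi>))" by (simp add: vimage_def)
    ultimately have "?W \<subseteq> kernel (\<phi> - \<psi>)" by (rule closure_minimal)
    then have "cblinfun_apply \<phi> y = p K y" using y \<psi>(2) by (auto simp: minus_cblinfun.rep_eq)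
    then have "p K y \<le> cmod (cblinfun_apply \<phi> y)" by simp
    also have "\<dots> \<le> norm \<phi> * norm y" by (rule norm_cblinfun_apply)
    also have "\<dots> \<le> C * norm y" using \<open>norm \<phi> \<le> C * 1\<close> by (intro mult_right_mono) simp_all
    finally show ?thesis .
  qed
  have W: "complex_vector.subspace ?W"
    by (rule complex_subspace_closure[OF subspace_range])
  have approx: "\<exists>x\<in>UNIV. norm x \<le> (C + 1) * norm w \<and> norm (w - cblinfun_apply S x) \<le> norm w / 2"
    if w: "w \<in> ?W" for w
  proof (cases "w = 0")
    case False
    \<comment> \<open>With this weight a value below \<open>(C + 1) * norm w\<close> leaves a residual of at most \<open>norm w / 2\<close>.\<close>
    let ?K = "2 * (C + 1)"
    have K: "0 \<le> ?K" using C(1) by simp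
    have "p ?K w < (C + 1) * norm w"
    proof -
      have "0 < norm w" using False by simp
      then show ?thesis using key[OF K w] unfolding distrib_right by linarith
    qed
    then obtain x where x: "norm x + ?K * norm (w - cblinfun_apply S x) < (C + 1) * norm w"
      using great[of "(C + 1) * norm w" ?K w] by (meson not_le)
    moreover have "0 \<le> ?K * norm (w - cblinfun_apply S x)" using K by simp
    ultimately have "norm x \<le> (C + 1) * norm w" by linarith
    moreover have "(C + 1) * (2 * norm (w - cblinfun_apply S x)) \<le> (C + 1) * norm w"
    proof -
      have "?K * norm (w - cblinfun_apply S x) \<le> (C + 1) * norm w"
        using x norm_ge_zero[of x] by linarith
      then show ?thesis by (simp add: algebra_simps)
    qed
    then have "norm (w - cblinfun_apply S x) \<le> norm w / 2" using C(1) by simp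
    ultimately show ?thesis by blast
  qed (auto simp: cblinfun_zero intro!: exI[of _ 0])
  have "w \<in> range_of S" if "w \<in> ?W" for w
  proof -
    have "w' - cblinfun_apply S v \<in> ?W" if "w' \<in> ?W" for w' v
      using that by (intro complex_vector.subspace_diff[OF W]) (auto intro: subsetD[OF closure_subset])
    from approximate_solvability_imp_solvability[OF cblinfun_bounded_linear subspace_UNIV closed_UNIV
        this approx \<open>w \<in> ?W\<close>]
    show ?thesis by blast
  qed
  then show ?thesis using closure_subset_eq by blast
qed

section \<open>Duality of semi-Weyl operators, ascent and descent\<close>

lemma lower_semi_Weyl_iff:
  "lower_semi_Weyl S \<longleftrightarrow> closed (range_of S) \<and> deficiency S < \<infinity> \<and> deficiency S \<le> nullity S"
proof -
  have "0 \<le> index S \<longleftrightarrow> deficiency S \<le> nullity S" if "deficiency S < \<infinity>"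
    using that unfolding index_def by (cases "nullity S"; cases "deficiency S") auto
  then show ?thesis by (auto simp: lower_semi_Weyl_def lower_semi_Fredholm_def)
qed

lemma upper_semi_Weyl_iff:
  "upper_semi_Weyl S \<longleftrightarrow> closed (range_of S) \<and> nullity S < \<infinity> \<and> nullity S \<le> deficiency S"
proof -
  have "index S \<le> 0 \<longleftrightarrow> nullity S \<le> deficiency S" if "nullity S < \<infinity>"
    using that unfolding index_def by (cases "nullity S"; cases "deficiency S") auto
  then show ?thesis by (auto simp: upper_semi_Weyl_def upper_semi_Fredholm_def)
qed

text \<open>
  By the closed range theorem both operators have closed range, and passing to the adjoint exchanges
  nullity and deficiency.
\<close>

theorem upper_semi_Weyl_dual_adjoint_iff:
  fixes S :: "'a::complex_banach \<Rightarrow>\<^sub>C\<^sub>L 'a"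
  shows "upper_semi_Weyl (dual_adjoint S) \<longleftrightarrow> lower_semi_Weyl S"
proof
  assume "upper_semi_Weyl (dual_adjoint S)"
  then have cl': "closed (range_of (dual_adjoint S))" and fin: "nullity (dual_adjoint S) < \<infinity>"
    and le: "nullity (dual_adjoint S) \<le> deficiency (dual_adjoint S)" by (auto simp: upper_semi_Weyl_iff)
  have cl: "closed (range_of S)" by (rule closed_range_of_closed_range_dual_adjoint[OF cl'])
  note deficiency_le_nullity_dual_adjoint[OF cl]
  moreover from this fin have "deficiency S < \<infinity>" by (rule le_less_trans)
  moreover note le deficiency_dual_adjoint_le[OF cl]
  ultimately show "lower_semi_Weyl S" using cl unfolding lower_semi_Weyl_iff by (meson order_trans)
next
  assume "lower_semi_Weyl S"
  then have cl: "closed (range_of S)" and fin: "deficiency S < \<infinity>" and le: "deficiency S \<le> nullity S"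
    by (auto simp: lower_semi_Weyl_iff)
  note nullity_dual_adjoint_le[OF fin]
  moreover from this fin have "nullity (dual_adjoint S) < \<infinity>" by (rule le_less_trans)
  moreover note le nullity_le_deficiency_dual_adjoint[of S]
  ultimately show "upper_semi_Weyl (dual_adjoint S)"
    using closed_range_dual_adjoint[OF cl] unfolding upper_semi_Weyl_iff by (meson order_trans)
qed

text \<open>
  Closed subspaces are determined by their annihilators, and the kernels of the powers of the adjoint are
  the annihilators of the ranges of the powers.
\<close>

lemma finite_ascent_dual_adjoint_iff:
  fixes S :: "'a::complex_normed_vector \<Rightarrow>\<^sub>C\<^sub>L 'a"
  assumes cl: "\<And>n. closed (range_of (cblinfun_power S n))"
  shows "ascent (dual_adjoint S) < \<infinity> \<longleftrightarrow>
    (\<exists>q. range_of (cblinfun_power S q) = range_of (cblinfun_power S (Suc q)))"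
proof -
  let ?R = "\<lambda>q. range_of (cblinfun_power S q)"
  have "?R q = ?R (Suc q)"
    if eq: "kernel (cblinfun_power (dual_adjoint S) q) = kernel (cblinfun_power (dual_adjoint S) (Suc q))" for q
  proof
    show "?R (Suc q) \<subseteq> ?R q" by (rule range_power_antimono) simp
    show "?R q \<subseteq> ?R (Suc q)"
    proof (rule subsetI, rule ccontr)
      fix y assume y: "y \<in> ?R q" "y \<notin> ?R (Suc q)"
      obtain \<phi> :: "'a cdual" where "\<forall>m\<in>?R (Suc q). cblinfun_apply \<phi> m = 0" "cblinfun_apply \<phi> y = 1"
        using separate_point_closed_subspace[OF subspace_range cl y(2)] by blast
      then have "\<phi> \<in> kernel (cblinfun_power (dual_adjoint S) (Suc q))" "cblinfun_apply \<phi> y = 1"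
        unfolding kernel_dual_adjoint_power by auto
      then show False using y(1) unfolding eq[symmetric] kernel_dual_adjoint_power by auto
    qed
  qed
  moreover have "kernel (cblinfun_power (dual_adjoint S) q) = kernel (cblinfun_power (dual_adjoint S) (Suc q))"
    if "?R q = ?R (Suc q)" for q
    unfolding kernel_dual_adjoint_power that ..
  ultimately show ?thesis unfolding ascent_finite_iff by blast
qed

section \<open>Isolated points of the spectrum\<close>

text \<open>
  Finite descent means that \<open>S\<close> maps \<open>W = R(S^q)\<close> onto itself, and this persists for \<open>S - c\<close> with small \<open>c\<close>.
  Modulo \<open>W\<close> the operator \<open>S\<close> is nilpotent, so \<open>S - c\<close> is onto there for every nonzero \<open>c\<close>: \<open>S - c\<close>
  divides \<open>S^q - c^q\<close>, and \<open>S^q x\<close> belongs to \<open>W\<close>.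
\<close>

lemma surjective_perturbation:
  fixes S :: "'a::complex_banach \<Rightarrow>\<^sub>C\<^sub>L 'a"
  assumes eq: "range_of (cblinfun_power S q) = range_of (cblinfun_power S (Suc q))"
    and cl: "closed (range_of (cblinfun_power S q))"
  shows "\<exists>e>0. \<forall>c. c \<noteq> 0 \<and> cmod c < e \<longrightarrow> surj (cblinfun_apply (S - c *\<^sub>C id_cblinfun))"
proof -
  let ?W = "range_of (cblinfun_power S q)"
  have SW: "cblinfun_apply S ` ?W = ?W" using range_power_Suc[of S q] eq by simp
  obtain C where C: "0 \<le> C" "\<And>w. w \<in> ?W \<Longrightarrow> \<exists>v\<in>?W. cblinfun_apply S v = w \<and> norm v \<le> C * norm w"
    using open_mapping[OF cblinfun_bounded_linear complex_subspace_real[OF subspace_range] cl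
        complex_subspace_real[OF subspace_range] cl SW] by blast
  define e where "e = 1 / (2 * (C + 1))"
  have e: "0 < e" using C(1) by (simp add: e_def)
  have "surj (cblinfun_apply (S - c *\<^sub>C id_cblinfun))" if c: "c \<noteq> 0" "cmod c < e" for c
  proof -
    let ?S = "S - c *\<^sub>C id_cblinfun"
    let ?R = "range_of ?S"
    have inv: "w - cblinfun_apply ?S v \<in> ?W" if w: "w \<in> ?W" and v: "v \<in> ?W" for w v
    proof -
      have "cblinfun_apply S v \<in> ?W" using v SW by blast
      then have "w - (cblinfun_apply S v - c *\<^sub>C v) \<in> ?W"
        by (intro complex_vector.subspace_diff[OF subspace_range] w
            complex_vector.subspace_scale[OF subspace_range] v)
      then show ?thesis by (simp add: shifted_apply)
    qed
    have approx: "\<exists>v\<in>?W. norm v \<le> C * norm w \<and> norm (w - cblinfun_apply ?S v) \<le> norm w / 2"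
      if w: "w \<in> ?W" for w
    proof -
      obtain v where v: "v \<in> ?W" "cblinfun_apply S v = w" "norm v \<le> C * norm w" using C(2)[OF w] by blast
      have "norm (w - cblinfun_apply ?S v) = cmod c * norm v"
        by (simp add: shifted_apply v(2) norm_scaleC)
      also have "\<dots> \<le> e * (C * norm w)" using c(2) v(3) e by (intro mult_mono) simp_all
      also have "\<dots> \<le> e * ((C + 1) * norm w)" using e C(1) by (intro mult_left_mono mult_right_mono) simp_all
      also have "\<dots> = norm w / 2" using C(1) by (simp add: e_def field_simps)
      finally show ?thesis using v by blast
    qed
    have WR: "?W \<subseteq> ?R"
    proof
      fix w assume "w \<in> ?W"
      from approximate_solvability_imp_solvability[OF cblinfun_bounded_linear
          complex_subspace_real[OF subspace_range] cl inv approx this]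
      obtain v where "cblinfun_apply ?S v = w" by blast
      then show "w \<in> ?R" by blast
    qed
    \<comment> \<open>\<open>S\<close> acts as the scalar \<open>c\<close> modulo the range of \<open>S - c\<close>.\<close>
    have mod: "cblinfun_apply (cblinfun_power S n) x - c ^ n *\<^sub>C x \<in> ?R" for n x
    proof (induction n arbitrary: x)
      case 0
      then show ?case
        using complex_vector.subspace_0[OF subspace_range[of ?S]] by (simp add: cblinfun_power_0 scaleC_one)
    next
      case (Suc n)
      have "cblinfun_apply (cblinfun_power S (Suc n)) x - c ^ Suc n *\<^sub>C x =
          (cblinfun_apply (cblinfun_power S n) (cblinfun_apply S x) - c ^ n *\<^sub>C cblinfun_apply S x) +
          c ^ n *\<^sub>C cblinfun_apply ?S x"
        by (simp add: cblinfun_power_Suc_right shifted_apply complex_vector.scale_right_diff_distrib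
            scaleC_scaleC mult.commute)
      also have "\<dots> \<in> ?R"
        by (intro complex_vector.subspace_add[OF subspace_range] Suc
            complex_vector.subspace_scale[OF subspace_range] rangeI)
      finally show ?case .
    qed
    have "x \<in> ?R" for x
    proof -
      have "cblinfun_apply (cblinfun_power S q) x \<in> ?R" using WR by blast
      from complex_vector.subspace_diff[OF subspace_range this mod[of q x]]
      have "c ^ q *\<^sub>C x \<in> ?R" by simp
      then have "inverse (c ^ q) *\<^sub>C c ^ q *\<^sub>C x \<in> ?R" by (rule complex_vector.subspace_scale[OF subspace_range])
      then show ?thesis using c(1) by (simp add: scaleC_scaleC scaleC_one)
    qed
    then show ?thesis by blast
  qed
  then show ?thesis using e by blast
qed

lemma SVEP_of_isolated_kernel:
  fixes T :: "'a::complex_normed_vector \<Rightarrow>\<^sub>C\<^sub>L 'a"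
  assumes e: "0 < e"
    and inj: "\<And>z. z \<noteq> l \<Longrightarrow> cmod (z - l) < e \<Longrightarrow> kernel (T - z *\<^sub>C id_cblinfun) = {0}"
  shows "SVEP_at T l"
  unfolding SVEP_at_def
proof (intro allI impI ballI)
  fix r :: real and f w
  assume r: "0 < r" and w: "w \<in> ball l r"
    and fk: "vector_analytic_on f (ball l r) \<and>
      (\<forall>z\<in>ball l r. cblinfun_apply (T - z *\<^sub>C id_cblinfun) (f z) = 0)"
  let ?U = "(ball l r \<inter> ball l e) - {l}"
  have "l islimpt (ball l r \<inter> ball l e)"
    using r e by (intro interior_limit_point) (simp add: interior_open)
  then have "l islimpt ?U" using islimpt_punctured by metis
  moreover have "f z = 0" if z: "z \<in> ?U" for z
  proof -
    have "f z \<in> kernel (T - z *\<^sub>C id_cblinfun)" using fk z by blast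
    then show ?thesis using inj[of z] z by (auto simp: dist_norm norm_minus_commute)
  qed
  ultimately show "f w = 0"
    using fk r by (intro vector_identity_theorem[OF _ _ _ _ _ w, of f ?U l]) auto
qed

text \<open>
  The set-theoretic inverse of a bijective bounded operator is bounded by the open mapping theorem.
\<close>

lemma notin_spectrum_iff:
  fixes T :: "'a::complex_banach \<Rightarrow>\<^sub>C\<^sub>L 'a"
  shows "l \<notin> spectrum T \<longleftrightarrow>
    surj (cblinfun_apply (T - l *\<^sub>C id_cblinfun)) \<and> kernel (T - l *\<^sub>C id_cblinfun) = {0}"
proof
  let ?S = "T - l *\<^sub>C id_cblinfun"
  assume "l \<notin> spectrum T"
  then obtain R where R: "R o\<^sub>C\<^sub>L ?S = id_cblinfun" "?S o\<^sub>C\<^sub>L R = id_cblinfun"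
    by (auto simp: spectrum_def)
  have 1: "cblinfun_apply R (cblinfun_apply ?S x) = x" and 2: "cblinfun_apply ?S (cblinfun_apply R x) = x" for x
    using R by (metis cblinfun_compose.rep_eq id_cblinfun.rep_eq)+
  show "surj (cblinfun_apply ?S) \<and> kernel ?S = {0}"
  proof
    show "surj (cblinfun_apply ?S)" by (rule surjI[of _ "cblinfun_apply R"]) (rule 2)
    show "kernel ?S = {0}"
    proof (intro set_eqI iffI)
      show "x \<in> {0}" if "x \<in> kernel ?S" for x using that 1[of x] by (simp add: cblinfun_zero)
    qed (simp add: cblinfun_zero)
  qed
next
  let ?S = "T - l *\<^sub>C id_cblinfun"
  assume asm: "surj (cblinfun_apply ?S) \<and> kernel ?S = {0}"
  have inj: "x = y" if "cblinfun_apply ?S x = cblinfun_apply ?S y" for x y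
  proof -
    have "x - y \<in> kernel ?S" using that by (simp add: cblinfun_diff)
    then show ?thesis using asm by simp
  qed
  obtain C where C: "\<And>w. \<exists>v. cblinfun_apply ?S v = w \<and> norm v \<le> C * norm w"
    using open_mapping[OF cblinfun_bounded_linear subspace_UNIV closed_UNIV
        subspace_UNIV closed_UNIV conjunct1[OF asm]] by auto
  then obtain g where g: "\<And>w. cblinfun_apply ?S (g w) = w" "\<And>w. norm (g w) \<le> C * norm w" by metis
  have "\<exists>R. cblinfun_apply R = g"
    by (rule cblinfun_of_bounded[OF _ _ g(2)]; rule inj; simp only: cblinfun_add cblinfun_scale g)
  then obtain R where R: "cblinfun_apply R = g" by blast
  have "R o\<^sub>C\<^sub>L ?S = id_cblinfun"
    by (rule cblinfun_apply_inject[THEN iffD1], rule ext, rule inj)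
      (simp only: cblinfun_compose.rep_eq id_cblinfun.rep_eq R g)
  moreover have "?S o\<^sub>C\<^sub>L R = id_cblinfun"
    by (rule cblinfun_apply_inject[THEN iffD1], rule ext)
      (simp only: cblinfun_compose.rep_eq id_cblinfun.rep_eq R g)
  ultimately show "l \<notin> spectrum T" by (auto simp: spectrum_def)
qed

lemma deficiency_surj:
  assumes "surj (cblinfun_apply S)"
  shows "deficiency S = 0"
proof -
  have "spans_mod (range_of S) {}" using assms by (auto simp: spans_mod_def)
  then show ?thesis
    unfolding deficiency_def using codimension_le_card[OF subspace_range, of "{}" S]
    by (simp add: zero_enat_def[symmetric])
qed

lemma kernel_trivial_of_nullity_zero:
  assumes "nullity S = 0"
  shows "kernel S = {0}"
proof -
  have "cdimension (kernel S) < \<infinity>" using assms by (simp add: nullity_def)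
  then obtain B where B: "finite B" "complex_vector.span B = kernel S" "nullity S = enat (card B)"
    unfolding nullity_def by (rule cdimension_finite_basis[OF subspace_kernel])
  then have "B = {}" using assms by (simp add: zero_enat_def)
  with B(2) show ?thesis by simp
qed

lemma upper_semi_Browder_imp_upper_semi_Weyl:
  assumes "upper_semi_Browder S"
  shows "upper_semi_Weyl S"
proof (cases "deficiency S < \<infinity>")
  case True
  then show ?thesis
    using assms finite_ascent_finite_deficiency(1)[of S]
    by (auto simp: upper_semi_Weyl_iff upper_semi_Browder_def upper_semi_Fredholm_def)
next
  case False
  then show ?thesis
    using assms by (auto simp: upper_semi_Weyl_iff upper_semi_Browder_def upper_semi_Fredholm_def)
qed

lemma left_Drazin_imp_finite_ascent: "left_Drazin_invertible S \<Longrightarrow> ascent S < \<infinity>"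
  by (auto simp: left_Drazin_invertible_def)

section \<open>The equivalences\<close>

text \<open>
  At a point \<open>l\<close> where the adjoint is upper semi-Weyl, \<open>S = T - l\<close> is lower semi-Weyl and by assumption
  has finite ascent. Finite ascent forces nullity at most deficiency, so \<open>S\<close> has index zero and finite
  descent, which is finite ascent of the adjoint.
\<close>

lemma a_Browder_dual_adjoint:
  fixes T :: "'a::complex_banach \<Rightarrow>\<^sub>C\<^sub>L 'a"
  assumes LD: "left_Drazin_spectrum T \<subseteq> lower_semi_Weyl_spectrum T"
  shows "a_Browder_theorem_holds (dual_adjoint T)"
proof -
  have "upper_semi_Weyl (dual_adjoint T - l *\<^sub>C id_cblinfun) \<longleftrightarrow>
      upper_semi_Browder (dual_adjoint T - l *\<^sub>C id_cblinfun)" for l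
  proof
    assume W: "upper_semi_Weyl (dual_adjoint T - l *\<^sub>C id_cblinfun)"
    let ?S = "T - l *\<^sub>C id_cblinfun"
    have S: "lower_semi_Weyl ?S"
      using W unfolding dual_adjoint_shifted upper_semi_Weyl_dual_adjoint_iff .
    then have "left_Drazin_invertible ?S"
      using LD by (auto simp: left_Drazin_spectrum_def lower_semi_Weyl_spectrum_def)
    then have asc: "ascent ?S < \<infinity>" by (rule left_Drazin_imp_finite_ascent)
    have fin: "deficiency ?S < \<infinity>" and le: "deficiency ?S \<le> nullity ?S"
      using S by (auto simp: lower_semi_Weyl_iff)
    have "ascent (dual_adjoint ?S) < \<infinity>"
      using finite_ascent_dual_adjoint_iff[OF closed_range_power[OF fin]]
        finite_ascent_finite_deficiency(2)[OF asc fin le] by blast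
    then show "upper_semi_Browder (dual_adjoint T - l *\<^sub>C id_cblinfun)"
      using W by (simp add: dual_adjoint_shifted upper_semi_Browder_def upper_semi_Weyl_def)
  qed (rule upper_semi_Browder_imp_upper_semi_Weyl)
  then show ?thesis
    by (simp add: a_Browder_theorem_holds_def upper_semi_Weyl_spectrum_def upper_semi_Browder_spectrum_def)
qed

text \<open>
  A surjective \<open>T - l\<close> is lower semi-Weyl, hence of finite ascent by assumption, and then its nullity is at most its
  deficiency, which is zero.
\<close>

lemma spectrum_eq_surjectivity_spectrum:
  fixes T :: "'a::complex_banach \<Rightarrow>\<^sub>C\<^sub>L 'a"
  assumes LD: "left_Drazin_spectrum T \<subseteq> lower_semi_Weyl_spectrum T"
  shows "spectrum T = surjectivity_spectrum T"
proof -
  have "kernel (T - l *\<^sub>C id_cblinfun) = {0}" if s: "surj (cblinfun_apply (T - l *\<^sub>C id_cblinfun))" for l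
  proof -
    let ?S = "T - l *\<^sub>C id_cblinfun"
    have d0: "deficiency ?S = 0" by (rule deficiency_surj[OF s])
    then have "lower_semi_Weyl ?S" using s by (simp add: lower_semi_Weyl_iff)
    then have "left_Drazin_invertible ?S"
      using LD by (auto simp: left_Drazin_spectrum_def lower_semi_Weyl_spectrum_def)
    then have "nullity ?S \<le> deficiency ?S"
      using d0 by (intro finite_ascent_finite_deficiency(1) left_Drazin_imp_finite_ascent) simp_all
    then show ?thesis using d0 by (intro kernel_trivial_of_nullity_zero) simp
  qed
  then have "l \<notin> spectrum T \<longleftrightarrow> l \<notin> surjectivity_spectrum T" for l
    unfolding notin_spectrum_iff surjectivity_spectrum_def by blast
  then show ?thesis by blast
qed

text \<open>
  The adjoint of \<open>S = T - l\<close> is upper semi-Weyl, hence of finite ascent, so \<open>S\<close> has finite descent and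
  \<open>T - z\<close> is surjective for all \<open>z \<noteq> l\<close> near \<open>l\<close>. As the two spectra agree, it is injective there, and so
  eigenfunctions vanish near \<open>l\<close>.
\<close>

lemma SVEP_of_a_Browder_dual_adjoint:
  fixes T :: "'a::complex_banach \<Rightarrow>\<^sub>C\<^sub>L 'a"
  assumes aB: "a_Browder_theorem_holds (dual_adjoint T)" and sp: "spectrum T = surjectivity_spectrum T"
    and l: "lower_semi_Weyl (T - l *\<^sub>C id_cblinfun)"
  shows "SVEP_at T l"
proof -
  let ?S = "T - l *\<^sub>C id_cblinfun"
  have fin: "deficiency ?S < \<infinity>" using l by (auto simp: lower_semi_Weyl_iff)
  have "upper_semi_Weyl (dual_adjoint T - l *\<^sub>C id_cblinfun)"
    unfolding dual_adjoint_shifted upper_semi_Weyl_dual_adjoint_iff by (rule l)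
  then have "upper_semi_Browder (dual_adjoint T - l *\<^sub>C id_cblinfun)"
    using aB unfolding a_Browder_theorem_holds_def upper_semi_Weyl_spectrum_def
      upper_semi_Browder_spectrum_def by blast
  then have "ascent (dual_adjoint ?S) < \<infinity>" by (simp add: dual_adjoint_shifted upper_semi_Browder_def)
  then obtain q where "range_of (cblinfun_power ?S q) = range_of (cblinfun_power ?S (Suc q))"
    using finite_ascent_dual_adjoint_iff[OF closed_range_power[OF fin]] by blast
  then obtain e where e: "0 < e"
    "\<And>c. c \<noteq> 0 \<Longrightarrow> cmod c < e \<Longrightarrow> surj (cblinfun_apply (?S - c *\<^sub>C id_cblinfun))"
    using surjective_perturbation[OF _ closed_range_power[OF fin]] by metis
  have "kernel (T - z *\<^sub>C id_cblinfun) = {0}" if z: "z \<noteq> l" "cmod (z - l) < e" for z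
  proof -
    have eq: "?S - (z - l) *\<^sub>C id_cblinfun = T - z *\<^sub>C id_cblinfun"
      by (simp add: complex_vector.scale_left_diff_distrib)
    have "surj (cblinfun_apply (T - z *\<^sub>C id_cblinfun))" using e(2)[of "z - l"] z unfolding eq by simp
    then have "z \<notin> spectrum T" unfolding sp surjectivity_spectrum_def by blast
    then show ?thesis unfolding notin_spectrum_iff by blast
  qed
  then show ?thesis by (rule SVEP_of_isolated_kernel[OF e(1)])
qed

theorem theorem3p5:
  fixes T :: "'a::complex_banach \<Rightarrow>\<^sub>C\<^sub>L 'a"
  assumes infinite_dimensional: "cdimension (UNIV :: 'a set) = \<infinity>"
  shows
    "(interior (left_Drazin_spectrum T) \<subseteq> lower_semi_Weyl_spectrum T
       \<longleftrightarrow> (\<forall>l. l \<notin> lower_semi_Weyl_spectrum T \<longrightarrow> SVEP_at T l))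
     \<and> ((\<forall>l. l \<notin> lower_semi_Weyl_spectrum T \<longrightarrow> SVEP_at T l)
       \<longleftrightarrow> left_Drazin_spectrum T \<subseteq> lower_semi_Weyl_spectrum T)
     \<and> (left_Drazin_spectrum T \<subseteq> lower_semi_Weyl_spectrum T
       \<longleftrightarrow> a_Browder_theorem_holds (dual_adjoint T) \<and> spectrum T = surjectivity_spectrum T)"
    (is "(?i \<longleftrightarrow> ?ii) \<and> (?ii \<longleftrightarrow> ?iii) \<and> (?iii \<longleftrightarrow> ?iv)")
proof -
  have fin: "deficiency (T - l *\<^sub>C id_cblinfun) < \<infinity>" if "l \<notin> lower_semi_Weyl_spectrum T" for l
    using that by (auto simp: lower_semi_Weyl_spectrum_def lower_semi_Weyl_iff)
  have "?iii \<Longrightarrow> ?i" using interior_subset by blast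
  moreover have "?i \<Longrightarrow> ?ii" using SVEP_of_left_Drazin_accumulation fin by (meson subsetD)
  moreover have "?ii \<Longrightarrow> ?iii"
  proof (rule subsetI, rule ccontr)
    fix l assume ?ii and LD: "l \<in> left_Drazin_spectrum T" and l: "l \<notin> lower_semi_Weyl_spectrum T"
    then have "left_Drazin_invertible (T - l *\<^sub>C id_cblinfun)"
      by (intro left_Drazin_invertibleI SVEP_imp_finite_ascent closed_range_power fin) blast+
    with LD show False by (simp add: left_Drazin_spectrum_def)
  qed
  moreover have "?iii \<Longrightarrow> ?iv"
    using a_Browder_dual_adjoint spectrum_eq_surjectivity_spectrum by blast
  moreover have "?iv \<Longrightarrow> ?ii"
    using SVEP_of_a_Browder_dual_adjoint by (auto simp: lower_semi_Weyl_spectrum_def)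
  ultimately show ?thesis by blast
qed

end
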